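(* Let $d$ be an even integer with $2<d\le 12$, and let $f$ be a sharp polynomial in $\mathcal{H}(2,d)$. Then, possibly after swapping the variables $x$ and $y$ in $f$, there exist odd positive integers $a,b$ with $a+b=d$, a sharp polynomial $p\in\mathcal{H}(2,a)$ and a sharp polynomial $q\in\mathcal{H}(2,b)$ such that, writing $p(x,y)=x^a+y^a+p_0(x,y)$ with $\deg p_0<a$, one has $$f(x,y)=x^a+y^a\,q(x,y)+p_0(x,y).$$
   Context: $\mathcal{H}(2,d)$ denotes the set of real polynomials $p(x,y)$ of degree exactly $d$ with nonnegative coefficients such that $p(x,y)=1$ whenever $x+y=1$. For a polynomial $p$, $N(p)$ is the number of distinct monomials with nonzero coefficient in $p$. A polynomial $p\in\mathcal{H}(2,d)$ is called sharp if $N(p)$ is minimal among all elements of $\mathcal{H}(2,d)$. It is a fact that every sharp polynomial $p\in\mathcal{H}(2,a)$ with $a$ odd has degree-$a$ homogeneous part equal to $x^a+y^a$, so that it can be written as $p=x^a+y^a+p_0$ with $\deg p_0<a$. *)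

theory Defs
  imports "HOL-Computational_Algebra.Polynomial"
begin

(* A polynomial p(x,y) in R[x,y] is represented in R[x][y]: the outer variable is y,
   the inner variable is x. *)

type_synonym bipoly = "real poly poly"

(* coefficient of x^i y^j *)
definition coeff2 :: "bipoly \<Rightarrow> nat \<Rightarrow> nat \<Rightarrow> real" where
  "coeff2 p i j = coeff (coeff p j) i"

definition eval2 :: "bipoly \<Rightarrow> real \<Rightarrow> real \<Rightarrow> real" where
  "eval2 p x y = poly (poly p [:y:]) x"

definition varX :: bipoly where
  "varX = [:[:0, 1:]:]"

definition varY :: bipoly where
  "varY = [:0, 1:]"

(* exponent pairs (i,j) of the monomials x^i y^j with nonzero coefficient *)
definition support2 :: "bipoly \<Rightarrow> (nat \<times> nat) set" where
  "support2 p = {(i, j). coeff2 p i j \<noteq> 0}"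

definition num_terms :: "bipoly \<Rightarrow> nat" where
  "num_terms p = card (support2 p)"

(* Total degree; as for the library's degree, the zero polynomial gets degree 0. *)
definition total_degree :: "bipoly \<Rightarrow> nat" where
  "total_degree p = Max (insert 0 ((\<lambda>(i, j). i + j) ` support2 p))"

(* p(y,x); see coeff2_swap_vars *)
definition swap_vars :: "bipoly \<Rightarrow> bipoly" where
  "swap_vars p = (\<Sum>(i, j)\<in>support2 p. monom (monom (coeff2 p i j) j) i)"

definition H2 :: "nat \<Rightarrow> bipoly set" where
  "H2 d = {p. total_degree p = d
            \<and> (\<forall>i j. coeff2 p i j \<ge> 0)
            \<and> (\<forall>x y. x + y = 1 \<longrightarrow> eval2 p x y = 1)}"

definition sharp :: "nat \<Rightarrow> bipoly \<Rightarrow> bool" where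
  "sharp d p \<longleftrightarrow> p \<in> H2 d \<and> (\<forall>q\<in>H2 d. num_terms p \<le> num_terms q)"

(* In particular the Max above and the cardinality in num_terms are taken over finite sets. *)
lemma finite_support2: "finite (support2 p)"
proof (rule finite_subset)
  show "support2 p \<subseteq> (\<Union>j\<in>{..degree p}. {..degree (coeff p j)} \<times> {j})"
  proof (clarify)
    fix i j assume "(i, j) \<in> support2 p"
    then have nz: "coeff (coeff p j) i \<noteq> 0"
      by (simp add: support2_def coeff2_def)
    then have "coeff p j \<noteq> 0" by auto
    then have "j \<le> degree p" by (rule le_degree)
    moreover have "i \<le> degree (coeff p j)" using nz by (rule le_degree)
    ultimately show "(i, j) \<in> (\<Union>j\<in>{..degree p}. {..degree (coeff p j)} \<times> {j})" by auto
  qed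
  show "finite (\<Union>j\<in>{..degree p}. {..degree (coeff p j)} \<times> {j})" by auto
qed

lemma coeff2_swap_vars: "coeff2 (swap_vars p) i j = coeff2 p j i"
proof -
  have "coeff2 (swap_vars p) i j =
      (\<Sum>z\<in>support2 p. if z = (j, i) then coeff2 p j i else 0)"
    unfolding swap_vars_def coeff2_def[of "sum _ _"] coeff_sum
    by (intro sum.cong) (auto split: if_splits)
  also have "\<dots> = (if (j, i) \<in> support2 p then coeff2 p j i else 0)"
    using finite_support2 by simp
  also have "\<dots> = coeff2 p j i"
    by (simp add: support2_def)
  finally show ?thesis .
qed

end

theory Submission
  imports Defs
begin

text \<open>
  Write f - 1 = (x + y - 1) g and let N be the number of monomials of f. Going from the homogeneous
  part g_k to (x + y) g_k = f_(k+1) + g_(k+1) creates a new sign alternation (as in Descartes' rule,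
  after x is replaced by -x), while each monomial of f_(k+1) destroys at most two, and only one if
  it lies at an end of the layer. Counting up to the top degree d gives d + 1 + E + t \<le> 2 N, where
  t is the number of monomials of degree d and E the number of monomials at the ends of lower layers.
  In particular d + 3 \<le> 2 N.

  For even d \<le> 12 a sharp f has 2 N \<le> d + 4, so E + t \<le> 3, and the ends of the layers
  are then known: up to a swap, x^a, x^(d-m) y^m and y^d belong to the support, m is odd, and
  all other monomials lie in the interior. If m = a, then cutting g along the row j = a
  splits f into p and q, and the lower bounds for N turn into equalities for both of them.

  The case m < a is excluded by certificates. If L(i,j) = L(i+1,j) + L(i,j+1) for i + j < d, then
  the sum of f_ij L(i,j) is L(0,0). So if L(0,0) is positive, or nonnegative with L(0,d) < 0, then
  the support contains a monomial with L > 0. The tables L below were found by linear programming;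
  no d/2 - 1 interior monomials meet all the resulting conditions, which is checked
  by a branching search whose choices are recorded in a tree.
\<close>

section \<open>The quotient by x + y - 1\<close>

text \<open>The tables L are dual vectors. A linear functional sending x^i y^j to L(i,j) kills all
  multiples of x + y - 1 up to degree d exactly when L(i,j) = L(i+1,j) + L(i,j+1) for i + j < d, so
  its value at f equals its value at 1. Because the coefficients of f are nonnegative, each table
  yields a statement about the support alone, and the problem for m < a becomes a finite covering
  problem without unknown coefficients. The sign count cannot replace the tables: it fixes the ends
  of the layers but does not by itself decide whether m = a. The bound 12 enters twice, through
  explicit polynomials with (d + 4) / 2 monomials and through the certificates. The split at m = a
  holds in any degree. There the monomial y^a of p is replaced by y^a q, so N(f) = N(p) + N(q) - 1;
  with the bounds 2 N(p) \<ge> a + 3 and 2 N(q) \<ge> b + 3 this leaves no slack below 2 N(f) = d +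
  4.\<close>

fun quot :: "(nat \<Rightarrow> nat \<Rightarrow> real) \<Rightarrow> nat \<Rightarrow> nat \<Rightarrow> real" where
  "quot c 0 0 = 1 - c 0 0"
| "quot c (Suc i) 0 = quot c i 0 - c (Suc i) 0"
| "quot c 0 (Suc j) = quot c 0 j - c 0 (Suc j)"
| "quot c (Suc i) (Suc j) = quot c i (Suc j) + quot c (Suc i) j - c (Suc i) (Suc j)"

text \<open>\<open>quot c\<close> is (1 - c) / (1 - x - y) as a formal power series, so it exists
  for every array \<open>c\<close>; divisibility by x + y - 1 turns into the vanishing of its layers
  from the degree on. The guards put the four cases of the recursion into one equation.\<close>

lemma coeff_quot:
  "c i j = (if i = 0 \<and> j = 0 then 1 else 0) + (if i = 0 then 0 else quot c (i - 1) j)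
    + (if j = 0 then 0 else quot c i (j - 1)) - quot c i j"
  by (cases i; cases j) auto

lemma quot_flip: "quot (\<lambda>i j. c j i) i j = quot c j i"
  by (induction c i j rule: quot.induct) auto

text \<open>Summation by parts: after inserting the recursion, each entry of the quotient is paired
  with L(i+1,j) + L(i,j+1) - L(i,j), which is zero below degree n. Only the source 1 at the origin
  and the last layer survive. Nothing is assumed about \<open>c\<close>, so partial sums by degree
  are covered too.\<close>

lemma harmonic_sum:
  fixes L :: "nat \<Rightarrow> nat \<Rightarrow> real"
  assumes "\<And>i j. i + j < n \<Longrightarrow> L i j = L (Suc i) j + L i (Suc j)"
  shows "(\<Sum>k\<le>n. \<Sum>i\<le>k. c i (k - i) * L i (k - i)) =
    L 0 0 - (\<Sum>i\<le>n. quot c i (n - i) * L i (n - i))"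
  using assms
proof (induction n)
  case 0
  then show ?case by (simp add: algebra_simps)
next
  case (Suc n)
  let ?g = "quot c"
  have "(\<Sum>i\<le>Suc n. c i (Suc n - i) * L i (Suc n - i)) =
      (\<Sum>i\<le>Suc n. (if i = 0 then 0 else ?g (i - 1) (Suc n - i)) * L i (Suc n - i))
      + (\<Sum>i\<le>Suc n. (if i = Suc n then 0 else ?g i (n - i)) * L i (Suc n - i))
      - (\<Sum>i\<le>Suc n. ?g i (Suc n - i) * L i (Suc n - i))"
    unfolding sum.distrib[symmetric] sum_subtractf[symmetric]
  proof (rule sum.cong)
    fix i assume "i \<in> {..Suc n}"
    then have "c i (Suc n - i) = (if i = 0 then 0 else ?g (i - 1) (Suc n - i))
      + (if i = Suc n then 0 else ?g i (n - i)) - ?g i (Suc n - i)"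
      using coeff_quot[of c i "Suc n - i"] by auto
    then show "c i (Suc n - i) * L i (Suc n - i) =
        (if i = 0 then 0 else ?g (i - 1) (Suc n - i)) * L i (Suc n - i)
        + (if i = Suc n then 0 else ?g i (n - i)) * L i (Suc n - i)
        - ?g i (Suc n - i) * L i (Suc n - i)"
      by (simp only: ring_distribs)
  qed simp
  also have "(\<Sum>i\<le>Suc n. (if i = 0 then 0 else ?g (i - 1) (Suc n - i)) * L i (Suc n - i)) =
      (\<Sum>i\<le>n. ?g i (n - i) * L (Suc i) (n - i))"
    by (subst sum.atMost_Suc_shift) simp
  also have "(\<Sum>i\<le>Suc n. (if i = Suc n then 0 else ?g i (n - i)) * L i (Suc n - i)) =
      (\<Sum>i\<le>n. ?g i (n - i) * L i (Suc (n - i)))"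
    by (subst sum.atMost_Suc) (auto intro!: sum.cong simp: Suc_diff_le)
  also have "(\<Sum>i\<le>n. ?g i (n - i) * L (Suc i) (n - i)) + (\<Sum>i\<le>n. ?g i (n - i) * L i (Suc (n - i)))
      = (\<Sum>i\<le>n. ?g i (n - i) * L i (n - i))"
    unfolding sum.distrib[symmetric]
    by (intro sum.cong) (auto simp: Suc.prems algebra_simps)
  finally show ?case using Suc by simp
qed

text \<open>On the line x + y = 1 the values x^i y^j form a table of the required kind.\<close>

lemma harmonic_sum_line:
  fixes x y :: real
  assumes "x + y = 1"
  shows "(\<Sum>k\<le>n. \<Sum>i\<le>k. c i (k - i) * (x ^ i * y ^ (k - i))) =
    1 - (\<Sum>i\<le>n. quot c i (n - i) * (x ^ i * y ^ (n - i)))"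
proof -
  have "x ^ i * y ^ j = x ^ Suc i * y ^ j + x ^ i * y ^ Suc j" for i j
  proof -
    have "x ^ Suc i * y ^ j + x ^ i * y ^ Suc j = x ^ i * y ^ j * (x + y)"
      by (simp add: algebra_simps)
    then show ?thesis using assms by simp
  qed
  then show ?thesis using harmonic_sum[of n "\<lambda>i j. x ^ i * y ^ j" c] by simp
qed

text \<open>Coefficient arrays of the members of H(2,d). Being 1 on the line is encoded in finite
  form: layer d of the quotient vanishes. Later layers then vanish as well, because \<open>c\<close>
  has no terms there.\<close>

locale line_coeffs =
  fixes c :: "nat \<Rightarrow> nat \<Rightarrow> real" and d :: nat
  assumes nonneg: "0 \<le> c i j"
    and degree_le: "d < i + j \<Longrightarrow> c i j = 0"
    and top_nonzero: "\<exists>i\<le>d. c i (d - i) \<noteq> 0"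
    and line: "i + j = d \<Longrightarrow> quot c i j = 0"
    and degree_pos: "0 < d"
begin

lemma quot_eq_0: "d \<le> i + j \<Longrightarrow> quot c i j = 0"
proof (induction "i + j" arbitrary: i j rule: less_induct)
  case less
  show ?case
  proof (cases "i + j = d")
    case False
    then have "c i j = 0" using less.prems degree_le by simp
    moreover have "quot c (i - 1) j = 0" if "i \<noteq> 0"
      using that less.prems False by (intro less.hyps) auto
    moreover have "quot c i (j - 1) = 0" if "j \<noteq> 0"
      using that less.prems False by (intro less.hyps) auto
    ultimately show ?thesis using coeff_quot[of c i j] less.prems False
      by (auto split: if_splits)
  qed (simp add: line)
qed

text \<open>All monomials are positive at x = y = 1/2. If layer k vanished, the terms of degree at
  most k would already add up to 1 there, leaving nothing for a nonzero term of degree d.\<close>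

lemma quot_layer_nonzero:
  assumes "k < d"
  shows "\<exists>i\<le>k. quot c i (k - i) \<noteq> 0"
proof (rule ccontr)
  assume H: "\<not> ?thesis"
  let ?s = "\<lambda>l. \<Sum>i\<le>l. c i (l - i) * ((1/2) ^ i * (1/2) ^ (l - i))"
  have half: "1/2 + 1/2 = (1::real)" by simp
  have "(\<Sum>l\<le>k. ?s l) = 1"
    unfolding harmonic_sum_line[OF half] using H by (auto intro!: sum.neutral)
  moreover have "(\<Sum>l\<le>d. ?s l) = 1"
    unfolding harmonic_sum_line[OF half] by (auto intro!: sum.neutral line)
  moreover have "(\<Sum>l\<le>d. ?s l) = (\<Sum>l\<le>k. ?s l) + (\<Sum>l\<in>{k<..d}. ?s l)"
    using assms by (subst sum.union_disjoint[symmetric]) (auto intro: sum.cong)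
  ultimately have "(\<Sum>l\<in>{k<..d}. ?s l) = 0" by linarith
  then have "?s d = 0"
    using assms by (subst (asm) sum_nonneg_eq_0_iff) (auto intro!: sum_nonneg mult_nonneg_nonneg nonneg)
  then have "\<forall>i\<le>d. c i (d - i) = 0"
    by (subst (asm) sum_nonneg_eq_0_iff) (auto intro!: mult_nonneg_nonneg nonneg)
  then show False using top_nonzero by auto
qed

lemma flip: "line_coeffs (\<lambda>i j. c j i) d"
proof
  show "\<exists>i\<le>d. c (d - i) i \<noteq> 0"
    using top_nonzero by (metis diff_diff_cancel diff_le_self)
  show "quot (\<lambda>i j. c j i) i j = 0" if "i + j = d" for i j
    using that line[of j i] quot_flip[of c i j] by simp
  show "c j i = 0" if "d < i + j" for i j
    using that by (intro degree_le) simp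
qed (use nonneg degree_pos in auto)

lemma support_degree: "c i j \<noteq> 0 \<Longrightarrow> i + j \<le> d"
  using degree_le not_less by blast

lemma finite_support: "finite {(i, j). c i j \<noteq> 0}"
  by (rule finite_subset[of _ "{..d} \<times> {..d}"]) (auto dest: support_degree)

end

section \<open>Alternating sign chains\<close>

text \<open>A chain of k positions below b at which the sign of u alternates, ending with the sign of s.\<close>

primrec alt :: "(nat \<Rightarrow> real) \<Rightarrow> nat \<Rightarrow> nat \<Rightarrow> real \<Rightarrow> bool" where
  "alt u 0 b s = True"
| "alt u (Suc k) b s = (\<exists>p<b. s * u p > 0 \<and> alt u k p (- s))"

lemma alt_mono: "alt u k b s \<Longrightarrow> b \<le> b' \<Longrightarrow> alt u k b' s"
  by (cases k) (auto intro: order.strict_trans2)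

lemma alt_pred: "alt u (Suc k) b s \<Longrightarrow> alt u k b (- s)"
  using alt_mono less_imp_le by (metis alt.simps(2))

lemma alt_cong: "(\<And>i. i < b \<Longrightarrow> u i = v i) \<Longrightarrow> alt u k b s \<longleftrightarrow> alt v k b s"
proof (induction k arbitrary: b s)
  case (Suc k)
  have "alt u k p (- s) \<longleftrightarrow> alt v k p (- s)" if "p < b" for p
    using that Suc.prems by (intro Suc.IH) auto
  then show ?case using Suc.prems by auto
qed simp

lemma sum_diff_telescope:
  fixes u :: "nat \<Rightarrow> real"
  assumes "a \<le> b"
  shows "(\<Sum>i\<in>{Suc a..b}. u i - u (i - 1)) = u b - u a"
  using assms by (induction b rule: dec_induct) auto

text \<open>A telescoping sum with positive value has a positive summand.\<close>

lemma rise_between: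
  fixes u :: "nat \<Rightarrow> real"
  assumes "a < b" "s * u a < s * u b"
  shows "\<exists>i. a < i \<and> i \<le> b \<and> 0 < s * (u i - u (i - 1))"
proof (rule ccontr)
  assume "\<not> ?thesis"
  then have "(\<Sum>i\<in>{Suc a..b}. s * (u i - u (i - 1))) \<le> 0"
    by (intro sum_nonpos) (auto simp: not_less)
  moreover have "(\<Sum>i\<in>{Suc a..b}. s * (u i - u (i - 1))) = s * (u b - u a)"
    using assms by (simp only: sum_distrib_left[symmetric] sum_diff_telescope less_imp_le)
  ultimately show False using assms by (simp add: algebra_simps)
qed

text \<open>The value before index 0 counts as 0, so this is multiplication of the generating
  function by 1 - t.\<close>

definition diff :: "(nat \<Rightarrow> real) \<Rightarrow> nat \<Rightarrow> real" where
  "diff u i = u i - (if i = 0 then 0 else u (i - 1))"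

text \<open>Between consecutive chain positions q < p some difference has the sign of the later
  value. It is found in the half-open gap from q + 1 to p, so the new positions stay increasing and
  below the same bound.\<close>

lemma alt_diff: "alt u k b s \<Longrightarrow> alt (diff u) k b s"
proof (induction k arbitrary: b s)
  case (Suc k)
  then obtain p where p: "p < b" "s * u p > 0" "alt u k p (- s)" by auto
  show ?case
  proof (cases k)
    case 0
    \<comment> \<open>The lowest chain position has no predecessor; its rise starts from the value 0
      assumed before index 0.\<close>
    have "\<exists>i\<le>p. 0 < s * diff u i"
    proof (rule ccontr)
      assume H: "\<not> ?thesis"
      then have "s * u 0 \<le> 0" by (auto simp: diff_def not_less dest: spec[of _ 0])
      then have "0 < p" using p(2) by (cases p) auto
      then have "\<exists>i. 0 < i \<and> i \<le> p \<and> 0 < s * (u i - u (i - 1))"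
        using \<open>s * u 0 \<le> 0\<close> p(2) by (intro rise_between) auto
      then show False using H by (auto simp: diff_def split: if_splits)
    qed
    then show ?thesis using 0 p(1) by (auto intro: order.strict_trans1)
  next
    case (Suc k')
    then obtain q where q: "q < p" "- s * u q > 0" "alt u k' q s" using p(3) by auto
    have "\<exists>i. q < i \<and> i \<le> p \<and> 0 < s * (u i - u (i - 1))"
      using q(1,2) p(2) by (intro rise_between) auto
    then obtain i where i: "q < i" "i \<le> p" "0 < s * diff u i" by (auto simp: diff_def)
    have "alt u k (Suc q) (- s)" using q \<open>k = Suc k'\<close> by auto
    then have "alt (diff u) k (Suc q) (- s)" by (rule Suc.IH)
    then have "alt (diff u) k i (- s)" using i(1) by (auto intro: alt_mono)
    then show ?thesis using i p(1) by (auto intro!: exI[of _ i])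
  qed
qed simp

definition alts :: "(nat \<Rightarrow> real) \<Rightarrow> nat \<Rightarrow> bool" where
  "alts u k \<longleftrightarrow> (\<exists>b. alt u k b 1 \<or> alt u k b (- 1))"

lemma alts_0 [simp]: "alts u 0"
  by (simp add: alts_def)

lemma alts_1:
  assumes "u p \<noteq> 0"
  shows "alts u 1"
proof -
  have "1 * u p > 0 \<or> (- 1) * u p > 0" using assms by auto
  then have "alt u 1 (Suc p) 1 \<or> alt u 1 (Suc p) (- 1)" by auto
  then show ?thesis unfolding alts_def by blast
qed

lemma alts_pred:
  assumes "alts u (Suc k)"
  shows "alts u k"
proof -
  obtain b where "alt u (Suc k) b 1 \<or> alt u (Suc k) b (- 1)"
    using assms unfolding alts_def by blast
  then have "alt u k b (- 1) \<or> alt u k b 1"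
    using alt_pred[of u k b 1] alt_pred[of u k b "- 1"] by (auto simp del: alt.simps)
  then show ?thesis unfolding alts_def by blast
qed

lemma alts_mono:
  assumes "j \<le> k" "alts u k"
  shows "alts u j"
  using assms by (induction k rule: dec_induct) (auto dest: alts_pred)

text \<open>If the altered position belongs to the chain, it is dropped together with the chain
  position before it. This keeps both the alternation and the last sign, at a cost of two.\<close>

lemma alt_change:
  assumes "\<And>i. i \<noteq> q \<Longrightarrow> u i = v i"
  shows "alt u k b s \<Longrightarrow> alt v (k - 2) b s"
proof (induction k arbitrary: b s)
  case (Suc k)
  then obtain p where p: "p < b" "s * u p > 0" "alt u k p (- s)" by auto
  show ?case
  proof (cases "k = 0")
    case False
    then obtain k' where k': "k = Suc k'" by (cases k) auto
    show ?thesis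
    proof (cases "p = q")
      case False
      have "alt v (k - 2) p (- s)" using p(3) by (rule Suc.IH)
      then have "alt v (Suc (k - 2)) b s" using p(1,2) assms[OF False] by auto
      then show ?thesis using k' by (cases k') auto
    next
      case True
      obtain p' where "p' < p" "alt u k' p' s" using p(3) k' by auto
      then have "alt v k' p' s" using alt_cong[of p' u v] assms True by auto
      then show ?thesis using \<open>p' < p\<close> p(1) k' by (auto intro: alt_mono)
    qed
  qed simp
qed simp

text \<open>As u is zero below q, the position q can only be the lowest one of a chain, where it is
  dropped alone.\<close>

lemma alt_change_low:
  assumes "\<And>i. i \<noteq> q \<Longrightarrow> u i = v i" "\<And>i. i < q \<Longrightarrow> u i = 0"
  shows "alt u k b s \<Longrightarrow> alt v (k - 1) b s"
proof (induction k arbitrary: b s)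
  case (Suc k)
  then obtain p where p: "p < b" "s * u p > 0" "alt u k p (- s)" by auto
  show ?case
  proof (cases "k = 0")
    case False
    then obtain k' where k': "k = Suc k'" by (cases k) auto
    then have "p \<noteq> q" using p(3) assms(2) by auto
    have "alt v (k - 1) p (- s)" using p(3) by (rule Suc.IH)
    then show ?thesis using p(1,2) assms(1)[OF \<open>p \<noteq> q\<close>] k' by auto
  qed simp
qed simp

text \<open>As u is zero above q, only the last chain position can be affected. Dropping it reverses
  the final sign.\<close>

lemma alt_change_high:
  assumes "\<And>i. i \<noteq> q \<Longrightarrow> u i = v i" "\<And>i. q < i \<Longrightarrow> u i = 0" "alt u (Suc k) b s"
  shows "alt v k b s \<or> alt v k b (- s)"
proof -
  obtain p where p: "p < b" "s * u p > 0" "alt u k p (- s)" using assms(3) by auto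
  then have "p \<le> q" using assms(2)[of p] by (cases "q < p") auto
  then have "alt v k p (- s)" using p(3) alt_cong[of p u v] assms(1) by auto
  then show ?thesis using p(1) by (auto intro: alt_mono)
qed

lemma alts_change:
  assumes "\<And>i. i \<noteq> q \<Longrightarrow> u i = v i" "alts u k"
  shows "alts v (k - 2)"
proof -
  obtain b where "alt u k b 1 \<or> alt u k b (- 1)" using assms(2) unfolding alts_def by blast
  then have "alt v (k - 2) b 1 \<or> alt v (k - 2) b (- 1)"
    using alt_change[of q u v, OF assms(1)] by metis
  then show ?thesis unfolding alts_def by blast
qed

lemma alts_change_low:
  assumes "\<And>i. i \<noteq> q \<Longrightarrow> u i = v i" "\<And>i. i < q \<Longrightarrow> u i = 0" "alts u k"
  shows "alts v (k - 1)"
proof -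
  obtain b where "alt u k b 1 \<or> alt u k b (- 1)" using assms(3) unfolding alts_def by blast
  then have "alt v (k - 1) b 1 \<or> alt v (k - 1) b (- 1)"
    using alt_change_low[of q u v, OF assms(1,2)] by metis
  then show ?thesis unfolding alts_def by blast
qed

lemma alts_change_high:
  assumes "\<And>i. i \<noteq> q \<Longrightarrow> u i = v i" "\<And>i. q < i \<Longrightarrow> u i = 0" "alts u k"
  shows "alts v (k - 1)"
proof (cases k)
  case (Suc k')
  obtain b where "alt u (Suc k') b 1 \<or> alt u (Suc k') b (- 1)"
    using assms(3) unfolding alts_def Suc by blast
  then have "alt v k' b 1 \<or> alt v k' b (- 1)"
    using alt_change_high[of q u v, OF assms(1,2), of k' b 1]
      alt_change_high[of q u v, OF assms(1,2), of k' b "- 1"]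
    by auto
  then show ?thesis unfolding alts_def Suc by auto
qed simp

text \<open>The positions are altered one at a time, each at a cost of at most two. Truncated
  subtraction covers the case in which the chain is used up.\<close>

lemma alts_change_set:
  assumes "finite F" "\<And>i. i \<notin> F \<Longrightarrow> u i = v i" "alts u k"
  shows "alts v (k - 2 * card F)"
  using assms
proof (induction F arbitrary: u k)
  case empty
  then have "u = v" by auto
  then show ?case using empty by simp
next
  case (insert q F)
  have "alts (u(q := v q)) (k - 2)"
    using alts_change[of q u "u(q := v q)"] insert.prems(2) by auto
  moreover have "(u(q := v q)) i = v i" if "i \<notin> F" for i
    using that insert.prems(1) by auto
  ultimately have "alts v (k - 2 - 2 * card F)" by (intro insert.IH)
  then show ?case using insert.hyps by (simp add: algebra_simps)
qed

text \<open>Beyond its last chain position the sequence must return to 0, since it vanishes above B.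
  That return contributes a difference of the opposite sign, which prolongs a nonempty chain by
  one.\<close>

lemma alts_diff:
  assumes "\<And>i. B < i \<Longrightarrow> u i = 0" "alts u k" "0 < k"
  shows "alts (diff u) (Suc k)"
proof -
  obtain k' where k': "k = Suc k'" using assms(3) by (cases k) auto
  have "alts (diff u) (Suc (Suc k'))" if u: "alt u (Suc k') b s" and s: "s = 1 \<or> s = - 1" for b s
  proof -
    obtain p where p: "p < b" "s * u p > 0" "alt u k' p (- s)" using u by auto
    have "p \<le> B" using p(2) assms(1)[of p] by (cases "B < p") auto
    then have "\<exists>i. p < i \<and> i \<le> Suc B \<and> 0 < (- s) * (u i - u (i - 1))"
      using p(2) assms(1)[of "Suc B"] by (intro rise_between) auto
    then obtain i where i: "p < i" "0 < (- s) * diff u i" by (auto simp: diff_def)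
    have "alt (diff u) (Suc k') (Suc p) s" using p by (intro alt_diff) auto
    then have "alt (diff u) (Suc k') i (- (- s))"
      using i(1) alt_mono[of "diff u" "Suc k'" "Suc p" s i] by auto
    then have "alt (diff u) (Suc (Suc k')) (Suc i) (- s)" using i(2) unfolding alt.simps(2)[of _ "Suc k'"] by blast
    then show ?thesis unfolding alts_def using s by (auto simp del: alt.simps)
  qed
  then show ?thesis using assms(2) unfolding alts_def k' by blast
qed

lemma alt_card: "alt u k b s \<Longrightarrow> k \<le> card {i. i < b \<and> u i \<noteq> 0}"
proof (induction k arbitrary: b s)
  case (Suc k)
  then obtain p where p: "p < b" "s * u p > 0" "alt u k p (- s)" by auto
  have "Suc k \<le> Suc (card {i. i < p \<and> u i \<noteq> 0})" using Suc.IH[OF p(3)] by simp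
  also have "\<dots> = card (insert p {i. i < p \<and> u i \<noteq> 0})" by simp
  also have "\<dots> \<le> card {i. i < b \<and> u i \<noteq> 0}" using p(1,2) by (intro card_mono) auto
  finally show ?case .
qed simp

lemma alts_card:
  assumes "alts u k" "finite {i. u i \<noteq> 0}"
  shows "k \<le> card {i. u i \<noteq> 0}"
proof -
  obtain b s where "alt u k b s" using assms(1) unfolding alts_def by blast
  then have "k \<le> card {i. i < b \<and> u i \<noteq> 0}" by (rule alt_card)
  also have "\<dots> \<le> card {i. u i \<noteq> 0}" using assms(2) by (intro card_mono) auto
  finally show ?thesis .
qed

lemma alts_change_set_low:
  assumes "finite F" "\<And>i. i \<notin> F \<Longrightarrow> u i = v i" "alts u k" "q \<in> F" "\<And>i. i < q \<Longrightarrow> u i = 0"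
  shows "alts v (k + 1 - 2 * card F)"
proof -
  have "alts (u(q := v q)) (k - 1)"
    using assms(5) by (intro alts_change_low[OF _ _ assms(3), of q]) auto
  then have "alts v (k - 1 - 2 * card (F - {q}))"
    using assms(1,2) by (intro alts_change_set[of _ "u(q := v q)"]) auto
  moreover have "k + 1 - 2 * card F \<le> k - 1 - 2 * card (F - {q})"
    unfolding card.remove[OF assms(1,4)] by simp
  ultimately show ?thesis by (rule alts_mono[rotated])
qed

lemma alts_change_set_high:
  assumes "finite F" "\<And>i. i \<notin> F \<Longrightarrow> u i = v i" "alts u k" "q \<in> F" "\<And>i. q < i \<Longrightarrow> u i = 0"
  shows "alts v (k + 1 - 2 * card F)"
proof -
  have "alts (u(q := v q)) (k - 1)"
    using assms(5) by (intro alts_change_high[OF _ _ assms(3), of q]) auto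
  then have "alts v (k - 1 - 2 * card (F - {q}))"
    using assms(1,2) by (intro alts_change_set[of _ "u(q := v q)"]) auto
  moreover have "k + 1 - 2 * card F \<le> k - 1 - 2 * card (F - {q})"
    unfolding card.remove[OF assms(1,4)] by simp
  ultimately show ?thesis by (rule alts_mono[rotated])
qed

text \<open>The low end is altered before the high one; q < q' ensures that the second discount
  concerns another position.\<close>

lemma alts_change_set_both:
  assumes "finite F" "\<And>i. i \<notin> F \<Longrightarrow> u i = v i" "alts u k"
    and "q \<in> F" "\<And>i. i < q \<Longrightarrow> u i = 0" "q' \<in> F" "\<And>i. q' < i \<Longrightarrow> u i = 0" "q < q'"
  shows "alts v (k + 2 - 2 * card F)"
proof -
  have len: "alts (u(q := v q)) (k - 1)"
    using assms(5) by (intro alts_change_low[OF _ _ assms(3), of q]) auto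
  have "alts v (k - 1 + 1 - 2 * card (F - {q}))"
  proof (intro alts_change_set_high[where q = q' and u = "u(q := v q)"])
    show "alts (u(q := v q)) (k - 1)" by (rule len)
    show "finite (F - {q})" "q' \<in> F - {q}" using assms(1,6,8) by auto
    show "(u(q := v q)) i = v i" if "i \<notin> F - {q}" for i using that assms(2) by auto
    show "(u(q := v q)) i = 0" if "q' < i" for i using that assms(7,8) by auto
  qed
  moreover have "k + 2 - 2 * card F \<le> k - 1 + 1 - 2 * card (F - {q})"
    unfolding card.remove[OF assms(1,4)] by simp
  ultimately show ?thesis by (rule alts_mono[rotated])
qed

text \<open>The two end conditions differ because entry i of \<open>diff u\<close> involves u at i
  and at i - 1: it vanishes below q when u does, while its vanishing above q is drawn from u being
  zero from q on. The nonzero entry u p separates the two ends, so both discounts may be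
  claimed.\<close>

lemma alts_step:
  assumes "finite F" "\<And>i. i \<notin> F \<Longrightarrow> diff u i = v i" "u p \<noteq> 0" "\<And>i. B < i \<Longrightarrow> u i = 0"
    and "alts u k" "0 < k"
  shows "alts v (k + 1 + of_bool (\<exists>q\<in>F. \<forall>i<q. u i = 0) + of_bool (\<exists>q\<in>F. \<forall>i\<ge>q. u i = 0)
    - 2 * card F)" (is "alts v (k + 1 + of_bool ?P + of_bool ?Q - _)")
proof -
  have k: "alts (diff u) (k + 1)" using alts_diff[OF assms(4-6)] by simp
  have low: "diff u i = 0" if "\<forall>i<q. u i = 0" "i < q" for q i using that by (auto simp: diff_def)
  have high: "diff u i = 0" if "\<forall>i\<ge>q. u i = 0" "q < i" for q i using that by (auto simp: diff_def)
  consider (both) ?P ?Q | (lo) ?P "\<not> ?Q" | (hi) "\<not> ?P" ?Q | (none) "\<not> ?P" "\<not> ?Q" by blast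
  then show ?thesis
  proof cases
    case both
    then obtain q q' where q: "q \<in> F" "\<forall>i<q. u i = 0" "q' \<in> F" "\<forall>i\<ge>q'. u i = 0" by blast
    have "q < q'"
    proof (rule ccontr)
      assume "\<not> q < q'"
      then have "u p = 0" using q by (cases "p < q") auto
      then show False using assms(3) by simp
    qed
    have "alts v (k + 1 + 2 - 2 * card F)"
      by (rule alts_change_set_both[OF assms(1,2) k q(1) low[OF q(2)] q(3) high[OF q(4)] \<open>q < q'\<close>])
    then show ?thesis using both by simp
  next
    case lo
    then obtain q where q: "q \<in> F" "\<forall>i<q. u i = 0" by blast
    have "alts v (k + 1 + 1 - 2 * card F)"
      by (rule alts_change_set_low[OF assms(1,2) k q(1) low[OF q(2)]])
    then show ?thesis unfolding eqTrueI[OF lo(1)] iffD2[OF eq_False lo(2)] by simp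
  next
    case hi
    then obtain q where q: "q \<in> F" "\<forall>i\<ge>q. u i = 0" by blast
    have "alts v (k + 1 + 1 - 2 * card F)"
      by (rule alts_change_set_high[OF assms(1,2) k q(1) high[OF q(2)]])
    then show ?thesis unfolding eqTrueI[OF hi(2)] iffD2[OF eq_False hi(1)] by simp
  next
    case none
    have "alts v (k + 1 - 2 * card F)" by (rule alts_change_set[OF assms(1,2) k])
    then show ?thesis unfolding iffD2[OF eq_False none(1)] iffD2[OF eq_False none(2)] by simp
  qed
qed

section \<open>The boundary of the support\<close>

text \<open>For a = d this is the shape with three monomials of degree d, and the last disjunction
  is void. For a < d there are two, x^a is the end in a lower layer, and the strip of degrees
  strictly between a and d with y-exponent at most m is empty.\<close>

definition frame :: "(nat \<Rightarrow> nat \<Rightarrow> real) \<Rightarrow> nat \<Rightarrow> nat \<Rightarrow> nat \<Rightarrow> bool" where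
  "frame c d a m \<longleftrightarrow> odd m \<and> m \<le> a \<and> a \<le> d \<and> c a 0 = 1 \<and> c 0 d = 1 \<and> c (d - m) m \<noteq> 0 \<and>
    (\<forall>i j. c i j \<noteq> 0 \<longrightarrow> (i, j) \<in> {(a, 0), (d - m, m), (0, d)} \<or>
      0 < i \<and> 0 < j \<and> i + j < d \<and> (i + j \<le> a \<or> m < j))"

section \<open>Sign chains through the layers of the quotient\<close>

context line_coeffs
begin

definition terms :: "nat \<Rightarrow> nat set" where
  "terms k = {i. i \<le> k \<and> c i (k - i) \<noteq> 0}"

text \<open>The sign twist turns multiplication by x + y into the difference operator.\<close>

definition layer :: "nat \<Rightarrow> nat \<Rightarrow> real" where
  "layer k i = (if i \<le> k then (-1) ^ i * quot c i (k - i) else 0)"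

text \<open>An end is measured against layer k - 1 of the quotient: the monomial lies at or before
  its first nonzero entry, on the side of the y-axis. The counterpart \<open>high\<close> asks for a
  monomial strictly after the last nonzero entry. These are the positions at which
  \<open>alts_step\<close> grants a discount.\<close>

definition low :: "nat \<Rightarrow> bool" where
  "low k \<longleftrightarrow> (\<exists>q\<in>terms k. \<forall>i<q. quot c i (k - 1 - i) = 0)"

definition high :: "nat \<Rightarrow> bool" where
  "high k \<longleftrightarrow> (\<exists>q\<in>terms k. \<forall>i. q \<le> i \<and> i < k \<longrightarrow> quot c i (k - 1 - i) = 0)"

lemma finite_terms: "finite (terms k)"
  by (rule finite_subset[of _ "{..k}"]) (auto simp: terms_def)

lemma diff_layer:
  "diff (layer k) i =
    (if i \<le> Suc k then (-1) ^ i * (c i (Suc k - i) + quot c i (Suc k - i)) else 0)"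
proof (cases i)
  case (Suc j)
  show ?thesis
  proof (cases "Suc j \<le> k")
    case True
    then have "k - j = Suc (k - Suc j)" by simp
    then show ?thesis using Suc True by (simp add: diff_def layer_def algebra_simps)
  next
    case False
    then show ?thesis using Suc by (cases "j = k") (auto simp: diff_def layer_def)
  qed
qed (simp add: diff_def layer_def)

text \<open>The count is kept in \<open>int\<close> because it may drop below zero. Sums start at
  degree 1, since a constant term only affects the starting entry 1 - c 0 0.\<close>

lemma alts_layer:
  assumes "k < d"
  shows "alts (layer k) (nat (1 + int k + (\<Sum>l=1..k. of_bool (low l) + of_bool (high l))
    - 2 * (\<Sum>l=1..k. int (card (terms l)))))"
  using assms
proof (induction k)
  case 0
  then have "layer 0 0 \<noteq> 0" using quot_layer_nonzero[of 0] by (simp add: layer_def)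
  then show ?case using alts_1 by simp
next
  case (Suc k)
  define z where "z = 1 + int k + (\<Sum>l=1..k. of_bool (low l) + of_bool (high l))
    - 2 * (\<Sum>l=1..k. int (card (terms l)))"
  obtain p where "p \<le> k" "quot c p (k - p) \<noteq> 0" using quot_layer_nonzero[of k] Suc.prems by auto
  then have p: "layer k p \<noteq> 0" by (simp add: layer_def)
  \<comment> \<open>Taking differences lengthens only nonempty chains. When z is not positive, a
    single nonzero entry of layer k supplies a chain of length 1.\<close>
  have len: "alts (layer k) (max 1 (nat z))"
    using Suc alts_1[of "layer k" p, OF p] unfolding z_def by (simp add: max_def)
  have "alts (layer (Suc k)) (max 1 (nat z) + 1
      + of_bool (\<exists>q\<in>terms (Suc k). \<forall>i<q. layer k i = 0)
      + of_bool (\<exists>q\<in>terms (Suc k). \<forall>i\<ge>q. layer k i = 0) - 2 * card (terms (Suc k)))"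
  proof (intro alts_step[where p = p and B = k and u = "layer k"] finite_terms p)
    show "diff (layer k) i = layer (Suc k) i" if "i \<notin> terms (Suc k)" for i
      using that by (auto simp: diff_layer terms_def layer_def[of "Suc k"])
    show "layer k i = 0" if "k < i" for i using that by (simp add: layer_def)
  qed (use len in auto)
  moreover have "(\<exists>q\<in>terms (Suc k). \<forall>i<q. layer k i = 0) = low (Suc k)"
    unfolding low_def by (intro bex_cong refl) (auto simp: layer_def terms_def)
  moreover have "(\<exists>q\<in>terms (Suc k). \<forall>i\<ge>q. layer k i = 0) = high (Suc k)"
    unfolding high_def by (intro bex_cong refl) (auto simp: layer_def terms_def less_Suc_eq_le)
  ultimately have "alts (layer (Suc k)) (max 1 (nat z) + 1 + of_bool (low (Suc k))
      + of_bool (high (Suc k)) - 2 * card (terms (Suc k)))" by simp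
  then show ?case
  proof (rule alts_mono[rotated])
    have "1 + int (Suc k) + (\<Sum>l=1..Suc k. of_bool (low l) + of_bool (high l))
        - 2 * (\<Sum>l=1..Suc k. int (card (terms l))) =
      z + 1 + of_bool (low (Suc k)) + of_bool (high (Suc k)) - 2 * int (card (terms (Suc k)))"
      by (simp add: z_def)
    then show "nat (1 + int (Suc k) + (\<Sum>l=1..Suc k. of_bool (low l) + of_bool (high l))
        - 2 * (\<Sum>l=1..Suc k. int (card (terms l))))
      \<le> max 1 (nat z) + 1 + of_bool (low (Suc k)) + of_bool (high (Suc k)) - 2 * card (terms (Suc k))"
      by (cases "low (Suc k)"; cases "high (Suc k)") auto
  qed
qed

lemma card_support: "card {(i, j). c i j \<noteq> 0} = (\<Sum>l\<le>d. card (terms l))"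
proof -
  have "{(i, j). c i j \<noteq> 0} = (\<lambda>(l, i). (i, l - i)) ` (SIGMA l:{..d}. terms l)"
  proof (intro set_eqI iffI)
    fix x assume "x \<in> {(i, j). c i j \<noteq> 0}"
    then obtain i j where x: "x = (i, j)" "c i j \<noteq> 0" by auto
    then show "x \<in> (\<lambda>(l, i). (i, l - i)) ` (SIGMA l:{..d}. terms l)"
      using support_degree[of i j]
      by (intro image_eqI[of _ _ "(i + j, i)"]) (auto simp: terms_def)
  qed (auto simp: terms_def)
  moreover have "inj_on (\<lambda>(l, i). (i, l - i)) (SIGMA l:{..d}. terms l)"
    by (auto simp: inj_on_def terms_def)
  ultimately show ?thesis by (simp add: card_image finite_terms)
qed

text \<open>Layer d of the quotient is zero, so the differences of layer d - 1 are, up to sign, the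
  coefficients of degree d.\<close>

lemma alts_top: "alts (diff (layer (d - 1))) k \<Longrightarrow> k \<le> card (terms d)"
proof -
  assume "alts (diff (layer (d - 1))) k"
  moreover have "{i. diff (layer (d - 1)) i \<noteq> 0} = terms d"
    using degree_pos line by (auto simp: diff_layer terms_def)
  ultimately show ?thesis using alts_card[of "diff (layer (d - 1))" k] finite_terms by simp
qed

text \<open>The chain of layer d - 1 grows once more and then has to fit into the monomials of
  degree d. Rewriting the count of the middle layers through the total number of monomials gives the
  inequality; a constant term lies outside that count and therefore appears with weight two.\<close>

lemma card_top_ge_2: "2 \<le> card (terms d)"
  and ends_bound: "d + 1 + card {l \<in> {1..<d}. low l} + card {l \<in> {1..<d}. high l}
    + card (terms d) + 2 * card (terms 0) \<le> 2 * card {(i, j). c i j \<noteq> 0}"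
proof -
  let ?E = "\<Sum>l=1..d-1. of_bool (low l) + of_bool (high l) :: int"
  let ?T = "\<Sum>l=1..d-1. int (card (terms l))"
  have fin: "layer (d - 1) i = 0" if "d - 1 < i" for i using that by (simp add: layer_def)
  obtain p where "p \<le> d - 1" "quot c p (d - 1 - p) \<noteq> 0"
    using quot_layer_nonzero[of "d - 1"] degree_pos by auto
  then have "layer (d - 1) p \<noteq> 0" by (simp add: layer_def)
  then have "alts (diff (layer (d - 1))) (Suc 1)" by (intro alts_diff[OF fin] alts_1) auto
  then show two: "2 \<le> card (terms d)" using alts_top by fastforce
  let ?z = "1 + int (d - 1) + ?E - 2 * ?T"
  have "?z + 1 \<le> int (card (terms d))"
  proof (cases "?z \<ge> 1")
    case True
    have "alts (diff (layer (d - 1))) (Suc (nat ?z))"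
      using True degree_pos by (intro alts_diff[OF fin] alts_layer) auto
    then have "Suc (nat ?z) \<le> card (terms d)" by (rule alts_top)
    then show ?thesis using True by linarith
  next
    case False
    then show ?thesis using two by linarith
  qed
  moreover have "?E = int (card {l \<in> {1..<d}. low l} + card {l \<in> {1..<d}. high l})"
  proof -
    have "{1..d - 1} = {1..<d}" using degree_pos by auto
    then show ?thesis
      by (simp add: sum.distrib sum_of_bool_eq Int_def)
  qed
  moreover have "int (card {(i, j). c i j \<noteq> 0}) = int (card (terms 0)) + int (card (terms d)) + ?T"
  proof -
    obtain e where e: "d = Suc e" using degree_pos by (cases d) auto
    have "(\<Sum>l\<le>d. int (card (terms l))) = (\<Sum>l\<le>e. int (card (terms l))) + int (card (terms d))"
      by (simp add: e)
    also have "(\<Sum>l\<le>e. int (card (terms l))) = int (card (terms 0)) + ?T"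
      by (simp add: e atMost_atLeast0 sum.atLeast_Suc_atMost)
    finally have "(\<Sum>l\<le>d. int (card (terms l))) = int (card (terms 0)) + int (card (terms d)) + ?T"
      by simp
    then show ?thesis by (simp add: card_support)
  qed
  ultimately show "d + 1 + card {l \<in> {1..<d}. low l} + card {l \<in> {1..<d}. high l}
    + card (terms d) + 2 * card (terms 0) \<le> 2 * card {(i, j). c i j \<noteq> 0}"
    using degree_pos by linarith
qed

text \<open>The part of degree d is x + y times a form, so it vanishes at x = -1, y = 1. The table
  used is (-1)^i on the top diagonal and zero below it: neighbours cancel.\<close>

lemma alternating_top_sum: "(\<Sum>i\<le>d. (-1) ^ i * c i (d - i)) = 0"
proof -
  let ?L = "\<lambda>i j. if i + j = d then (-1) ^ i else 0 :: real"
  have "(\<Sum>k\<le>d. \<Sum>i\<le>k. c i (k - i) * ?L i (k - i)) =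
      ?L 0 0 - (\<Sum>i\<le>d. quot c i (d - i) * ?L i (d - i))"
    by (rule harmonic_sum) auto
  moreover have "(\<Sum>k\<le>d. \<Sum>i\<le>k. c i (k - i) * ?L i (k - i)) =
      (\<Sum>k\<le>d. if k = d then \<Sum>i\<le>d. c i (d - i) * (-1) ^ i else 0)"
    by (intro sum.cong refl) (auto intro!: sum.cong)
  ultimately show ?thesis using line degree_pos by (simp add: mult.commute)
qed

lemma low_flip:
  assumes "line_coeffs.low (\<lambda>i j. c j i) l"
  shows "high l"
proof -
  interpret F: line_coeffs "\<lambda>i j. c j i" d by (rule flip)
  obtain q where q: "q \<in> F.terms l" "\<forall>i<q. quot c (l - 1 - i) i = 0"
    using assms unfolding F.low_def quot_flip[of c] by blast
  show ?thesis unfolding high_def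
  proof (intro bexI allI impI)
    show "l - q \<in> terms l" using q(1) by (auto simp: terms_def F.terms_def)
    fix i assume "l - q \<le> i \<and> i < l"
    then have "l - 1 - i < q" "l - 1 - (l - 1 - i) = i" using q(1) by (auto simp: F.terms_def)
    then show "quot c i (l - 1 - i) = 0" using q(2) by metis
  qed
qed

text \<open>Two cases fit the budget: no high layer and three monomials of degree d, or one high
  layer a and two monomials of degree d. In the second, the last nonzero entry of the quotient keeps
  its y-exponent m from layer a on, until x^(d-m) y^m cancels it in degree d. The two statements
  about \<open>quot\<close> prepare the split along a row.\<close>

lemma frame_if_not_low:
  assumes "even d" and N: "2 * card {(i, j). c i j \<noteq> 0} \<le> d + 4"
    and nlow: "\<And>l. 0 < l \<Longrightarrow> l < d \<Longrightarrow> \<not> low l"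
  shows "\<exists>a m. frame c d a m \<and> quot c 0 (a - 1) = 1 \<and> (\<forall>i j. j < m \<longrightarrow> a \<le> i + j \<longrightarrow> quot c i j = 0)"
proof -
  let ?H = "{l \<in> {1..<d}. high l}"
  \<comment> \<open>Two monomials of degree d are unavoidable, so at most one unit of the budget is
    left, too little for a constant term.\<close>
  have cardH: "card ?H + card (terms d) \<le> 3" and "card (terms 0) = 0"
    using ends_bound card_top_ge_2 N by linarith+
  then have c00: "c 0 0 = 0" using finite_terms by (auto simp: terms_def)
  \<comment> \<open>A monomial y^k with 0 < k < d would be a low end. The 1 from the origin thus
    travels unchanged along the y-axis until y^d absorbs it.\<close>
  have g0: "quot c 0 k = 1" if "k < d" for k
    using that
  proof (induction k)
    case (Suc k)
    have "c 0 (Suc k) = 0"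
    proof (rule ccontr)
      assume "c 0 (Suc k) \<noteq> 0"
      then have "low (Suc k)" unfolding low_def by (intro bexI[of _ 0]) (auto simp: terms_def)
      then show False using nlow[of "Suc k"] Suc.prems by simp
    qed
    then show ?case using Suc by simp
  qed (simp add: c00)
  have c0: "c 0 k = 0" if "k < d" for k
    using that g0[of k] g0[of "k - 1"] c00 by (cases k) auto
  have c0d: "c 0 d = 1"
    using coeff_quot[of c 0 d] g0[of "d - 1"] line[of 0 d] degree_pos by simp
  have row0: "quot c k 0 = 1 \<and> (0 < k \<longrightarrow> c k 0 = 0)" if "k < b" "b \<le> d" "\<And>l. 0 < l \<Longrightarrow> l < b \<Longrightarrow> \<not> high l" for k b
    using that(1)
  proof (induction k)
    case (Suc k)
    have "c (Suc k) 0 = 0"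
    proof (rule ccontr)
      assume "c (Suc k) 0 \<noteq> 0"
      then have "high (Suc k)" unfolding high_def by (intro bexI[of _ "Suc k"]) (auto simp: terms_def)
      then show False using that(3)[of "Suc k"] Suc.prems by simp
    qed
    then show ?case using Suc by simp
  qed (simp add: c00)
  have top_sum: "(\<Sum>i\<in>terms d. (-1) ^ i * c i (d - i)) = 0"
    using alternating_top_sum
    by (subst sum.mono_neutral_left[of "{..d}"]) (auto simp: terms_def)
  show ?thesis
  proof (cases "?H = {}")
    case True
    then have nhigh: "\<not> high l" if "0 < l" "l < d" for l using that by auto
    have h: "quot c k 0 = 1" "0 < k \<Longrightarrow> c k 0 = 0" if "k < d" for k
      using row0[OF that order.refl nhigh] by auto
    have cd0: "c d 0 = 1"
      using coeff_quot[of c d 0] h(1)[of "d - 1"] line[of d 0] degree_pos by simp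
    have sub: "{0, d} \<subseteq> terms d" using c0d cd0 by (auto simp: terms_def)
    \<comment> \<open>For even d both x^d and y^d enter the alternating sum with sign +, so a third
      monomial with a negative sign is needed.\<close>
    have "terms d \<noteq> {0, d}"
    proof
      assume "terms d = {0, d}"
      then show False using top_sum c0d cd0 degree_pos \<open>even d\<close> by simp
    qed
    then obtain i where i: "i \<in> terms d" "i \<noteq> 0" "i \<noteq> d" using sub by auto
    have "{0, d, i} \<subseteq> terms d" "card {0, d, i} = 3" using sub i degree_pos by auto
    then have T: "terms d = {0, d, i}"
      using card_seteq[OF finite_terms, of "{0, d, i}" d] cardH by auto
    have "2 + (-1) ^ i * c i (d - i) = 0"
      using top_sum i(2,3) c0d cd0 degree_pos \<open>even d\<close> unfolding T by simp
    then have "odd i" using nonneg[of i "d - i"] by (cases "even i") auto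
    moreover have "i \<le> d" using i(1) by (auto simp: terms_def)
    ultimately have "odd (d - i)" using \<open>even d\<close> by auto
    have supp: "(i', j) \<in> {(d, 0), (d - (d - i), d - i), (0, d)} \<or> 0 < i' \<and> 0 < j \<and> i' + j < d"
      if nz: "c i' j \<noteq> 0" for i' j
    proof (cases "i' + j = d")
      case True
      then have "i' \<in> terms d" using nz by (auto simp: terms_def)
      then show ?thesis using T True \<open>i \<le> d\<close> by auto
    next
      case False
      then have "i' + j < d" using support_degree[OF nz] by simp
      moreover have "0 < i'" using nz c0[of j] \<open>i' + j < d\<close> by (cases i') auto
      moreover have "0 < j" using nz h(2)[of i'] \<open>i' + j < d\<close> \<open>0 < i'\<close> by (cases j) auto
      ultimately show ?thesis by simp
    qed
    have "c (d - (d - i)) (d - i) \<noteq> 0" using i(1) \<open>i \<le> d\<close> by (simp add: terms_def)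
    then have "frame c d d (d - i)"
      unfolding frame_def using \<open>odd (d - i)\<close> cd0 c0d supp by (meson diff_le_self less_imp_le order.refl)
    moreover have "quot c 0 (d - 1) = 1" using g0 degree_pos by simp
    ultimately show ?thesis using quot_eq_0 by blast
  next
    case False
    have "finite ?H" by simp
    then have "card ?H \<noteq> 0" using False by (simp only: card_0_eq not_False_eq_True)
    then have "card ?H = 1" and T2: "card (terms d) = 2" using cardH card_top_ge_2 by linarith+
    then obtain a where Ha: "?H = {a}" by (auto simp: card_1_singleton_iff)
    have "a \<in> ?H" unfolding Ha by simp
    then have a: "0 < a" "a < d" "high a" by simp_all
    have nhigh: "\<not> high l" if "0 < l" "l < d" "l \<noteq> a" for l
    proof
      assume "high l"
      then have "l \<in> ?H" using that by simp
      then show False using that unfolding Ha by simp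
    qed
    have h: "quot c k 0 = 1" "0 < k \<Longrightarrow> c k 0 = 0" if "k < a" for k
      using row0[OF that less_imp_le[OF a(2)] nhigh] a(2) by auto
    \<comment> \<open>\<open>h\<close> is the x-exponent and \<open>m\<close> the y-exponent of the
      last nonzero entry in layer a of the quotient.\<close>
    define h where "h = Max {i. i \<le> a \<and> quot c i (a - i) \<noteq> 0}"
    define m where "m = a - h"
    have "h \<in> {i. i \<le> a \<and> quot c i (a - i) \<noteq> 0}"
      unfolding h_def using quot_layer_nonzero[OF a(2)] by (intro Max_in) auto
    then have h1: "h \<le> a" "quot c h (a - h) \<noteq> 0" by auto
    have h2: "quot c i (a - i) = 0" if "h < i" "i \<le> a" for i
      using Max_ge[of "{i. i \<le> a \<and> quot c i (a - i) \<noteq> 0}" i] that unfolding h_def by fastforce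
    have "m \<le> a" "a - m = h" using h1 by (auto simp: m_def)
    \<comment> \<open>A monomial of degree k + 1 strictly after the last nonzero entry of layer k
      would make layer k + 1 high, but a is the only high layer.\<close>
    have no_term: "c i (Suc k - i) = 0"
      if "0 < k" "Suc k < d" "a \<le> k" "\<And>i. k - m < i \<Longrightarrow> i \<le> k \<Longrightarrow> quot c i (k - i) = 0"
        "k - m < i" "i \<le> Suc k" for i k
    proof (rule ccontr)
      assume "c i (Suc k - i) \<noteq> 0"
      then have "high (Suc k)" unfolding high_def using that(4-6)
        by (intro bexI[of _ i]) (auto simp: terms_def)
      then show False using nhigh[of "Suc k"] that by auto
    qed
    have shift: "quot c i (Suc k - i) = - c i (Suc k - i)"
      if "a \<le> k" and Z: "\<And>i. k - m < i \<Longrightarrow> i \<le> k \<Longrightarrow> quot c i (k - i) = 0"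
        and i: "Suc k - m < i" "i \<le> Suc k" for i k
    proof -
      have "k - (i - 1) = Suc k - i" "k - m < i - 1" "i - 1 \<le> k" "i \<noteq> 0"
        using i \<open>m \<le> a\<close> \<open>a \<le> k\<close> by auto
      then have "quot c (i - 1) (Suc k - i) = 0" using Z[of "i - 1"] by simp
      moreover have "quot c i (Suc k - i - 1) = 0" if "i \<noteq> Suc k"
        using that i Z[of i] by (simp add: Suc_diff_le)
      ultimately show ?thesis using coeff_quot[of c i "Suc k - i"] i \<open>i \<noteq> 0\<close> by auto
    qed
    have edge: "quot c (Suc k - m) m = quot c (k - m) m - c (Suc k - m) m"
      if "a \<le> k" and Z: "\<And>i. k - m < i \<Longrightarrow> i \<le> k \<Longrightarrow> quot c i (k - i) = 0" for k
    proof -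
      have "quot c (Suc k - m) (m - 1) = 0" if "m \<noteq> 0"
      proof -
        have "k - (Suc k - m) = m - 1" "k - m < Suc k - m" "Suc k - m \<le> k"
          using that \<open>m \<le> a\<close> \<open>a \<le> k\<close> by auto
        then show ?thesis using Z[of "Suc k - m"] by simp
      qed
      moreover have "Suc k - m - 1 = k - m" "Suc k - m \<noteq> 0" using that(1) \<open>m \<le> a\<close> by auto
      ultimately show ?thesis using coeff_quot[of c "Suc k - m" m] by auto
    qed
    \<comment> \<open>From layer a to layer d - 1, the last nonzero entry moves one step in x and
      stays in the row j = m.\<close>
    have main: "quot c (k - m) m \<noteq> 0 \<and> (\<forall>i. k - m < i \<longrightarrow> i \<le> k \<longrightarrow> quot c i (k - i) = 0)"
      if "a \<le> k" "k < d" for k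
      using that
    proof (induction k rule: dec_induct)
      case base
      have "a - h = m" by (simp add: m_def)
      then show ?case using h1 h2 \<open>a - m = h\<close> by auto
    next
      case (step k)
      then have IH: "quot c (k - m) m \<noteq> 0" "\<And>i. k - m < i \<Longrightarrow> i \<le> k \<Longrightarrow> quot c i (k - i) = 0" by auto
      have z: "c i (Suc k - i) = 0" if "k - m < i" "i \<le> Suc k" for i
        using no_term[OF _ _ _ IH(2) that] step a by auto
      have "c (Suc k - m) m = 0" using z[of "Suc k - m"] \<open>m \<le> a\<close> step by auto
      then have "quot c (Suc k - m) m \<noteq> 0" using edge[OF _ IH(2)] IH(1) step by auto
      moreover have "quot c i (Suc k - i) = 0" if "Suc k - m < i" "i \<le> Suc k" for i
        using shift[OF _ IH(2) that] z[of i] that step by auto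
      ultimately show ?case by auto
    qed
    have mainZ: "quot c i (k - i) = 0" if "a \<le> k" "k < d" "k - m < i" "i \<le> k" for i k
      using main[OF that(1,2)] that by auto
    have gap: "c i j = 0" if "a < i + j" "i + j < d" "j \<le> m" for i j
    proof -
      define k where "k = i + j - 1"
      then have k: "Suc k = i + j" using that(1) by simp
      have "c i (Suc k - i) = 0"
        using that k a \<open>m \<le> a\<close> by (intro no_term[OF _ _ _ mainZ]) linarith+
      then show ?thesis by (simp add: k)
    qed
    obtain k where k: "d = Suc k" "a \<le> k" using a(2) by (cases d) auto
    \<comment> \<open>Layer d of the quotient is zero, so the entry carried along the row j = m must
      be cancelled by a coefficient of f.\<close>
    have "c (d - m) m \<noteq> 0"
      using edge[OF k(2) mainZ[OF k(2)]] main[of k] k line[of "d - m" m] \<open>m \<le> a\<close> by auto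
    have "{0, d - m} \<subseteq> terms d" "card {0, d - m} = 2"
      using c0d \<open>c (d - m) m \<noteq> 0\<close> \<open>m \<le> a\<close> a by (auto simp: terms_def)
    then have T: "terms d = {0, d - m}"
      using card_seteq[OF finite_terms, of "{0, d - m}" d] T2 by auto
    \<comment> \<open>With only two monomials of degree d, their signs in the alternating sum must
      be opposite; together with the parity of d this makes m odd.\<close>
    have "1 + (-1) ^ (d - m) * c (d - m) m = 0"
      using top_sum c0d a \<open>m \<le> a\<close> unfolding T by simp
    then have "odd (d - m)" using nonneg[of "d - m" m] by (cases "even (d - m)") auto
    then have "odd m" using \<open>even d\<close> a \<open>m \<le> a\<close> by auto
    then have "0 < m" by (cases m) auto
    \<comment> \<open>Since m > 0, the position (a, 0) lies after the last nonzero entry; hence x^a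
      absorbs the whole 1 that travels along the x-axis.\<close>
    have "quot c a 0 = 0" using mainZ[of a a] a \<open>0 < m\<close> by simp
    then have ca0: "c a 0 = 1" using coeff_quot[of c a 0] h(1)[of "a - 1"] a by simp
    have supp: "(i, j) \<in> {(a, 0), (d - m, m), (0, d)} \<or>
        0 < i \<and> 0 < j \<and> i + j < d \<and> (i + j \<le> a \<or> m < j)" if nz: "c i j \<noteq> 0" for i j
    proof (cases "i + j = d")
      case True
      then have "i \<in> terms d" using nz by (auto simp: terms_def)
      then show ?thesis using T True a \<open>m \<le> a\<close> by auto
    next
      case False
      then have lt: "i + j < d" using support_degree[OF nz] by simp
      then have "0 < i" using nz c0[of j] by (cases i) auto
      show ?thesis
      proof (cases "j = 0")
        case True
        then have "i = a" using nz h(2)[of i] gap[of i 0] lt \<open>0 < i\<close> by (cases i a rule: linorder_cases) auto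
        then show ?thesis using True by simp
      next
        case False
        have "i + j \<le> a \<or> m < j" using gap[of i j] nz lt by (meson not_le)
        then show ?thesis using False lt \<open>0 < i\<close> by simp
      qed
    qed
    have "a \<le> d" using a by simp
    have "frame c d a m"
      unfolding frame_def
      using \<open>odd m\<close> \<open>m \<le> a\<close> \<open>a \<le> d\<close> ca0 c0d \<open>c (d - m) m \<noteq> 0\<close>
      by - (intro conjI allI impI; (assumption | erule supp))
    moreover have "quot c 0 (a - 1) = 1" using g0 a by simp
    moreover have "quot c i j = 0" if "j < m" "a \<le> i + j" for i j
    proof (cases "i + j < d")
      case True
      have "i + j - m < i" using that \<open>m \<le> a\<close> by linarith
      then have "quot c i (i + j - i) = 0" using that True by (intro mainZ) auto
      then show ?thesis by simp
    qed (use quot_eq_0 in auto)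
    ultimately show ?thesis by blast
  qed
qed

lemma card_support_flip: "card {(i, j). c j i \<noteq> 0} = card {(i, j). c i j \<noteq> 0}"
proof -
  have "{(i, j). c j i \<noteq> 0} = prod.swap ` {(i, j). c i j \<noteq> 0}" by auto
  then show ?thesis by (simp add: card_image)
qed

text \<open>One low layer exhausts the budget, so no layer below d is high, and swapping the
  variables leads to the case without low layers.\<close>

lemma frame_or_flip:
  assumes "even d" and N: "2 * card {(i, j). c i j \<noteq> 0} \<le> d + 4"
  shows "\<exists>c'\<in>{c, \<lambda>i j. c j i}. \<exists>a m. frame c' d a m \<and> quot c' 0 (a - 1) = 1 \<and>
    (\<forall>i j. j < m \<longrightarrow> a \<le> i + j \<longrightarrow> quot c' i j = 0)"
proof (cases "\<exists>l. 0 < l \<and> l < d \<and> low l")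
  case True
  then have "{l \<in> {1..<d}. low l} \<noteq> {}" by auto
  then have "0 < card {l \<in> {1..<d}. low l}" by (simp only: card_gt_0_iff) simp
  then have "card {l \<in> {1..<d}. high l} = 0" using ends_bound card_top_ge_2 N by linarith
  then have nhigh: "\<not> high l" if "0 < l" "l < d" for l using that by auto
  interpret F: line_coeffs "\<lambda>i j. c j i" d by (rule flip)
  show ?thesis
    using F.frame_if_not_low nhigh low_flip assms by (auto simp: card_support_flip)
qed (use frame_if_not_low assms in auto)

end

section \<open>Bivariate polynomials and their coefficients\<close>

lemma bipoly_eqI: "(\<And>i j. coeff2 p i j = coeff2 q i j) \<Longrightarrow> p = q"
  unfolding coeff2_def by (intro poly_eqI) blast

lemma coeff2_add [simp]: "coeff2 (p + q) i j = coeff2 p i j + coeff2 q i j"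
  and coeff2_diff [simp]: "coeff2 (p - q) i j = coeff2 p i j - coeff2 q i j"
  by (simp_all add: coeff2_def)

lemma coeff2_varX_power [simp]: "coeff2 (varX ^ a) i j = of_bool (i = a \<and> j = 0)"
proof -
  have "varX ^ a = [:monom 1 a:]"
    by (induction a) (simp_all add: varX_def monom_altdef one_pCons mult.commute)
  then show ?thesis by (cases j) (auto simp: coeff2_def)
qed

lemma coeff2_varY_power_mult [simp]:
  "coeff2 (varY ^ a * q) i j = (if a \<le> j then coeff2 q i (j - a) else 0)"
proof -
  have "varY ^ a = monom 1 a" by (simp add: varY_def monom_altdef)
  then show ?thesis by (simp add: coeff2_def coeff_monom_mult)
qed

lemma coeff2_varY_power [simp]: "coeff2 (varY ^ a) i j = of_bool (i = 0 \<and> j = a)"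
proof -
  have "varY ^ a = monom 1 a" by (simp add: varY_def monom_altdef)
  then show ?thesis by (auto simp: coeff2_def)
qed

definition bipoly_of :: "nat \<Rightarrow> (nat \<Rightarrow> nat \<Rightarrow> real) \<Rightarrow> bipoly" where
  "bipoly_of n c = (\<Sum>j\<le>n. monom (\<Sum>i\<le>n. monom (c i j) i) j)"

lemma coeff2_bipoly_of: "coeff2 (bipoly_of n c) i j = (if i \<le> n \<and> j \<le> n then c i j else 0)"
proof -
  have "coeff2 (bipoly_of n c) i j = (\<Sum>j'\<le>n. if j' = j then \<Sum>i'\<le>n. if i' = i then c i j else 0 else 0)"
    unfolding bipoly_of_def coeff2_def coeff_sum by (intro sum.cong refl) (auto simp: coeff_sum intro!: sum.cong)
  then show ?thesis by auto
qed

section \<open>From values on the line x + y = 1 to coefficients\<close>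

lemma eval2_eq_sum:
  assumes "\<And>i j. n < i + j \<Longrightarrow> coeff2 p i j = 0"
  shows "eval2 p x y = (\<Sum>k\<le>n. \<Sum>i\<le>k. coeff2 p i (k - i) * (x ^ i * y ^ (k - i)))"
proof -
  have poly_upto: "poly q z = (\<Sum>i\<le>n. coeff q i * z ^ i)" if "degree q \<le> n"
    for q :: "'a::comm_semiring_1 poly" and z
    unfolding poly_altdef using that
    by (intro sum.mono_neutral_left) (auto intro: le_degree)
  have "coeff p j = 0" if "n < j" for j
    using assms that by (intro poly_eqI) (auto simp: coeff2_def)
  then have "degree p \<le> n" by (intro degree_le) auto
  have "degree (coeff p j) \<le> n" for j
    using assms by (intro degree_le) (auto simp: coeff2_def)
  then have inner: "poly (coeff p j) x = (\<Sum>i\<le>n. coeff2 p i j * x ^ i)" for j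
    unfolding coeff2_def by (rule poly_upto)
  have "eval2 p x y = (\<Sum>j\<le>n. poly (coeff p j) x * y ^ j)"
    unfolding eval2_def using \<open>degree p \<le> n\<close>
    by (simp add: poly_upto poly_sum)
  also have "\<dots> = (\<Sum>j\<le>n. \<Sum>i\<le>n. coeff2 p i j * (x ^ i * y ^ j))"
    unfolding inner sum_distrib_right by (simp add: mult.assoc)
  also have "\<dots> = (\<Sum>i\<le>n. \<Sum>j\<le>n. coeff2 p i j * (x ^ i * y ^ j))"
    by (rule sum.swap)
  also have "\<dots> = (\<Sum>(i, j)\<in>{..n} \<times> {..n}. coeff2 p i j * (x ^ i * y ^ j))"
    by (rule sum.cartesian_product)
  also have "\<dots> = (\<Sum>(i, j)\<in>{(i, j). i + j \<le> n}. coeff2 p i j * (x ^ i * y ^ j))"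
    using assms by (intro sum.mono_neutral_right) (auto, meson not_le)
  also have "\<dots> = (\<Sum>k\<le>n. \<Sum>i\<le>k. coeff2 p i (k - i) * (x ^ i * y ^ (k - i)))"
    by (rule sum.triangle_reindex_eq)
  finally show ?thesis .
qed

text \<open>On the part of the line with x, y > 0, the ratio t = x / y takes every positive value,
  and the form is y^n times a polynomial in t. That polynomial has infinitely many roots.\<close>

lemma homogeneous_eq_0:
  fixes q :: "nat \<Rightarrow> real"
  assumes "\<And>x y. x + y = 1 \<Longrightarrow> (\<Sum>i\<le>n. q i * (x ^ i * y ^ (n - i))) = 0" "i \<le> n"
  shows "q i = 0"
proof (rule ccontr)
  assume "q i \<noteq> 0"
  have "(\<Sum>i\<le>n. q i * t ^ i) = 0" if "0 < t" for t
  proof -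
    have "q i * ((t / (1 + t)) ^ i * (1 / (1 + t)) ^ (n - i)) = q i * t ^ i * (1 / (1 + t)) ^ n" if "i \<le> n" for i
    proof -
      have "(1 / (1 + t)) ^ n = (1 / (1 + t)) ^ i * (1 / (1 + t)) ^ (n - i)"
        using that by (simp add: power_add[symmetric])
      moreover have "(t / (1 + t)) ^ i = t ^ i * (1 / (1 + t)) ^ i"
        by (simp add: power_mult_distrib[symmetric])
      ultimately show ?thesis by simp
    qed
    then have "(\<Sum>i\<le>n. q i * ((t / (1 + t)) ^ i * (1 / (1 + t)) ^ (n - i))) =
        (\<Sum>i\<le>n. q i * t ^ i) * (1 / (1 + t)) ^ n"
      unfolding sum_distrib_right by (intro sum.cong) auto
    moreover have "t / (1 + t) + 1 / (1 + t) = 1" using that by (simp add: field_simps)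
    ultimately have "(\<Sum>i\<le>n. q i * t ^ i) * (1 / (1 + t)) ^ n = 0"
      using assms(1)[of "t / (1 + t)" "1 / (1 + t)"] by simp
    then show ?thesis using that by simp
  qed
  then have "{0<..} \<subseteq> {t. (\<Sum>i\<le>n. q i * t ^ i) = 0}" by auto
  moreover have "finite {t. (\<Sum>i\<le>n. q i * t ^ i) = 0}"
    using polyfun_rootbound[of q i n] \<open>q i \<noteq> 0\<close> assms(2) by auto
  ultimately show False using infinite_Ioi[of "0::real"] finite_subset by blast
qed

text \<open>On the line, 1 - p equals layer n of the quotient evaluated as a form of degree n; a
  form vanishing there has zero coefficients.\<close>

lemma line_coeffs_if_H2:
  assumes "p \<in> H2 n" "0 < n"
  shows "line_coeffs (coeff2 p) n"
proof
  let ?D = "insert 0 ((\<lambda>(i, j). i + j) ` support2 p)"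
  have fin: "finite ?D" using finite_support2 by simp
  have n: "Max ?D = n" using assms(1) by (simp add: H2_def total_degree_def)
  show zero: "coeff2 p i j = 0" if "n < i + j" for i j
  proof (rule ccontr)
    assume "coeff2 p i j \<noteq> 0"
    then have "i + j \<in> ?D" by (force simp: support2_def)
    then show False using Max_ge[OF fin, of "i + j"] n that by simp
  qed
  have "n \<in> ?D" using Max_in[OF fin] n by blast
  then obtain i j where "i + j = n" "coeff2 p i j \<noteq> 0" using assms(2) by (auto simp: support2_def)
  then show "\<exists>i\<le>n. coeff2 p i (n - i) \<noteq> 0" by (intro exI[of _ i]) auto
  show "quot (coeff2 p) i j = 0" if "i + j = n" for i j
  proof -
    have "(\<Sum>i\<le>n. quot (coeff2 p) i (n - i) * (x ^ i * y ^ (n - i))) = 0" if "x + y = 1" for x y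
    proof -
      have "eval2 p x y = 1" using assms(1) that unfolding H2_def by blast
      then show ?thesis
        using harmonic_sum_line[OF that, of "coeff2 p" n] eval2_eq_sum[of n p x y, OF zero] by linarith
    qed
    then have "quot (coeff2 p) i (n - i) = 0"
      using that by (intro homogeneous_eq_0[where q = "\<lambda>i. quot (coeff2 p) i (n - i)"]) auto
    then show ?thesis using that by auto
  qed
qed (use assms in \<open>auto simp: H2_def\<close>)

lemma total_degree_eqI:
  assumes "\<And>i j. n < i + j \<Longrightarrow> coeff2 p i j = 0" "coeff2 p i j \<noteq> 0" "i + j = n"
  shows "total_degree p = n"
  unfolding total_degree_def
proof (rule Max_eqI)
  show "n \<in> insert 0 ((\<lambda>(i, j). i + j) ` support2 p)"
    using assms(2,3) by (force simp: support2_def)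
  show "y \<le> n" if y: "y \<in> insert 0 ((\<lambda>(i, j). i + j) ` support2 p)" for y
  proof (cases "y = 0")
    case False
    then obtain i j where "y = i + j" "coeff2 p i j \<noteq> 0" using y by (auto simp: support2_def)
    then show ?thesis using assms(1)[of i j] by (meson not_le)
  qed simp
qed (simp add: finite_support2)

lemma total_degree_less:
  assumes "\<And>i j. n \<le> i + j \<Longrightarrow> coeff2 p i j = 0" "0 < n"
  shows "total_degree p < n"
proof -
  have "i + j < n" if "coeff2 p i j \<noteq> 0" for i j
    using assms(1)[of i j] that by (meson not_le)
  then show ?thesis
    unfolding total_degree_def using assms(2) finite_support2[of p]
    by (subst Max_less_iff) (auto simp: support2_def)
qed

section \<open>Polynomials rebuilt from coefficient arrays\<close>

context line_coeffs
begin

lemma coeff2_bipoly_of_line: "coeff2 (bipoly_of d c) = c"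
proof (intro ext)
  fix i j
  show "coeff2 (bipoly_of d c) i j = c i j"
    using support_degree[of i j] by (cases "c i j = 0") (auto simp: coeff2_bipoly_of)
qed

lemma bipoly_of_H2: "bipoly_of d c \<in> H2 d"
proof -
  obtain i where i: "i \<le> d" "c i (d - i) \<noteq> 0" using top_nonzero by blast
  have "total_degree (bipoly_of d c) = d"
    by (rule total_degree_eqI[of d _ i "d - i"]) (use i degree_le in \<open>auto simp: coeff2_bipoly_of_line\<close>)
  moreover have "eval2 (bipoly_of d c) x y = 1" if "x + y = 1" for x y
    using eval2_eq_sum[of d "bipoly_of d c" x y] harmonic_sum_line[OF that, of c d] degree_le line
    by (simp add: coeff2_bipoly_of_line)
  ultimately show ?thesis using nonneg by (simp add: H2_def coeff2_bipoly_of_line)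
qed

end

section \<open>Splitting at a corner\<close>

text \<open>The later polynomial q: the rows from a on, divided by y^a. The polynomial p comes from
  \<open>lower\<close>, the rows before a closed off by y^a with coefficient 1.\<close>

definition upper :: "nat \<Rightarrow> (nat \<Rightarrow> nat \<Rightarrow> real) \<Rightarrow> nat \<Rightarrow> nat \<Rightarrow> real" where
  "upper a c i j = c i (j + a)"

definition lower :: "nat \<Rightarrow> (nat \<Rightarrow> nat \<Rightarrow> real) \<Rightarrow> nat \<Rightarrow> nat \<Rightarrow> real" where
  "lower a c i j = (if j < a then c i j else of_bool (i = 0 \<and> j = a))"

text \<open>Row a - 1 of the quotient is 1, 0, 0, ..., which is exactly what the recursion feeds in
  at the origin. Row a therefore starts a fresh quotient.\<close>

lemma quot_upper:
  assumes "0 < a" "quot c 0 (a - 1) = 1" "\<And>i. quot c (Suc i) (a - 1) = 0"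
  shows "quot (upper a c) i j = quot c i (j + a)"
proof -
  obtain a' where a': "a = Suc a'" using assms(1) by (cases a) auto
  have "quot u i j = quot c i (j + a)" if "u = upper a c" for u
    using that assms(2,3) by (induction u i j rule: quot.induct) (auto simp: upper_def a')
  then show ?thesis by simp
qed

text \<open>The added monomial y^a absorbs the row 1, 0, 0, ..., and nothing is passed on to the
  rows from a on.\<close>

lemma quot_lower:
  assumes "0 < a" "quot c 0 (a - 1) = 1" "\<And>i. quot c (Suc i) (a - 1) = 0"
  shows "quot (lower a c) i j = (if j < a then quot c i j else 0)"
proof -
  obtain a' where a': "a = Suc a'" using assms(1) by (cases a) auto
  have "quot u i j = (if j < a then quot c i j else 0)" if "u = lower a c" for u
    using that assms(2,3)
  proof (induction u i j rule: quot.induct)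
    case (3 u j)
    then show ?case by (cases "j = a'") (auto simp: lower_def a')
  next
    case (4 u i j)
    then show ?case by (cases "j = a'") (auto simp: lower_def a')
  qed (auto simp: lower_def a')
  then show ?thesis by simp
qed

context line_coeffs
begin

context
  fixes a :: nat
  assumes frame: "frame c d a a" and lt: "a < d"
    and corner: "quot c 0 (a - 1) = 1"
    and below: "\<And>i j. j < a \<Longrightarrow> a \<le> i + j \<Longrightarrow> quot c i j = 0"
begin

lemma a_pos: "0 < a"
  using frame by (cases a) (auto simp: frame_def)

lemma below': "quot c (Suc i) (a - 1) = 0"
  using below[of "a - 1" "Suc i"] a_pos by simp

lemma line_upper: "line_coeffs (upper a c) (d - a)"
proof
  show "\<exists>i\<le>d - a. upper a c i (d - a - i) \<noteq> 0"
    using frame lt by (intro exI[of _ 0]) (auto simp: upper_def frame_def)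
  show "quot (upper a c) i j = 0" if "i + j = d - a" for i j
    using quot_eq_0[of i "j + a"] that lt
    by (simp add: quot_upper[OF a_pos corner below'])
qed (use nonneg degree_le lt in \<open>auto simp: upper_def\<close>)

text \<open>For j < a a monomial of degree above a would lie in the empty strip of the frame or be
  one of its corners, and none of the corners qualifies.\<close>

lemma line_lower: "line_coeffs (lower a c) a"
proof
  show "\<exists>i\<le>a. lower a c i (a - i) \<noteq> 0"
    by (intro exI[of _ 0]) (auto simp: lower_def)
  show "quot (lower a c) i j = 0" if "i + j = a" for i j
    using below[of j i] that by (simp add: quot_lower[OF a_pos corner below'])
  show "lower a c i j = 0" if "a < i + j" for i j
  proof (cases "j < a")
    case True
    have "c i j = 0"
    proof (rule ccontr)
      assume "c i j \<noteq> 0"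
      then have "(i, j) \<in> {(a, 0), (d - a, a), (0, d)} \<or>
          0 < i \<and> 0 < j \<and> i + j < d \<and> (i + j \<le> a \<or> a < j)"
        using frame unfolding frame_def by blast
      then show False using True that lt by auto
    qed
    then show ?thesis using True by (simp add: lower_def)
  next
    case False
    then show ?thesis using that by (auto simp: lower_def)
  qed
  show "0 \<le> lower a c i j" for i j using nonneg by (simp add: lower_def)
qed (rule a_pos)

text \<open>Row a of \<open>c\<close> belongs to \<open>upper\<close>, so the closing y^a of
  \<open>lower\<close> is the only monomial counted in addition.\<close>

lemma card_support_split:
  "card {(i, j). c i j \<noteq> 0} + 1 = card {(i, j). lower a c i j \<noteq> 0} + card {(i, j). upper a c i j \<noteq> 0}"
proof -
  interpret U: line_coeffs "upper a c" "d - a" by (rule line_upper)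
  interpret W: line_coeffs "lower a c" a by (rule line_lower)
  let ?S = "{(i, j). c i j \<noteq> 0}" and ?U = "{(i, j). upper a c i j \<noteq> 0}"
    and ?W = "{(i, j). lower a c i j \<noteq> 0}"
  let ?V = "(\<lambda>(i, j). (i, j + a)) ` ?U"
  have "?S = (?W - {(0, a)}) \<union> ?V"
  proof (intro set_eqI)
    fix x :: "nat \<times> nat"
    obtain i j where x: "x = (i, j)" by (cases x)
    have "(i, j) \<in> ?V \<longleftrightarrow> a \<le> j \<and> c i j \<noteq> 0"
    proof
      assume R: "a \<le> j \<and> c i j \<noteq> 0"
      then have "(i, j - a) \<in> ?U" by (simp add: upper_def)
      moreover have "(i, j) = (\<lambda>(i, j). (i, j + a)) (i, j - a)" using R by simp
      ultimately show "(i, j) \<in> ?V" by (rule rev_image_eqI)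
    qed (auto simp: upper_def)
    then show "x \<in> ?S \<longleftrightarrow> x \<in> (?W - {(0, a)}) \<union> ?V"
      unfolding x by (auto simp: lower_def)
  qed
  moreover have "(?W - {(0, a)}) \<inter> ?V = {}"
    by (auto simp: lower_def)
  ultimately have "card ?S = card (?W - {(0, a)}) + card ?V"
    using W.finite_support U.finite_support by (simp add: card_Un_disjoint)
  moreover have "card ?V = card ?U" by (intro card_image) (auto simp: inj_on_def)
  moreover have "card ?W = Suc (card (?W - {(0, a)}))"
    by (intro card.remove W.finite_support) (auto simp: lower_def)
  ultimately show ?thesis by simp
qed

end

end

lemma num_terms_lower_bound:
  assumes "p \<in> H2 n" "0 < n"
  shows "n + 3 \<le> 2 * num_terms p"
proof -
  interpret line_coeffs "coeff2 p" n by (rule line_coeffs_if_H2[OF assms])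
  show ?thesis using ends_bound card_top_ge_2 by (simp add: num_terms_def support2_def)
qed

section \<open>Explicit members of H(2,d) with (d + 4) / 2 monomials\<close>

definition bipoly_of_list :: "(real \<times> nat \<times> nat) list \<Rightarrow> bipoly" where
  "bipoly_of_list ts = (\<Sum>(w, k, l)\<leftarrow>ts. monom (monom w k) l)"

lemma coeff2_bipoly_of_list:
  "coeff2 (bipoly_of_list ts) i j = (\<Sum>(w, k, l)\<leftarrow>ts. if k = i \<and> l = j then w else 0)"
  by (induction ts) (auto simp: bipoly_of_list_def, auto simp: coeff2_def)

lemma eval2_bipoly_of_list:
  "eval2 (bipoly_of_list ts) x y = (\<Sum>(w, k, l)\<leftarrow>ts. w * x ^ k * y ^ l)"
  by (induction ts) (auto simp: bipoly_of_list_def eval2_def poly_monom)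

text \<open>Positive weights cannot cancel, so the listed monomial of degree n survives. Repeated
  exponents would only lower the number of terms, hence the inequality.\<close>

lemma ex_H2_of_list:
  fixes ts :: "(real \<times> nat \<times> nat) list"
  assumes pos: "\<forall>(w, k, l)\<in>set ts. 0 < w \<and> k + l \<le> n"
    and top: "\<exists>(w, k, l)\<in>set ts. k + l = n"
    and line: "\<And>x y. x + y = 1 \<Longrightarrow> (\<Sum>(w, k, l)\<leftarrow>ts. w * x ^ k * y ^ l) = 1"
  shows "\<exists>p\<in>H2 n. num_terms p \<le> length ts"
proof
  let ?p = "bipoly_of_list ts"
  have nonneg: "0 \<le> coeff2 ?p i j" for i j
    unfolding coeff2_bipoly_of_list using pos by (intro sum_list_nonneg) (auto split: if_splits)
  have supp: "(i, j) \<in> snd ` set ts" if "coeff2 ?p i j \<noteq> 0" for i j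
    using that unfolding coeff2_bipoly_of_list
    by (induction ts) (auto split: if_splits)
  have "coeff2 ?p i j = 0" if "n < i + j" for i j
    using supp[of i j] pos that by force
  moreover obtain w k l where wkl: "(w, k, l) \<in> set ts" "k + l = n" using top by auto
  moreover have "coeff2 ?p k l \<noteq> 0"
  proof -
    let ?f = "\<lambda>(w', k', l'). if k' = k \<and> l' = l then w' else 0 :: real"
    have "?f (w, k, l) \<in> set (map ?f ts)"
      unfolding set_map by (rule imageI) (rule wkl(1))
    then have "?f (w, k, l) \<le> coeff2 ?p k l"
      unfolding coeff2_bipoly_of_list using pos
      by (intro member_le_sum_list) (auto split: if_splits)
    then show ?thesis using pos wkl(1) by auto
  qed
  ultimately have "total_degree ?p = n" by (intro total_degree_eqI)
  then show "?p \<in> H2 n" using nonneg line by (simp add: H2_def eval2_bipoly_of_list)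
  have "support2 ?p \<subseteq> snd ` set ts" using supp by (auto simp: support2_def)
  then have "num_terms ?p \<le> card (snd ` set ts)"
    unfolding num_terms_def by (intro card_mono) auto
  also have "\<dots> \<le> length ts" using card_image_le card_length le_trans by (metis List.finite_set)
  finally show "num_terms ?p \<le> length ts" .
qed

text \<open>The witnesses are glued as in the theorem, with (a, b) = (1,3), (1,5), (1,7), (3,7),
  (5,7), from x + y, x^3 + 3xy + y^3, x^5 + 5x^3 y + 5xy^2 + y^5 and x^7 + 7x^3 y + 7x^3 y^3 + 7xy^3
  + y^7.\<close>

lemma ex_H2_few_terms:
  assumes "even n" "2 < n" "n \<le> 12"
  shows "\<exists>p\<in>H2 n. 2 * num_terms p \<le> n + 4"
proof -
  have *: ?thesis
    if "\<exists>p\<in>H2 n. num_terms p \<le> length ts" "2 * length ts = n + 4" for ts :: "(real \<times> nat \<times> nat) list"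
    using that by (metis mult_le_mono2)
  obtain k where k: "n = 2 * k" using assms(1) by auto
  then consider "n = 4" | "n = 6" | "n = 8" | "n = 10" | "n = 12"
    using assms(2,3) by fastforce
  then show ?thesis
  proof cases
    case 1
    show ?thesis
    proof (rule *, rule ex_H2_of_list)
      show "(\<Sum>(w, k, l)\<leftarrow>[(1, 1, 0), (1, 3, 1), (3, 1, 2), (1, 0, 4)].
          w * x ^ k * y ^ l) = 1" if "x + y = 1" for x y :: real
        using that by (simp, algebra)
    qed (use 1 in auto)
  next
    case 2
    show ?thesis
    proof (rule *, rule ex_H2_of_list)
      show "(\<Sum>(w, k, l)\<leftarrow>[(1, 1, 0), (1, 5, 1), (5, 3, 2), (5, 1, 3), (1, 0, 6)].
          w * x ^ k * y ^ l) = 1" if "x + y = 1" for x y :: real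
        using that by (simp, algebra)
    qed (use 2 in auto)
  next
    case 3
    show ?thesis
    proof (rule *, rule ex_H2_of_list)
      show "(\<Sum>(w, k, l)\<leftarrow>[(1, 1, 0), (1, 7, 1), (7, 3, 2), (7, 3, 4), (7, 1, 4), (1, 0, 8)].
          w * x ^ k * y ^ l) = 1" if "x + y = 1" for x y :: real
        using that by (simp, algebra)
    qed (use 3 in auto)
  next
    case 4
    show ?thesis
    proof (rule *, rule ex_H2_of_list)
      show "(\<Sum>(w, k, l)\<leftarrow>[(1, 3, 0), (3, 1, 1), (1, 7, 3), (7, 3, 4), (7, 3, 6), (7, 1, 6), (1, 0, 10)].
          w * x ^ k * y ^ l) = 1" if "x + y = 1" for x y :: real
        using that by (simp, algebra)
    qed (use 4 in auto)
  next
    case 5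
    show ?thesis
    proof (rule *, rule ex_H2_of_list)
      show "(\<Sum>(w, k, l)\<leftarrow>[(1, 5, 0), (5, 3, 1), (5, 1, 2), (1, 7, 5), (7, 3, 6), (7, 3, 8), (7, 1, 8), (1, 0, 12)].
          w * x ^ k * y ^ l) = 1" if "x + y = 1" for x y :: real
        using that by (simp, algebra)
    qed (use 5 in auto)
  qed
qed

section \<open>Refutation trees\<close>

fun adj :: "int list \<Rightarrow> int list" where
  "adj (x # y # r) = (x + y) # adj (y # r)"
| "adj [x] = []"
| "adj [] = []"

lemma length_adj: "length (adj xs) = length xs - 1"
  by (induction xs rule: adj.induct) auto

text \<open>
  A table L is given by its top diagonal L(0,d), ..., L(d,0). The diagonals are listed by increasing
  degree, each starting from its power of y.
\<close>

function layers :: "int list \<Rightarrow> int list list" where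
  "layers [] = []"
| "layers (x # r) = layers (adj (x # r)) @ [x # r]"
  by pat_completeness auto
termination by (relation "measure length") (auto simp: length_adj)

text \<open>The clause of a table: at which monomials L is positive. Degree 0 is cut off, because f
  has no constant term in the situations considered.\<close>

definition mask :: "int list \<Rightarrow> bool list" where
  "mask t = map (\<lambda>x. 0 < x) (concat (tl (layers t)))"

definition valid :: "nat \<Rightarrow> int list \<Rightarrow> bool" where
  "valid d t \<longleftrightarrow> length t = Suc d \<and> 0 \<le> hd (hd (layers t)) \<and> (0 < hd (hd (layers t)) \<or> hd t < 0)"

section \<open>The search for supports that meet all clauses\<close>

datatype status = Free | Chosen | Out

text \<open>A clause shorter than the status list is rejected. A clause number out of range is read
  as [] and thus can never justify a step.\<close>

fun unhit :: "status list \<Rightarrow> bool list \<Rightarrow> bool" where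
  "unhit [] ps = True"
| "unhit (a # as) [] = False"
| "unhit (Free # as) (p # ps) = unhit as ps"
| "unhit (Out # as) (p # ps) = unhit as ps"
| "unhit (Chosen # as) (False # ps) = unhit as ps"
| "unhit (Chosen # as) (True # ps) = False"

text \<open>The accumulator reverses the free positions. All columns are reversed alike, so the rows
  assembled from them still belong to single positions.\<close>

fun sel :: "status list \<Rightarrow> bool list \<Rightarrow> bool list \<Rightarrow> bool list option" where
  "sel [] ps acc = Some acc"
| "sel (a # as) [] acc = None"
| "sel (Free # as) (p # ps) acc = sel as ps (p # acc)"
| "sel (Out # as) (p # ps) acc = sel as ps acc"
| "sel (Chosen # as) (False # ps) acc = sel as ps acc"
| "sel (Chosen # as) (True # ps) acc = None"

fun cons_col :: "bool list \<Rightarrow> bool list list \<Rightarrow> bool list list" where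
  "cons_col (p # ps) (r # rs) = (p # r) # cons_col ps rs"
| "cons_col [] rs = []"
| "cons_col (p # ps) [] = []"

fun push_col :: "bool list option \<Rightarrow> bool list list option \<Rightarrow> bool list list option" where
  "push_col (Some ps) (Some rs) = Some (cons_col ps rs)"
| "push_col None rs = None"
| "push_col (Some ps) None = None"

fun blank :: "status list \<Rightarrow> bool list list" where
  "blank [] = []"
| "blank (Free # as) = [] # blank as"
| "blank (Out # as) = blank as"
| "blank (Chosen # as) = blank as"

text \<open>The incidence matrix of a covering problem: a row per free position, a column per clause
  listed at the leaf. \<open>None\<close> arises when a chosen position already meets one of the
  clauses or a clause is too short.\<close>

primrec rows :: "(int \<Rightarrow> bool list) \<Rightarrow> status list \<Rightarrow> int list \<Rightarrow> bool list list option" where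
  "rows M as [] = Some (blank as)"
| "rows M as (k # ks) = push_col (sel as (M k) []) (rows M as ks)"

fun full :: "bool list \<Rightarrow> bool" where
  "full [] = True" | "full (True # ds) = full ds" | "full (False # ds) = False"

fun useful :: "bool list \<Rightarrow> bool list \<Rightarrow> bool" where
  "useful (True # ds) (v # vs) = useful ds vs"
| "useful (False # ds) (v # vs) = v"
| "useful [] vs = False"
| "useful (d # ds) [] = False"

fun join :: "bool list \<Rightarrow> bool list \<Rightarrow> bool list" where
  "join (True # ds) (v # vs) = True # join ds vs"
| "join (False # ds) (v # vs) = v # join ds vs"
| "join [] vs = []"
| "join (d # ds) [] = []"

text \<open>Exhaustive search for at most r rows that meet all clauses still open in
  \<open>dn\<close>. Any cover contains a row meeting the first open clause, so only such rows are
  tried; \<open>cs\<close> holds those left at the current level. \<open>hit_with\<close> takes the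
  test as an argument in place of a conditional.\<close>

function hit :: "nat \<Rightarrow> bool list \<Rightarrow> bool list list \<Rightarrow> bool list list \<Rightarrow> bool"
  and hit_with :: "bool \<Rightarrow> nat \<Rightarrow> bool list \<Rightarrow> bool list \<Rightarrow> bool list list \<Rightarrow> bool" where
  "hit 0 dn rs cs = full dn"
| "hit (Suc r) dn rs [] = full dn"
| "hit (Suc r) dn rs (v # vs) = (hit_with (useful dn v) r dn v rs \<or> hit (Suc r) dn rs vs)"
| "hit_with False r dn v rs = False"
| "hit_with True r dn v rs = hit r (join dn v) rs rs"
  by pat_completeness auto
termination
  \<comment> \<open>The weight 2 r + 1 puts the auxiliary call strictly between \<open>hit\<close>
    at r + 1 and \<open>hit\<close> at r; the list length decides when r stays the same.\<close>
  by (relation "measures [\<lambda>x. case x of Inl (r, dn, rs, cs) \<Rightarrow> 2 * r | Inr (b, r, dn, v, rs) \<Rightarrow> 2 * r + 1,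
      \<lambda>x. case x of Inl (r, dn, rs, cs) \<Rightarrow> length cs | Inr _ \<Rightarrow> 0]") auto

fun refuted :: "nat \<Rightarrow> bool list \<Rightarrow> bool list list option \<Rightarrow> bool" where
  "refuted r dn None = False"
| "refuted r dn (Some rs) = (\<not> hit r dn rs rs)"

primrec falses :: "int list \<Rightarrow> bool list" where
  "falses [] = []" | "falses (k # ks) = False # falses ks"

fun onto :: "status list \<Rightarrow> status list \<Rightarrow> status list" where
  "onto [] as = as" | "onto (p # ps) as = onto ps (p # as)"

text \<open>\<open>pre\<close> is the reversed prefix of a zipper. A child stands for the supports
  whose first free position meeting the clause is the newly chosen one, so earlier candidates become
  \<open>Out\<close>.\<close>

fun kids :: "status list \<Rightarrow> status list \<Rightarrow> bool list \<Rightarrow> status list list" where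
  "kids pre [] ps = []"
| "kids pre (a # as) [] = []"
| "kids pre (Free # as) (True # ps) = onto pre (Chosen # as) # kids (Out # pre) as ps"
| "kids pre (Free # as) (False # ps) = kids (Free # pre) as ps"
| "kids pre (Out # as) (p # ps) = kids (Out # pre) as ps"
| "kids pre (Chosen # as) (p # ps) = kids (Chosen # pre) as ps"

text \<open>
  An inner node branches over the free positions at which the given clause holds; a leaf lists clauses
  that cannot all be met by r further positions. The functions below avoid conditionals, because
  their congruence rules make the simplifier traverse large arguments again at every step.
\<close>

datatype tree = L "int list" | B int "tree list"

fun check :: "(int \<Rightarrow> bool list) \<Rightarrow> nat \<Rightarrow> status list \<Rightarrow> tree \<Rightarrow> bool"
  and checks :: "(int \<Rightarrow> bool list) \<Rightarrow> nat \<Rightarrow> status list list \<Rightarrow> tree list \<Rightarrow> bool" where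
  "check M r as (L ks) = refuted r (falses ks) (rows M as ks)"
| "check M 0 as (B k ts) = False"
| "check M (Suc r) as (B k ts) = (unhit as (M k) \<and> checks M r (kids [] as (M k)) ts)"
| "checks M r [] ts = True"
| "checks M r (a # as) [] = False"
| "checks M r (a # as) (t # ts) = (check M r a t \<and> checks M r as ts)"

text \<open>The order is that of the concatenated diagonals of a table without degree 0, so masks
  and statuses correspond index by index.\<close>

definition positions :: "nat \<Rightarrow> (nat \<times> nat) list" where
  "positions d = concat (map (\<lambda>k. map (\<lambda>i. (i, k - i)) [0..<Suc k]) [1..<Suc d])"

definition status_of :: "nat \<Rightarrow> nat \<Rightarrow> nat \<Rightarrow> nat \<times> nat \<Rightarrow> status" where
  "status_of d a m = (\<lambda>(i, j). if (i, j) \<in> {(a, 0), (d - m, m), (0, d)} then Chosen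
     else if 0 < i \<and> 0 < j \<and> i + j < d \<and> (i + j \<le> a \<or> m < j) then Free else Out)"

definition statuses :: "nat \<Rightarrow> nat \<Rightarrow> nat \<Rightarrow> status list" where
  "statuses d a m = map (status_of d a m) (positions d)"

primrec refutes :: "(int \<Rightarrow> bool list) \<Rightarrow> nat \<Rightarrow> nat \<Rightarrow> (nat \<times> nat \<times> tree) list \<Rightarrow> bool" where
  "refutes M d r [] = True"
| "refutes M d r (x # xs) =
    (check M r (statuses d (fst x) (fst (snd x))) (snd (snd x)) \<and> refutes M d r xs)"

text \<open>Clauses are numbered from 2, so that every index is a numeral.\<close>

definition clause :: "bool list list \<Rightarrow> int \<Rightarrow> bool list" where
  "clause xs k = (if 2 \<le> k \<and> nat k - 2 < length xs then xs ! (nat k - 2) else [])"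

text \<open>Unfolds into one equation per numeral, which serve as rewrite rules for looking up a
  clause.\<close>

primrec tab :: "(int \<Rightarrow> 'a) \<Rightarrow> num \<Rightarrow> 'a list \<Rightarrow> bool" where
  "tab f n [] = True"
| "tab f n (x # xs) = (f (numeral n) = x \<and> tab f (Num.inc n) xs)"

lemma tab_nth: "(\<And>i. i < length xs \<Longrightarrow> f (numeral n + int i) = xs ! i) \<Longrightarrow> tab f n xs"
proof (induction xs arbitrary: n)
  case (Cons x xs)
  have "f (numeral (Num.inc n) + int i) = xs ! i" if "i < length xs" for i
  proof -
    have "numeral (Num.inc n) + int i = numeral n + int (Suc i)"
      by (simp only: numeral_inc of_nat_Suc ac_simps)
    then show ?thesis
      using Cons.prems[of "Suc i"] that by (simp only: length_Cons Suc_less_eq nth_Cons_Suc)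
  qed
  then show ?case using Cons.IH Cons.prems[of 0] by simp
qed simp

lemma tab_clause: "tab (clause xs) (num.Bit0 num.One) xs"
  by (rule tab_nth) (simp add: clause_def nat_add_distrib)

lemmas check_rules = unhit.simps sel.simps cons_col.simps push_col.simps blank.simps rows.simps
  full.simps useful.simps join.simps hit.simps hit_with.simps refuted.simps falses.simps onto.simps
  kids.simps check.simps checks.simps refutes.simps fst_conv snd_conv simp_thms

text \<open>X stands for the indices of the monomials in a support. An empty clause asserts nothing,
  as it stands for a number out of range; \<open>as\<close> being nonempty lets \<open>unhit\<close>
  exclude that case.\<close>

definition compatible :: "(int \<Rightarrow> bool list) \<Rightarrow> nat \<Rightarrow> status list \<Rightarrow> nat set \<Rightarrow> bool" where
  "compatible M r as X \<longleftrightarrow> as \<noteq> [] \<and> X \<subseteq> {..<length as} \<and> (\<forall>i\<in>X. as ! i \<noteq> Out) \<and>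
    card {i \<in> X. as ! i = Free} \<le> r \<and> (\<forall>k. M k = [] \<or> (\<exists>i\<in>X. i < length (M k) \<and> M k ! i))"

definition frees :: "status list \<Rightarrow> nat list" where
  "frees as = filter (\<lambda>i. as ! i = Free) [0..<length as]"

lemma frees_Nil: "frees [] = []"
  by (simp add: frees_def)

lemma frees_Cons: "frees (a # as) = (if a = Free then [0] else []) @ map Suc (frees as)"
  unfolding frees_def length_Cons upt_conv_Cons[OF zero_less_Suc] map_Suc_upt[symmetric]
  by (simp add: filter_map o_def)

lemma unhit_nth:
  assumes "unhit as P"
  shows "length as \<le> length P" "i < length as \<Longrightarrow> as ! i = Chosen \<Longrightarrow> \<not> P ! i"
  using assms by (induction as P arbitrary: i rule: unhit.induct) (auto simp: nth_Cons split: nat.splits)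

lemma sel_SomeD:
  "sel as P acc = Some c \<Longrightarrow> unhit as P \<and> c = rev (map ((!) P) (frees as)) @ acc"
  by (induction as P acc rule: sel.induct) (auto simp: frees_Nil frees_Cons o_def)

lemma blank_eq: "blank as = map (\<lambda>i. []) (frees as)"
  by (induction as rule: blank.induct) (auto simp: frees_Nil frees_Cons o_def)

lemma cons_col_map: "cons_col (map f xs) (map g xs) = map (\<lambda>x. f x # g x) xs"
  by (induction xs) auto

lemma rows_SomeD:
  "rows M as ks = Some rs \<Longrightarrow>
    (\<forall>k\<in>set ks. unhit as (M k)) \<and> rs = map (\<lambda>i. map (\<lambda>k. M k ! i) ks) (rev (frees as))"
proof (induction ks arbitrary: rs)
  case Nil
  then show ?case by (auto simp: blank_eq map_replicate_const)
next
  case (Cons k ks)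
  then obtain c rs' where "sel as (M k) [] = Some c" "rows M as ks = Some rs'" "rs = cons_col c rs'"
    by (cases "sel as (M k) []"; cases "rows M as ks") auto
  then show ?case
    using sel_SomeD[of as "M k" "[]" c] Cons.IH[of rs'] by (simp add: rev_map cons_col_map)
qed

lemma length_falses: "length (falses ks) = length ks"
  by (induction ks) auto

lemma full_iff: "full dn \<longleftrightarrow> (\<forall>j<length dn. dn ! j)"
  by (induction dn rule: full.induct) (auto simp: nth_Cons split: nat.splits)

text \<open>The pivot is the first open clause. It depends on \<open>dn\<close> only and not on the
  row under test.\<close>

lemma useful_pivot:
  "\<not> full dn \<Longrightarrow> \<exists>j<length dn. \<not> dn ! j \<and> (\<forall>v. length v = length dn \<longrightarrow> useful dn v = v ! j)"
proof (induction dn rule: full.induct)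
  case (2 ds)
  then obtain j where "j < length ds" "\<not> ds ! j" "\<And>v. length v = length ds \<Longrightarrow> useful ds v = v ! j"
    by auto
  then show ?case by (intro exI[of _ "Suc j"]) (auto simp: length_Suc_conv)
next
  case (3 ds)
  then show ?case by (intro exI[of _ 0]) (auto simp: length_Suc_conv)
qed simp

lemma join_nth:
  assumes "length v = length dn"
  shows "length (join dn v) = length dn \<and> (\<forall>j<length dn. join dn v ! j = (dn ! j \<or> v ! j))"
  using assms
proof (induction dn arbitrary: v)
  case (Cons d dn)
  then obtain x v' where "v = x # v'" "length v' = length dn" by (cases v) auto
  then show ?case using Cons.IH[of v'] by (cases d) (auto simp: nth_Cons split: nat.splits)
qed simp

lemma hit_if_full: "full dn \<Longrightarrow> hit r dn rs cs"
proof (cases r)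
  case (Suc r')
  assume "full dn"
  then show ?thesis unfolding Suc by (induction cs) simp_all
qed simp

lemma hit_if_mem:
  assumes "v \<in> set cs" "useful dn v" "hit r (join dn v) rs rs"
  shows "hit (Suc r) dn rs cs"
  using assms by (induction cs) auto

text \<open>Some row of the cover R meets the pivot clause. The search tries this row, and R without
  it covers what is still open.\<close>

lemma hit_complete:
  assumes "\<forall>v\<in>set rs. length v = length dn" "R \<subseteq> set rs" "finite R" "card R \<le> r"
    and "\<forall>j<length dn. dn ! j \<or> (\<exists>v\<in>R. v ! j)"
  shows "hit r dn rs rs"
  using assms
proof (induction r arbitrary: dn R)
  case 0
  then show ?case by (auto simp: full_iff)
next
  case (Suc r)
  show ?case
  proof (cases "full dn")
    case False
    then obtain j where j: "j < length dn" "\<not> dn ! j"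
      "\<And>v. length v = length dn \<Longrightarrow> useful dn v = v ! j" using useful_pivot by blast
    then obtain v where v: "v \<in> R" "v ! j" using Suc.prems(5) by blast
    then have mem: "v \<in> set rs" "length v = length dn" using Suc.prems(1,2) by auto
    have len: "length (join dn v) = length dn" using join_nth[OF mem(2)] by simp
    have "hit r (join dn v) rs rs"
    proof (rule Suc.IH[of "join dn v" "R - {v}"])
      show "\<forall>j<length (join dn v). join dn v ! j \<or> (\<exists>v\<in>R - {v}. v ! j)"
        using Suc.prems(5) join_nth[OF mem(2)] by auto
      show "card (R - {v}) \<le> r" using Suc.prems(3,4) v(1) by simp
    qed (use Suc.prems len in auto)
    then show ?thesis using hit_if_mem mem j(3) v(2) by blast
  qed (rule hit_if_full)
qed

text \<open>The clause is met by some position of X, which is not \<open>Out\<close> and, by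
  \<open>unhit\<close>, not \<open>Chosen\<close>.\<close>

lemma free_hit:
  assumes "compatible M r as X" "unhit as (M k)"
  obtains i where "i \<in> X" "as ! i = Free" "M k ! i" "i < length as"
proof -
  have "M k \<noteq> []" using assms unhit_nth(1)[OF assms(2)] by (auto simp: compatible_def)
  then obtain i where i: "i \<in> X" "M k ! i" using assms(1) unfolding compatible_def by blast
  then have "i < length as" "as ! i \<noteq> Out" using assms(1) by (auto simp: compatible_def)
  moreover have "as ! i \<noteq> Chosen" using unhit_nth(2)[OF assms(2) \<open>i < length as\<close>] i(2) by blast
  ultimately show thesis using that i by (cases "as ! i") auto
qed

text \<open>Closed form of the entries of \<open>kids\<close>, indexed by the position branched
  on.\<close>

definition child :: "status list \<Rightarrow> bool list \<Rightarrow> nat \<Rightarrow> status list" where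
  "child as P i = map (\<lambda>j. if j = i then Chosen else if j < i \<and> as ! j = Free \<and> P ! j then Out else as ! j)
    [0..<length as]"

lemma child_0: "child (a # as) P 0 = Chosen # as"
  unfolding child_def length_Cons upt_conv_Cons[OF zero_less_Suc] map_Suc_upt[symmetric]
  by (simp add: o_def map_nth)

lemma child_Suc:
  "child (a # as) (p # P) (Suc i) = (if a = Free \<and> p then Out else a) # child as P i"
  unfolding child_def length_Cons upt_conv_Cons[OF zero_less_Suc] map_Suc_upt[symmetric]
  by (simp add: o_def)

lemma onto_eq: "onto pre as = rev pre @ as"
  by (induction pre as rule: onto.induct) auto

lemma child_in_kids:
  assumes "i < length as" "as ! i = Free" "P ! i" "length as \<le> length P"
  shows "rev pre @ child as P i \<in> set (kids pre as P)"
  using assms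
proof (induction as arbitrary: pre P i)
  case (Cons a as)
  then obtain p P' where P: "P = p # P'" by (cases P) auto
  show ?case
  proof (cases i)
    case 0
    then show ?thesis using Cons.prems P by (simp add: child_0 onto_eq)
  next
    case (Suc i')
    have IH: "rev pre' @ child as P' i' \<in> set (kids pre' as P')" for pre'
      using Cons.prems P Suc by (intro Cons.IH) auto
    show ?thesis
      using IH[of "(if a = Free \<and> p then Out else a) # pre"]
      by (cases a; cases p) (simp_all add: P Suc child_Suc)
  qed
qed simp

text \<open>At a leaf, the free positions of X would form a cover by at most r rows. At an inner
  node, the least free position of X meeting the clause selects the child: earlier free positions
  that meet the clause are not in X, so marking them \<open>Out\<close> does no harm.\<close>

lemma check_sound:
  "check M r as t \<Longrightarrow> \<not> compatible M r as X"
  "checks M r ass ts \<Longrightarrow> as' \<in> set ass \<Longrightarrow> \<not> compatible M r as' X"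
proof (induction M r as t and M r ass ts arbitrary: X and as' X rule: check_checks.induct)
  case (1 M r as ks)
  show ?case
  proof
    assume comp: "compatible M r as X"
    obtain rs where rs: "rows M as ks = Some rs" "\<not> hit r (falses ks) rs rs"
      using 1 by (cases "rows M as ks") auto
    let ?f = "\<lambda>i. map (\<lambda>k. M k ! i) ks"
    let ?I = "{i \<in> X. as ! i = Free}"
    have unhit: "\<forall>k\<in>set ks. unhit as (M k)" and eq: "rs = map ?f (rev (frees as))"
      using rows_SomeD[OF rs(1)] by auto
    have "finite X" using comp finite_subset[of X "{..<length as}"] by (auto simp: compatible_def)
    have "hit r (falses ks) rs rs"
    proof (rule hit_complete[where R = "?f ` ?I"])
      show "?f ` ?I \<subseteq> set rs"
        using comp by (auto simp: eq frees_def compatible_def)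
      show "card (?f ` ?I) \<le> r"
        using card_image_le[of ?I ?f] \<open>finite X\<close> comp by (simp add: compatible_def)
      show "\<forall>j<length (falses ks). falses ks ! j \<or> (\<exists>v\<in>?f ` ?I. v ! j)"
      proof (intro allI impI disjI2)
        fix j assume j: "j < length (falses ks)"
        then have "unhit as (M (ks ! j))" using unhit by (simp add: length_falses)
        then obtain i where "i \<in> X" "as ! i = Free" "M (ks ! j) ! i" using free_hit[OF comp] by blast
        then show "\<exists>v\<in>?f ` ?I. v ! j" using j by (intro bexI[of _ "?f i"]) (auto simp: length_falses)
      qed
    qed (use \<open>finite X\<close> in \<open>auto simp: eq length_falses\<close>)
    then show False using rs(2) by simp
  qed
next
  case (3 M r as k ts)
  show ?case
  proof
    assume comp: "compatible M (Suc r) as X"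
    have unhit: "unhit as (M k)" and ch: "checks M r (kids [] as (M k)) ts" using 3(2) by auto
    let ?Q = "\<lambda>i. i \<in> X \<and> as ! i = Free \<and> M k ! i"
    obtain i0 where "?Q i0" using free_hit[OF comp unhit] by blast
    define i where "i = (LEAST i. ?Q i)"
    have i: "?Q i" unfolding i_def using \<open>?Q i0\<close> by (rule LeastI)
    have least: "\<not> ?Q j" if "j < i" for j using not_less_Least[of j ?Q] that unfolding i_def by blast
    have ilt: "i < length as" using comp i by (auto simp: compatible_def)
    let ?c = "child as (M k) i"
    have mem: "?c \<in> set (kids [] as (M k))"
      using child_in_kids[OF ilt, of "M k" "[]"] i unhit_nth(1)[OF unhit] by simp
    have nth: "?c ! j = (if j = i then Chosen else if j < i \<and> as ! j = Free \<and> M k ! j then Out else as ! j)"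
      if "j < length as" for j using that by (simp add: child_def)
    have X: "X \<subseteq> {..<length as}" "\<And>j. j \<in> X \<Longrightarrow> as ! j \<noteq> Out" using comp by (auto simp: compatible_def)
    have "{j \<in> X. ?c ! j = Free} \<subseteq> {j \<in> X. as ! j = Free} - {i}"
      using X(1) nth by (auto split: if_splits)
    moreover have fin: "finite {j \<in> X. as ! j = Free}"
      using X(1) finite_subset[of X "{..<length as}"] by auto
    ultimately have "card {j \<in> X. ?c ! j = Free} \<le> card ({j \<in> X. as ! j = Free} - {i})"
      by (intro card_mono) auto
    also have "\<dots> \<le> r"
    proof -
      have "card {j \<in> X. as ! j = Free} \<le> Suc r" using comp by (simp add: compatible_def)
      then show ?thesis using i fin by (simp add: card_Diff_singleton)
    qed
    finally have "card {j \<in> X. ?c ! j = Free} \<le> r" .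
    moreover have "?c ! j \<noteq> Out" if "j \<in> X" for j
      using that X(1) X(2)[OF that] nth[of j] least[of j] by (auto split: if_splits)
    moreover have "?c \<noteq> []" "length ?c = length as" using ilt by (auto simp: child_def)
    ultimately have "compatible M r ?c X"
      using comp by (simp add: compatible_def)
    then show False using 3(1)[OF ch mem] by blast
  qed
qed auto

lemma refutes_append: "refutes M d r (xs @ ys) \<longleftrightarrow> refutes M d r xs \<and> refutes M d r ys"
  by (induction xs) auto

lemma refutes_mem:
  "refutes M d r xs \<Longrightarrow> (a, m, t) \<in> set xs \<Longrightarrow> check M r (statuses d a m) t"
  by (induction xs) auto

lemma clause_cases: "clause xs k = [] \<or> clause xs k \<in> set xs"
  by (auto simp: clause_def)

section \<open>Tables as functionals on coefficient arrays\<close>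

definition entry :: "int list \<Rightarrow> nat \<Rightarrow> nat \<Rightarrow> int" where
  "entry t i j = (adj ^^ (length t - Suc (i + j))) t ! i"

lemma length_funpow_adj: "length ((adj ^^ n) t) = length t - n"
  by (induction n) (auto simp: length_adj)

lemma adj_nth: "Suc i < length t \<Longrightarrow> adj t ! i = t ! i + t ! Suc i"
  by (induction t arbitrary: i rule: adj.induct) (auto simp: nth_Cons split: nat.splits)

lemma entry_harmonic:
  assumes "Suc (i + j) < length t"
  shows "entry t i j = entry t (Suc i) j + entry t i (Suc j)"
proof -
  define n where "n = length t - Suc (Suc (i + j))"
  have "length t - Suc (i + j) = Suc n" using assms by (simp add: n_def)
  then show ?thesis
    using assms by (simp add: entry_def n_def[symmetric] adj_nth length_funpow_adj)
qed

lemma layers_eq: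
  "length t = Suc d \<Longrightarrow> layers t = map (\<lambda>k. (adj ^^ (d - k)) t) [0..<Suc d]"
proof (induction d arbitrary: t)
  case 0
  then obtain x where "t = [x]" by (cases t) auto
  then show ?case by simp
next
  case (Suc d)
  then obtain x r where t: "t = x # r" by (cases t) auto
  have "layers (adj t) = map (\<lambda>k. (adj ^^ (d - k)) (adj t)) [0..<Suc d]"
    using Suc.prems by (intro Suc.IH) (simp add: length_adj)
  also have "\<dots> = map (\<lambda>k. (adj ^^ (Suc d - k)) t) [0..<Suc d]"
    by (intro map_cong refl) (auto simp: Suc_diff_le funpow_swap1)
  finally show ?case unfolding t by simp
qed

lemma mask_eq:
  assumes "length t = Suc d"
  shows "mask t = map (\<lambda>(i, j). 0 < entry t i j) (positions d)"
proof -
  have "tl (layers t) = map (\<lambda>k. (adj ^^ (d - k)) t) [1..<Suc d]"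
    using layers_eq[OF assms] by (simp add: upt_conv_Cons del: upt_Suc)
  moreover have "map (\<lambda>x. 0 < x) ((adj ^^ (d - k)) t) =
      map (\<lambda>(i, j). 0 < entry t i j) (map (\<lambda>i. (i, k - i)) [0..<Suc k])" if "k \<le> d" for k
    by (rule nth_equalityI) (use that assms in \<open>auto simp: length_funpow_adj entry_def simp del: upt_Suc\<close>)
  ultimately show ?thesis
    unfolding mask_def positions_def map_concat
    by (auto intro!: arg_cong[of _ _ concat] simp del: upt_Suc)
qed

lemma set_positions: "set (positions d) = {(i, j). 0 < i + j \<and> i + j \<le> d}"
proof (intro set_eqI iffI)
  fix x assume "x \<in> {(i, j). 0 < i + j \<and> i + j \<le> d}"
  then obtain i j where "x = (i, j)" "0 < i + j" "i + j \<le> d" by auto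
  then show "x \<in> set (positions d)"
    by (auto simp: positions_def simp del: upt_Suc intro!: bexI[of _ "i + j"] image_eqI[of _ _ i])
qed (auto simp: positions_def simp del: upt_Suc)

lemma distinct_positions: "distinct (positions d)"
proof -
  have "distinct (concat (map (\<lambda>k. map (\<lambda>i. (i, k - i)) [0..<Suc k]) ks))" if "distinct ks" for ks :: "nat list"
    using that by (induction ks) (auto simp: distinct_map inj_on_def eq_diff_iff less_Suc_eq_le simp del: upt_Suc)
  then show ?thesis unfolding positions_def by simp
qed

context line_coeffs
begin

text \<open>If L were nonpositive on the support, all summands c i j L(i,j) would be too, and
  comparing their sum L(0,0) with the summand of y^d gives L(0,0) \<le> L(0,d) \<le> 0. Either
  alternative in \<open>valid\<close> contradicts this.\<close>

lemma valid_clause: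
  assumes "valid d t" "c 0 0 = 0" "c 0 d = 1"
  shows "\<exists>n<length (positions d). (case positions d ! n of (i, j) \<Rightarrow> c i j \<noteq> 0) \<and> mask t ! n"
proof (rule ccontr)
  assume H: "\<not> ?thesis"
  have len: "length t = Suc d" using assms(1) by (simp add: valid_def)
  have nonpos: "entry t i j \<le> 0" if "c i j \<noteq> 0" for i j
  proof -
    have "(i, j) \<in> set (positions d)"
      using that assms(2) support_degree[OF that] unfolding set_positions by (cases "i + j") auto
    then obtain n where n: "n < length (positions d)" "positions d ! n = (i, j)"
      by (auto simp: in_set_conv_nth)
    then have "\<not> mask t ! n" using H that by auto
    then show ?thesis using n by (simp add: mask_eq[OF len])
  qed
  let ?S = "\<lambda>k. \<Sum>i\<le>k. c i (k - i) * real_of_int (entry t i (k - i))"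
  have le: "c i j * real_of_int (entry t i j) \<le> 0" for i j
    using nonpos[of i j] nonneg[of i j] by (cases "c i j = 0") (auto simp: mult_le_0_iff)
  have "(\<Sum>k\<le>d. ?S k) = real_of_int (entry t 0 0) - (\<Sum>i\<le>d. quot c i (d - i) * real_of_int (entry t i (d - i)))"
    by (rule harmonic_sum) (use len entry_harmonic in auto)
  then have total: "(\<Sum>k\<le>d. ?S k) = real_of_int (entry t 0 0)" using line by simp
  \<comment> \<open>All terms but the one of y^d are dropped as nonpositive; keeping it settles
    tables with L(0,0) = 0.\<close>
  have "(\<Sum>k\<le>d. ?S k) \<le> (\<Sum>k\<le>d. if k = d then real_of_int (entry t 0 d) else 0)"
  proof (rule sum_mono)
    fix k
    have "?S k \<le> c 0 k * real_of_int (entry t 0 k)"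
      using sum_mono[of "{..k} - {0}" "\<lambda>i. c i (k - i) * real_of_int (entry t i (k - i))" "\<lambda>_. 0"] le
      by (subst sum.remove[of _ 0]) auto
    then show "?S k \<le> (if k = d then real_of_int (entry t 0 d) else 0)"
      using le[of 0 k] assms(3) by auto
  qed
  then have "entry t 0 0 \<le> entry t 0 d" using total by simp
  moreover have "hd (hd (layers t)) = entry t 0 0"
  proof -
    have "(adj ^^ d) t \<noteq> []" using len length_funpow_adj[of d t] by auto
    then show ?thesis
      using len layers_eq[OF len] by (simp add: entry_def hd_conv_nth upt_conv_Cons del: upt_Suc)
  qed
  moreover have "hd t = entry t 0 d" using len by (cases t) (auto simp: entry_def)
  moreover have "entry t 0 d \<le> 0" using nonpos[of 0 d] assms(3) by simp
  ultimately show False using assms(1) by (auto simp: valid_def)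
qed

text \<open>The indices of the support form a compatible set: its three corners are the chosen
  positions, so at most r free positions are used, and every valid table provides a clause that the
  support meets.\<close>

lemma frame_refuted:
  assumes "frame c d a m" "even d" and N: "card {(i, j). c i j \<noteq> 0} \<le> r + 3"
    and "list_all (valid d) ts" "check (clause (map mask ts)) r (statuses d a m) t"
  shows False
proof -
  have m: "odd m" "m \<le> a" "a \<le> d" and c: "c a 0 = 1" "c 0 d = 1" "c (d - m) m \<noteq> 0"
    and supp: "\<And>i j. c i j \<noteq> 0 \<Longrightarrow> (i, j) \<in> {(a, 0), (d - m, m), (0, d)} \<or>
      0 < i \<and> 0 < j \<and> i + j < d \<and> (i + j \<le> a \<or> m < j)"
    using assms(1) unfolding frame_def by blast+
  have "0 < m" "m < d" using m assms(2) by (auto intro: Nat.gr0I simp: le_less)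
  have c00: "c 0 0 = 0"
  proof (rule ccontr)
    assume "c 0 0 \<noteq> 0"
    from supp[OF this] show False using m \<open>0 < m\<close> \<open>m < d\<close> by auto
  qed
  let ?P = "positions d" and ?as = "statuses d a m"
  let ?X = "{n. n < length ?P \<and> (case ?P ! n of (i, j) \<Rightarrow> c i j \<noteq> 0)}"
  have nth: "?as ! n = status_of d a m (?P ! n)" if "n < length ?P" for n
    using that by (simp add: statuses_def)
  have len: "length ?as = length ?P" by (simp add: statuses_def)
  let ?T = "{(a, 0), (d - m, m), (0, d)}"
  have "?T \<subseteq> {(i, j). c i j \<noteq> 0}" using c by auto
  moreover have "card ?T = 3" using m \<open>0 < m\<close> \<open>m < d\<close> by (auto simp: card_insert_if)
  ultimately have "card ({(i, j). c i j \<noteq> 0} - ?T) \<le> r"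
    using N card_Diff_subset[of ?T "{(i, j). c i j \<noteq> 0}"] by simp
  moreover have "card {n \<in> ?X. ?as ! n = Free} \<le> card ({(i, j). c i j \<noteq> 0} - ?T)"
  proof (rule card_inj_on_le)
    show "inj_on ((!) ?P) {n \<in> ?X. ?as ! n = Free}"
      by (auto simp: inj_on_def nth_eq_iff_index_eq[OF distinct_positions])
    show "(!) ?P ` {n \<in> ?X. ?as ! n = Free} \<subseteq> {(i, j). c i j \<noteq> 0} - ?T"
      using nth by (fastforce simp: status_of_def split: if_splits)
    show "finite ({(i, j). c i j \<noteq> 0} - ?T)" using finite_support by simp
  qed
  ultimately have card: "card {n \<in> ?X. ?as ! n = Free} \<le> r" by simp
  have "(a, 0) \<in> set ?P" using m \<open>0 < m\<close> by (simp add: set_positions)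
  then have "?as \<noteq> []" using len by auto
  moreover have "\<forall>n\<in>?X. ?as ! n \<noteq> Out"
    using nth supp by (fastforce simp: status_of_def split: if_splits)
  moreover have "clause (map mask ts) k = [] \<or>
      (\<exists>n\<in>?X. n < length (clause (map mask ts) k) \<and> clause (map mask ts) k ! n)" for k
  proof (cases "clause (map mask ts) k = []")
    case False
    then obtain s where s: "s \<in> set ts" "clause (map mask ts) k = mask s"
      using clause_cases[of "map mask ts" k] by auto
    then have "valid d s" using assms(4) by (simp add: list_all_iff)
    then have "length (mask s) = length ?P" by (simp add: mask_eq[of s d] valid_def)
    then show ?thesis using valid_clause[OF \<open>valid d s\<close> c00 c(2)] s(2) by auto
  qed simp
  ultimately have "compatible (clause (map mask ts)) r ?as ?X"
    using card len unfolding compatible_def by auto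
  then show False using check_sound(1)[OF assms(5)] by blast
qed

end

text \<open>The pairs that need a tree. For a = d, swapping the variables exchanges m and d - m, so
  the smaller half of the values is enough.\<close>

definition keys :: "nat \<Rightarrow> (nat \<times> nat) list" where
  "keys d = filter (\<lambda>(a, m). odd m \<and> m < a \<and> (a = d \<longrightarrow> 2 * m \<le> d)) (List.product [0..<Suc d] [0..<Suc d])"

text \<open>For a = d the strip condition is void, and the remaining conditions are symmetric once
  x^(d-m) y^m is replaced by its mirror image.\<close>

lemma frame_flip:
  assumes "frame c d d m" "even d"
  shows "frame (\<lambda>i j. c j i) d d (d - m)"
proof -
  have m: "odd m" "m \<le> d" and c: "c d 0 = 1" "c 0 d = 1" "c (d - m) m \<noteq> 0"
    and supp: "\<And>i j. c i j \<noteq> 0 \<Longrightarrow> (i, j) \<in> {(d, 0), (d - m, m), (0, d)} \<or>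
      0 < i \<and> 0 < j \<and> i + j < d \<and> (i + j \<le> d \<or> m < j)"
    using assms(1) unfolding frame_def by blast+
  have "(i, j) \<in> {(d, 0), (d - (d - m), d - m), (0, d)} \<or>
      0 < i \<and> 0 < j \<and> i + j < d \<and> (i + j \<le> d \<or> d - m < j)" if "c j i \<noteq> 0" for i j
    using supp[OF that] m(2) by auto
  moreover have "odd (d - m)" using m assms(2) by simp
  ultimately show ?thesis using m c unfolding frame_def by simp
qed

lemma (in line_coeffs) frame_eq_if_refutes:
  assumes "frame c d a m" "even d" "card {(i, j). c i j \<noteq> 0} \<le> r + 3"
    and "list_all (valid d) ts" "refutes (clause (map mask ts)) d r xs"
    and "set (keys d) \<subseteq> set (map (\<lambda>x. (fst x, fst (snd x))) xs)"
  shows "m = a"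
proof (rule ccontr)
  assume "m \<noteq> a"
  have m: "odd m" "m < a" "a \<le> d" using assms(1) \<open>m \<noteq> a\<close> by (auto simp: frame_def)
  have tree: "\<exists>t. (a', m', t) \<in> set xs" if "odd m'" "m' < a'" "a' \<le> d" "a' = d \<longrightarrow> 2 * m' \<le> d" for a' m'
  proof -
    have "(a', m') \<in> set (keys d)" using that by (auto simp: keys_def)
    then have "(a', m') \<in> (\<lambda>x. (fst x, fst (snd x))) ` set xs" using assms(6) by auto
    then obtain x where "x \<in> set xs" "a' = fst x" "m' = fst (snd x)" by blast
    then show ?thesis by (intro exI[of _ "snd (snd x)"]) simp
  qed
  show False
  proof (cases "a = d \<longrightarrow> 2 * m \<le> d")
    case True
    then obtain t where "(a, m, t) \<in> set xs" using tree m by blast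
    then show False using frame_refuted[OF assms(1-4)] refutes_mem[OF assms(5)] by blast
  next
    case False
    then have "frame (\<lambda>i j. c j i) d d (d - m)" using assms(1,2) frame_flip by blast
    moreover have "2 * (d - m) \<le> d" "odd (d - m)" "d - m < d"
      using m False assms(2) odd_pos[OF m(1)] by auto
    then obtain t where "(d, d - m, t) \<in> set xs" using tree by blast
    moreover interpret F: line_coeffs "\<lambda>i j. c j i" d by (rule flip)
    have "card {(i, j). c j i \<noteq> 0} \<le> r + 3" using assms(3) by (simp add: card_support_flip)
    ultimately show False
      using F.frame_refuted[OF _ assms(2) _ assms(4)] refutes_mem[OF assms(5)] by blast
  qed
qed

section \<open>The refutations for degrees 4 to 12\<close>

text \<open>For example, [0,-1,1,0,-1] lists L(0,4), ..., L(4,0); repeated sums of neighbours lead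
  to L(0,0) = 1.\<close>

definition tops_4 :: "int list list" where
  "tops_4 = [[0,2,-1,0,0], [0,-1,1,0,-1]]"

definition clause_4 :: "int \<Rightarrow> bool list" where
  "clause_4 = clause (map mask tops_4)"

schematic_goal masks_4: "map mask tops_4 = ?T"
  by code_simp

text \<open>One equation per clause number, so that a mask is found by rewriting at its numeral
  instead of indexing into a list.\<close>

lemmas clauses_4 =
  tab_clause[of "map mask tops_4", folded clause_4_def, unfolded masks_4 tab.simps Num.inc.simps]

lemma valid_4: "list_all (valid 4) tops_4"
  by code_simp

schematic_goal statuses_4:
  "statuses 4 2 1 = ?s0 \<and> statuses 4 3 1 = ?s1 \<and> statuses 4 4 1 = ?s2"
  by (intro conjI) code_simp+

definition trees_4 :: "(nat \<times> nat \<times> tree) list" where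
  "trees_4 = [
  (2,1, L [2,3]), (3,1, L [2,3]), (4,1, L [2,3])]"

text \<open>The budget is d / 2 - 1: at most (d + 4) / 2 monomials, less the three corners. It is
  written with \<open>Suc\<close> because \<open>check\<close> and \<open>hit\<close> match on
  it.\<close>

lemma refutes_4: "refutes clause_4 4 (Suc 0) trees_4"
  unfolding trees_4_def by (simp only: check_rules clauses_4 statuses_4)

lemma keys_4: "set (keys 4) \<subseteq> set (map (\<lambda>x. (fst x, fst (snd x))) (trees_4))"
  unfolding trees_4_def list.map append.simps fst_conv snd_conv by code_simp

definition tops_6 :: "int list list" where
  "tops_6 = [[0,3,-1,0,0,0,0], [0,-1,1,-1,1,0,-3], [0,6,-6,5,-3,0,0], [0,0,0,0,-1,4,-7], [0,-2,1,0,0,0,0],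
  [0,0,0,0,1,-3,5], [0,-1,1,0,-2,5,-8], [0,1,0,-1,1,0,0], [0,0,0,0,-1,3,0]]"

definition clause_6 :: "int \<Rightarrow> bool list" where
  "clause_6 = clause (map mask tops_6)"

schematic_goal masks_6: "map mask tops_6 = ?T"
  by code_simp

lemmas clauses_6 =
  tab_clause[of "map mask tops_6", folded clause_6_def, unfolded masks_6 tab.simps Num.inc.simps]

lemma valid_6: "list_all (valid 6) tops_6"
  by code_simp

schematic_goal statuses_6:
  "statuses 6 2 1 = ?s0 \<and> statuses 6 3 1 = ?s1 \<and> statuses 6 4 1 = ?s2 \<and>
    statuses 6 5 1 = ?s3 \<and> statuses 6 6 1 = ?s4 \<and> statuses 6 4 3 = ?s5 \<and>
    statuses 6 5 3 = ?s6 \<and> statuses 6 6 3 = ?s7"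
  by (intro conjI) code_simp+

definition trees_6 :: "(nat \<times> nat \<times> tree) list" where
  "trees_6 = [
  (2,1, L [3,2,4]), (3,1, L [2,4,3]), (4,1, L [2,4,3]), (5,1, L [2,4,3]), (6,1, L [2,
  4,3]), (4,3, L [2,5,7]), (5,3, L [2,5,6,9,8]), (6,3, L [2,5,6,10])]"

lemma refutes_6: "refutes clause_6 6 (Suc (Suc 0)) trees_6"
  unfolding trees_6_def by (simp only: check_rules clauses_6 statuses_6)

lemma keys_6: "set (keys 6) \<subseteq> set (map (\<lambda>x. (fst x, fst (snd x))) (trees_6))"
  unfolding trees_6_def list.map append.simps fst_conv snd_conv by code_simp

definition tops_8 :: "int list list" where
  "tops_8 = [[0,9,-6,3,-1,0,0,0,0], [0,0,0,0,0,0,-1,6,-18], [0,4,-1,0,0,0,0,0,0], [0,-1,1,-1,1,-1,1,0,-5],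
  [0,-3,3,-1,0,0,0,0,0], [0,9,-9,9,-9,8,-5,0,0], [0,10,-10,10,-10,9,-6,0,9],
  [0,4,0,-2,2,-1,0,0,0], [0,-11,5,1,-1,0,0,0,0], [0,-1,1,-1,1,0,-2,4,-6], [0,5,-5,2,2,-5,5,0,-5],
  [0,-5,5,-4,3,-2,1,0,0], [0,2,-2,0,3,-6,8,-8,8], [0,5,-5,4,-2,0,1,-1,0], [0,5,-5,2,0,0,0,0,0],
  [-7,0,0,-1,1,0,0,-1,1], [0,6,-6,5,-3,0,4,-9,15], [0,4,-3,2,-1,0,1,-2,3], [0,2,-1,0,1,-2,3,-4,5],
  [0,1,-1,0,2,-3,3,-4,8], [0,9,-9,6,0,-5,5,0,-5], [0,2,-1,0,1,-2,3,-4,4], [0,6,-6,5,-3,0,4,-9,14],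
  [0,4,-3,2,-1,0,1,-2,0], [0,5,-5,4,-2,0,2,-4,4], [0,-20,20,-14,8,-3,0,0,0],
  [0,-1,0,0,1,-2,3,-4,4]]"

definition clause_8 :: "int \<Rightarrow> bool list" where
  "clause_8 = clause (map mask tops_8)"

schematic_goal masks_8: "map mask tops_8 = ?T"
  by code_simp

lemmas clauses_8 =
  tab_clause[of "map mask tops_8", folded clause_8_def, unfolded masks_8 tab.simps Num.inc.simps]

lemma valid_8: "list_all (valid 8) tops_8"
  by code_simp

schematic_goal statuses_8:
  "statuses 8 2 1 = ?s0 \<and> statuses 8 3 1 = ?s1 \<and> statuses 8 4 1 = ?s2 \<and>
    statuses 8 5 1 = ?s3 \<and> statuses 8 6 1 = ?s4 \<and> statuses 8 7 1 = ?s5 \<and>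
    statuses 8 8 1 = ?s6 \<and> statuses 8 4 3 = ?s7 \<and> statuses 8 5 3 = ?s8 \<and>
    statuses 8 6 3 = ?s9 \<and> statuses 8 7 3 = ?s10 \<and> statuses 8 8 3 = ?s11 \<and>
    statuses 8 6 5 = ?s12 \<and> statuses 8 7 5 = ?s13"
  by (intro conjI) code_simp+

text \<open>In degrees 4 and 6 a single leaf suffices for each pair; here the trees begin to
  branch.\<close>

definition trees_8 :: "(nat \<times> nat \<times> tree) list" where
  "trees_8 = [
  (2,1, B 5 [L [4,7,22]]), (3,1, B 5 [L [4,8,2,6], L [4,8,21]]), (4,1, B 4 [L [2,5,8],
  L [2,5,8], L [5,8,6]]), (5,1, B 4 [L [2,8,5], L [2,8,10], L [8,6,5]]), (6,1, B 4
  [L [2,7,5,14,9], L [2,7,10], L [6,7,12,5,27]]), (7,1, B 4 [L [2,7,5,14,9], L [2,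
  7,10], L [6,7,12,13]]), (8,1, B 4 [L [2,7,5,15,9], L [2,7,10], L [6,7,12,13]]),
  (4,3, B 2 [L [3,15,11,18], L [9,3,10]]), (5,3, B 2 [L [18,3,11], L [4,3,11]]), (6,3,
  B 19 [L [3,6,11,24], L [4,3,11]]), (7,3, B 4 [L [2,3,15,9,26], L [2,3,10], L [6,3,
  16,12,13]]), (8,3, B 4 [L [2,3,15,9,16,25], L [2,3,10], L [6,3,16,12,13]]), (6,5,
  B 20 [L [3,6,11,17,14]]), (7,5, B 4 [L [9,3,14,28], L [3,11,23,17], L [6,3,17,14,
  13]])]"

lemma refutes_8: "refutes clause_8 8 (Suc (Suc (Suc 0))) trees_8"
  unfolding trees_8_def by (simp only: check_rules clauses_8 statuses_8)

lemma keys_8: "set (keys 8) \<subseteq> set (map (\<lambda>x. (fst x, fst (snd x))) (trees_8))"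
  unfolding trees_8_def list.map append.simps fst_conv snd_conv by code_simp

definition tops_10 :: "int list list" where
  "tops_10 = [[0,-7,7,-2,0,0,0,0,0,0,0], [0,0,0,0,0,0,0,0,-1,6,-11], [0,5,-1,0,0,0,0,0,0,0,0],
  [0,-14,14,-14,14,-14,14,-15,15,0,-30], [0,19,-10,4,-1,0,0,0,0,0,0], [0,0,0,0,0,-1,3,-3,0,0,0],
  [0,14,-9,4,-1,0,0,0,0,0,0], [0,-3,1,0,0,0,0,0,0,0,0], [0,0,0,0,0,0,0,2,-5,0,0],
  [0,-9,5,-1,0,0,0,0,0,0,0], [0,3,-3,1,0,0,0,0,0,0,0], [-3,0,0,0,0,0,0,0,-1,7,-22],
  [0,-1,0,0,0,1,-1,0,0,0,0], [0,20,-15,10,-5,0,4,-6,6,-6,6], [-4,6,-5,4,-3,2,-1,0,1,-2,0],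
  [-5,0,0,0,0,0,0,0,-1,5,0], [0,35,-35,35,-35,34,-31,25,-15,0,0],
  [0,15,-15,15,-15,15,-15,14,-10,0,20], [0,9,-9,9,-9,8,-5,0,5,-5,-9], [0,5,-5,0,0,0,0,6,-12,0,0],
  [0,2,-1,0,1,-2,3,-4,5,-6,6], [0,245,-245,245,-245,179,-65,0,0,0,0],
  [0,-1,1,-1,1,-1,1,-1,1,0,-7], [0,-56,28,0,0,0,-3,0,0,0,0], [0,0,0,0,1,-2,2,-1,0,0,0],
  [0,15,-15,15,-15,15,-15,14,-10,0,19], [-4,4,-3,2,-1,0,1,-2,3,-4,4],
  [0,-10,10,-6,3,-1,0,0,0,0,0], [0,-3,3,-4,4,-3,2,-1,0,0,0], [0,39,-39,30,-16,0,16,-31,45,-59,59],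
  [0,-20,20,-20,20,-20,20,-21,21,0,-80], [0,26,-26,23,-18,12,-6,0,6,-12,18],
  [0,0,0,-12,9,0,0,0,-7,0,0], [0,0,0,0,0,0,0,0,1,-7,27], [0,-29,9,1,-1,0,0,0,0,0,0],
  [0,0,0,0,0,0,0,-2,7,-7,0], [0,0,0,0,0,0,-1,4,-9,14,0], [0,5,-4,3,-2,1,0,-1,2,-3,4],
  [0,8,-5,2,0,-1,1,0,-2,5,-9], [0,13,0,-5,5,-3,1,0,0,-1,1], [-1,-1,1,0,-2,5,-9,14,-20,27,-34],
  [0,21,-21,21,-21,21,-21,20,-15,0,25], [0,30,-30,25,-17,8,0,-5,5,0,-5],
  [0,0,0,0,0,0,0,-1,5,-12,19], [0,32,10,-31,31,-20,8,0,-4,4,-4], [0,-10,8,-8,8,-6,3,0,-2,2,-2],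
  [0,6,-6,5,-3,0,4,-9,15,-22,30], [0,7,-7,4,-1,0,0,0,0,0,0], [0,0,0,0,0,0,0,0,-1,8,-33],
  [0,4,0,-2,2,-1,0,0,2,-7,15], [0,14,-14,9,-4,1,0,0,0,0,0], [0,0,0,0,0,0,0,0,1,-6,20],
  [0,40,0,0,-40,0,99,-95,0,0,0], [0,70,-70,55,-35,17,-5,0,0,0,0],
  [0,12,-12,12,-12,12,-12,11,-7,0,0], [0,-1,1,-1,1,-1,1,0,-4,13,-29],
  [0,0,1,-2,3,-4,5,-6,6,0,-26], [0,0,0,0,0,0,-1,4,-4,-21,121], [0,12,-14,15,-15,14,-12,9,-5,0,5],
  [0,0,0,-1,2,-2,1,0,0,0,0], [0,-111,111,-85,59,-36,18,-6,0,0,0], [0,-2,2,-2,2,-2,2,0,-9,33,-83],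
  [0,7,-4,1,0,0,0,0,0,0,0], [0,-1,1,-1,1,0,-4,14,-34,69,-124], [0,3,-3,0,3,-4,4,-4,4,-4,4],
  [0,14,-14,10,-10,10,-5,0,0,0,0], [0,5,-1,0,0,0,0,0,0,0,1], [0,-5,5,-5,5,-5,5,-3,0,0,0],
  [0,2,-2,1,0,0,-2,7,-16,30,-49], [0,-14,14,-9,3,0,0,0,0,0,0], [0,5,-5,6,-7,7,-5,0,9,-23,42],
  [0,0,0,0,0,0,0,-1,5,-9,0], [0,0,0,-1,1,0,0,0,0,-28,204], [-4,10,-10,10,-10,9,-6,0,10,-25,46],
  [0,0,0,0,0,0,0,-2,11,-32,70], [0,-16,0,4,-2,0,0,2,-3,0,0], [0,24,-24,19,-14,8,0,-8,11,-4,-3],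
  [0,-4,4,-4,4,-4,3,0,-6,16,0], [-5,2,-2,2,-2,3,-5,7,-7,0,24],
  [0,24,-24,24,-24,24,-25,28,-28,0,115], [0,8,-8,8,-8,6,0,-11,27,-48,74],
  [0,1,-1,1,-1,1,-1,0,5,-19,49], [0,9,-9,6,0,-5,5,0,-4,-5,45], [0,4,-4,4,-4,3,0,0,-20,77,-77],
  [0,0,0,0,0,-2,9,-24,47,-70,93], [0,-9,9,-9,9,-6,0,5,-5,5,-5], [0,-14,14,-9,4,0,-3,5,-6,6,-6],
  [0,8,-8,6,-3,0,2,-2,-1,7,0], [0,0,0,0,0,0,1,-2,2,-2,0], [0,-11,11,-8,4,0,-4,8,-12,16,0],
  [0,-17,17,-11,0,15,-33,53,-74,95,-95], [0,-12,9,-6,3,0,0,-2,4,-6,8], [0,2,5,-8,8,-6,3,0,-2,2,0],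
  [0,1,-1,1,-1,0,1,-2,13,-44,75]]"

definition clause_10 :: "int \<Rightarrow> bool list" where
  "clause_10 = clause (map mask tops_10)"

schematic_goal masks_10: "map mask tops_10 = ?T"
  by code_simp

lemmas clauses_10 =
  tab_clause[of "map mask tops_10", folded clause_10_def, unfolded masks_10 tab.simps Num.inc.simps]

lemma valid_10: "list_all (valid 10) tops_10"
  by code_simp

schematic_goal statuses_10:
  "statuses 10 2 1 = ?s0 \<and> statuses 10 3 1 = ?s1 \<and> statuses 10 4 1 = ?s2 \<and>
    statuses 10 5 1 = ?s3 \<and> statuses 10 6 1 = ?s4 \<and> statuses 10 7 1 = ?s5 \<and>
    statuses 10 8 1 = ?s6 \<and> statuses 10 9 1 = ?s7 \<and> statuses 10 10 1 = ?s8
    \<and> statuses 10 4 3 = ?s9 \<and> statuses 10 5 3 = ?s10 \<and> statuses 10 6 3 =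
    ?s11 \<and> statuses 10 7 3 = ?s12 \<and> statuses 10 8 3 = ?s13 \<and> statuses 10 9
    3 = ?s14 \<and> statuses 10 10 3 = ?s15 \<and> statuses 10 6 5 = ?s16 \<and> statuses
    10 7 5 = ?s17 \<and> statuses 10 8 5 = ?s18 \<and> statuses 10 9 5 = ?s19 \<and>
    statuses 10 10 5 = ?s20 \<and> statuses 10 8 7 = ?s21 \<and> statuses 10 9 7 = ?s22"
  by (intro conjI) code_simp+

definition trees_10 :: "(nat \<times> nat \<times> tree) list" where
  "trees_10 = [
  (2,1, B 24 [B 28 [L [56,44,29,20,74], L [68,56,74,20], L [68,8,56], L [68,8,15]]]),
  (3,1, B 24 [B 28 [L [19,44,29,20,80], L [4,19,20,80,41], L [4,8,56], L [58,4,8]],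
  B 16 [L [19,44,14,29], L [4,19,14], L [4,8,35], L [4,8,59]]]), (4,1, B 24 [B 16
  [L [19,2,20,55,81], L [4,19,20,81], L [4,8,56], L [58,4,8]], B 16 [L [19,2,20,59],
  L [4,19,14], L [4,8,35], L [4,8,59]], B 16 [L [19,2,67], L [4,19,14], L [4,8,35],
  L [4,8,59]]]), (5,1, B 32 [B 16 [L [19,2,20,55,62], L [4,19,14], L [4,8,19], L [4,8,
  15]], B 16 [L [19,2,67], L [4,19,14], L [4,8,53], L [4,8,15]], B 16 [L [19,2,12],
  L [4,19,14], L [4,8,53], L [4,8,15]]]), (6,1, B 4 [B 28 [L [27,32,14], L [27,32,14],
  L [6,27,24], L [6,58,15]], B 27 [L [39,32,14], L [39,32,14], L [39,32,14], L [32,6,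
  36]], B 28 [L [27,32,11], L [27,32,11], L [8,27,24], L [8,58,15]], B 32 [L [27,2,20,
  52,29], L [27,2,67], L [27,2,12], L [27,2,12]]]), (7,1, B 4 [B 28 [L [5,33,10], L [5,
  43,14], L [6,5,10], L [6,15,24]], B 28 [L [5,33,10], L [5,43,9], L [6,5,9], L [6,15,
  9]], B 28 [L [5,33,10], L [5,43,9], L [8,5,43], L [8,15,24]], B 5 [L [2,43,20,7],
  L [2,43,12,18], L [2,43,12,18], L [2,45,12,18]]]), (8,1, B 4 [B 28 [L [33,5,10],
  L [5,60,10], L [6,5,10], L [6,15,24]], B 28 [L [33,5,10], L [5,60,10], L [6,5,9],
  L [6,15,9]], B 28 [L [33,5,10], L [5,60,10], L [8,5,10,11], L [8,15,24]], B 33 [L [5,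
  60,10], L [5,18,10,14], L [2,5,7], L [2,5,34], L [2,44,12]]]), (9,1, B 4 [B 16
  [L [18,5,10,14], L [18,5,10,14], L [6,5,10], L [6,15,24]], B 16 [L [18,5,9], L [18,
  5,9], L [6,5,9], L [6,15,9]], B 16 [L [18,5,9], L [18,5,9], L [8,5,10,11], L [8,15,
  24]], B 18 [L [2,5,7], L [2,5,7], L [2,5,12,10,52], L [2,5,7], L [2,37,34], L [2,5,
  7]]]), (10,1, B 4 [B 16 [L [18,5,10,14], L [18,5,10,14], L [6,5,10], L [6,44,10,
  24]], B 16 [L [18,5,9], L [18,5,9], L [6,5,9], L [6,44,9,10]], B 16 [L [18,5,9],
  L [18,5,9], L [8,5,10,11], L [8,44,24,26]], B 18 [L [2,5,7], L [2,5,7], L [2,5,12,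
  10,52], L [2,5,7], L [2,37,34], L [2,5,7]]]), (4,3, B 50 [B 39 [L [35,20,26], L [4,
  35,20], L [40,4,35]], B 22 [L [35,20,2], L [4,35,20], L [40,4,35]]]), (5,3, B 50 [B 16
  [L [48,63,2,72,84], L [4,20,63,51,11], L [40,4,63]], B 16 [L [53,48,2,20], L [4,
  53,20], L [40,4,53]], B 83 [L [39,63,2,4,72]]]), (6,3, B 39 [B 75 [L [13,48,57],
  L [13,33,30], L [13,57,2,34]], B 75 [L [4,13,7], L [4,13,30], L [4,13,14]], B 40
  [L [4,13,57]]]), (7,3, B 39 [B 33 [L [13,48,30], L [13,72,49,7], L [13,2,7], L [13,2,
  34]], B 4 [L [13,51,7], L [13,51,9], L [13,11,82]], B 40 [L [4,13,93]]]), (8,3, B 39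
  [B 33 [L [3,29,12,23], L [3,49,23,45,78,62], L [3,2,7], L [3,2,12]], B 4 [L [3,41,
  7,47], L [3,46,36,54], L [3,11,23,25]], B 4 [L [6,3,69], L [6,3,9], L [40,45,
  11]]]), (9,3, B 4 [B 16 [L [3,31,30,7], L [3,41,7,47], L [6,3,69], L [6,15,50]], B 16
  [L [3,36,23,55], L [3,36,46,54], L [6,3,9], L [6,15,9]], B 16 [L [3,11,23,25],
  L [3,11,23,25], L [8,3,26,11,64], L [8,15,50]], B 2 [L [3,31,12,7], L [3,31,30,
  7], L [3,29,12,23], L [3,49,23,52,85], L [3,31,14,7]]]), (10,3, B 4 [B 16 [L [17,55,
  71,12], L [17,46,23,94], L [6,17,69], L [6,17,7]], B 16 [L [17,36,23,55], L [17,36,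
  46,54], L [6,17,9], L [6,17,9]], B 16 [L [17,11,23,26], L [17,11,23,25], L [17,8,
  26], L [17,8,26]], B 17 [L [2,23,78,12,79], L [2,23,52,12,29], L [2,73,67,52,29],
  L [37,2,7]]]), (6,5, B 22 [B 48 [L [13,57,65,49,76], L [13,2,7]], B 51 [L [13,57,65,
  76,9]]]), (7,5, B 22 [B 48 [L [13,70,30,45,49], L [13,2,7]], B 4 [L [51,13,7], L [51,
  13,9], L [13,11,7,25,21,65]]]), (8,5, B 22 [B 3 [L [70,29,21,12,2], L [70,29,95],
  L [45,2,30,31,62,12], L [45,2,30,31,62,12]], B 4 [L [3,41,10,47], L [3,46,36,
  54], L [3,11,21,25]]]), (9,5, B 4 [B 22 [L [3,31,30,10], L [3,41,7,47], L [6,3,10],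
  L [6,15,50]], B 22 [L [3,36,21,31], L [3,36,46,54], L [6,3,9], L [6,15,9]], B 28
  [L [3,11,21,25], L [3,11,21,25], L [8,3,26,10,11], L [8,15,50]], B 2 [L [3,31,12,
  7], L [3,31,30,10], L [3,29,21], L [3,49,21,88], L [3,31,30,10]]]), (10,5, B 4 [B 17
  [L [6,38,47,71,79,12,77], L [6,38,47,71,40,89,77], L [6,38,73,61,90], L [37,6,
  7]], B 17 [L [6,38,9], L [6,38,9], L [6,38,9], L [37,6,9]], B 17 [L [8,38,11,64,26],
  L [8,38,11,64,26], L [8,38,11,64,26], L [37,8,11,7]], B 91 [L [17,26,34,12], L [2,
  17,12], L [2,17,12], L [2,37,7]]]), (8,7, B 22 [B 42 [L [3,11,21,25], L [3,2,7],
  L [3,2,34], L [2,45,7,86]]]), (9,7, B 4 [B 22 [L [3,66,21,42,61], L [3,41,7,47],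
  L [3,41,10,66], L [3,41,7,66]], B 3 [L [22,42,9,10], L [22,42,9,10], L [22,42,9,
  10], L [22,9,21,87], L [37,22,9,46,61]], B 22 [L [3,11,21,25], L [3,11,21,25],
  L [3,11,21,25], L [3,11,21,25]], B 3 [L [2,42,7,66,65,34], L [2,42,7,26,34,14],
  L [2,42,7,26,34,14], L [2,73,7,92,61], L [37,2,7]]])]"

lemma refutes_10: "refutes clause_10 10 (Suc (Suc (Suc (Suc 0)))) trees_10"
  unfolding trees_10_def by (simp only: check_rules clauses_10 statuses_10)

lemma keys_10: "set (keys 10) \<subseteq> set (map (\<lambda>x. (fst x, fst (snd x))) (trees_10))"
  unfolding trees_10_def list.map append.simps fst_conv snd_conv by code_simp

definition tops_12 :: "int list list" where
  "tops_12 = [[0,-9,5,-1,0,0,0,0,0,0,0,0,0], [0,-5,1,0,0,0,0,0,0,0,0,0,0], [0,0,0,0,0,0,0,0,0,-1,5,-9,0],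
  [0,28,-28,28,-28,28,-28,28,-28,27,-21,0,46], [0,0,0,0,0,0,0,0,0,0,-1,7,-13],
  [0,8,-8,8,-8,5,-2,2,-2,0,0,0,0], [-4,-7,7,-7,7,-7,7,-7,7,-7,6,0,0],
  [0,-6,6,-6,6,-6,6,-6,5,0,-15,49,-83], [0,-35,11,1,-1,0,0,0,0,0,0,0,0],
  [0,7,-7,4,-1,0,0,0,0,0,0,0,0], [0,0,0,0,0,0,0,0,0,0,1,-5,0],
  [0,80,-80,80,-80,79,-76,70,-60,45,-25,0,0], [0,74,-35,11,-2,0,0,0,0,0,0,0,0],
  [0,0,0,-5,4,-1,0,0,0,0,0,0,0], [0,6,-1,0,0,0,0,0,0,0,0,0,0], [0,0,0,-13,0,0,0,0,0,72,-180,0,0],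
  [0,-8,8,-8,8,-8,8,-8,8,-8,7,0,-13], [-22,33,-14,4,0,-1,1,-1,1,-1,1,-1,1],
  [0,37,-14,0,5,-5,3,-1,0,0,0,0,0], [0,-5,5,-5,5,-5,5,-5,4,0,-4,0,0],
  [-2,15,-10,5,-1,-2,4,-5,5,-4,2,0,-2], [0,14,-9,4,0,-3,5,-6,6,-5,3,0,-4],
  [-4,20,-20,20,-20,20,-20,20,-20,19,-14,0,28], [0,4,-3,2,-1,0,1,-2,3,-4,5,-6,6],
  [0,18,-18,18,-18,18,-18,18,-18,17,-12,0,12], [0,35,0,-7,4,-1,0,0,0,0,0,0,0],
  [0,40,-7,-3,3,-1,0,0,0,0,0,0,0], [0,-46,46,-21,6,-1,0,0,0,0,0,0,0],
  [-4,0,0,0,0,0,0,0,0,-1,6,-15,8], [0,0,0,0,0,0,0,0,0,0,1,-7,22],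
  [0,7,-9,10,-10,9,-7,4,0,-5,11,-18,26], [-135,828,-492,156,-23,2,-2,0,0,0,0,0,0],
  [0,-117,117,-61,24,-6,0,0,0,0,0,0,0], [0,-4,1,0,0,0,0,0,0,0,0,-1,0],
  [0,-8,8,-8,-15,20,-7,0,0,0,0,0,0], [0,7,-7,2,0,0,0,0,0,0,0,0,0],
  [-5,0,0,0,0,0,0,0,0,-2,11,-27,43], [0,0,0,0,-7,0,16,-24,24,-24,24,-24,24],
  [0,34,-27,20,-14,9,-5,2,0,-1,1,-1,1], [0,15,3,-7,4,-1,0,0,0,0,0,0,0],
  [0,20,-24,24,-21,16,-10,4,1,-4,4,0,-9], [0,0,0,0,0,0,0,0,0,0,-1,8,-26],
  [0,6,-5,4,-3,2,-1,0,1,-2,3,-4,0], [0,9,-9,7,-5,3,-1,0,0,0,0,0,0],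
  [0,2,-1,0,1,-2,3,-4,5,-6,7,-8,9], [0,9,-9,3,0,0,0,0,0,0,-2,0,0],
  [0,-85,85,-85,64,-22,0,0,0,0,0,0,0], [0,0,0,0,0,0,0,0,-3,17,-52,108,-108],
  [0,0,0,0,0,0,0,-1,4,-7,8,-9,9], [-129,-25,25,-25,25,-25,25,-28,28,-14,0,0,0],
  [0,-5,5,-5,5,-5,5,-5,4,0,-9,23,0], [0,51,-31,16,-6,0,3,-4,4,-4,4,-4,4],
  [0,65,-65,59,-50,40,-30,20,-10,0,10,-20,20], [0,-9,9,-9,8,-8,8,-4,0,0,0,0,0],
  [-167,-141,36,-1,1,-1,0,0,0,0,0,0,0], [0,42,-42,41,-39,36,-32,27,-21,14,-7,0,7],
  [0,25,-27,22,-14,6,0,-3,3,-1,-1,0,1], [0,7,-7,7,-7,7,-7,6,-3,0,0,0,0],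
  [0,6,-6,6,-6,5,-3,1,0,0,0,0,0], [0,-9,9,-9,9,-9,9,-5,0,0,0,0,0],
  [0,72,-7,-17,17,-10,4,-1,0,0,0,0,0], [0,42,-42,42,-42,42,-42,41,-37,28,-14,0,0],
  [0,99,-29,-6,6,-1,0,0,0,0,0,0,0], [0,21,-21,21,-21,21,-21,20,-15,0,35,-105,230],
  [0,0,0,0,0,0,0,0,0,0,1,-4,4], [0,0,0,0,0,0,0,0,-1,4,-7,8,-9],
  [0,-14,14,-14,14,-12,9,-6,3,0,-3,6,-9], [0,0,0,0,1,-3,3,-1,0,0,0,0,0],
  [0,-10,10,-10,9,-7,4,0,-5,11,-18,25,0], [0,0,0,0,0,0,0,-2,8,-15,15,0,-38],
  [-10,120,-120,120,-120,120,-120,118,-110,91,-56,0,0],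
  [0,-62,62,-41,20,0,-20,40,-60,80,-100,120,-140], [0,15,-15,14,-12,9,-5,0,6,-13,21,-30,30],
  [0,3,-3,3,-3,0,9,-25,46,-67,81,-81,81], [0,16,-20,20,-17,12,-6,0,5,-8,8,-5,2],
  [0,-70,70,-40,15,-3,0,0,0,0,0,0,0], [0,30,-30,0,8,-5,2,0,0,0,0,-15,0],
  [-24,35,-28,21,-15,10,-6,3,-1,0,0,0,0], [0,-27,27,-27,27,-27,27,-27,27,-28,28,0,-108],
  [-1,10,-10,10,-10,9,-6,0,10,-25,46,-74,109], [0,6,-6,5,-3,0,4,-9,15,-22,30,-39,49],
  [0,-5,5,-4,3,-2,1,0,-1,2,-3,4,-5], [0,5,-7,9,-9,6,0,-8,16,-21,19,-5,-27],
  [0,25,-25,13,-3,0,0,0,0,0,0,0,0], [0,-7,7,-7,7,-7,7,-7,6,0,-21,76,-165],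
  [0,99,-99,89,-75,60,-45,30,-15,0,15,-30,0], [0,0,0,0,0,0,-5,18,-34,48,-62,76,-90],
  [0,54,-57,60,-63,65,-65,62,-55,43,-25,0,0], [0,0,0,0,0,-3,12,-28,49,-70,84,-84,84],
  [0,56,-56,41,-21,0,21,-42,63,-84,105,-126,147], [0,0,0,0,0,0,0,0,-1,5,-14,28,0],
  [0,0,0,0,0,0,0,0,0,-1,7,-22,37], [0,-56,12,2,-1,0,0,0,0,0,0,0,0],
  [0,-26,26,-16,6,-1,0,0,0,0,0,0,0], [0,28,-21,14,-7,0,7,-15,25,-35,35,0,-119],
  [-25,42,-42,42,-42,39,-31,19,-7,0,0,0,16], [0,-7,7,-7,7,-7,7,-7,5,0,0,-5,0],
  [0,0,0,8,-8,4,-1,0,0,0,0,0,0], [0,115,-115,87,-45,0,40,-70,88,-95,95,-95,95],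
  [0,-14,14,-9,7,-7,7,-7,7,0,-40,175,-525], [0,45,-45,45,-45,45,-45,44,-40,31,-17,0,16],
  [0,42,-42,42,-42,42,-42,42,-42,41,-33,0,58], [0,90,-90,70,-42,15,5,-15,15,-8,0,0,0],
  [0,9,-9,9,-9,8,-5,0,5,-5,-9,51,-141], [-7499,-366,366,-366,309,-252,140,-28,28,-28,0,0,0],
  [0,30,-23,16,-9,2,5,-13,23,-33,33,0,-107], [0,8,-5,2,0,-1,1,0,-2,5,-9,14,-20],
  [0,0,0,0,3,-7,11,-15,19,-23,27,-31,31], [0,-64,64,-64,63,-63,63,-63,63,-42,0,0,0],
  [0,1,0,-1,2,-3,4,-5,6,-7,7,0,-32], [-4,-1,1,-1,1,-1,1,-1,1,0,-8,43,-148],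
  [0,-6,6,-6,6,-6,6,-6,5,0,-12,32,-61], [0,0,0,0,0,0,0,-1,4,-7,0,35,-35],
  [0,14,-7,0,6,-11,15,-18,20,-21,21,-21,21], [-4,0,0,0,0,0,0,0,0,-1,4,0,-40],
  [0,12,-7,2,1,-2,2,-2,2,0,-9,34,-89], [0,0,0,0,0,0,0,0,0,-1,7,-25,62],
  [0,43,-15,-6,20,-27,27,-21,11,0,-8,8,-8], [0,0,0,0,0,0,0,0,0,0,1,-8,33],
  [0,11,3,-10,10,-8,7,-7,7,-7,7,0,-44], [0,0,0,0,0,0,0,0,0,0,1,-6,15],
  [0,-14,14,-14,14,-14,14,-15,15,0,-65,245,-644], [0,-2,2,-2,2,-2,2,0,-9,33,-83,173,-320],
  [0,129,-129,80,-31,6,0,0,0,0,0,0,0], [0,-1545,1545,-913,267,70,-70,0,0,0,0,0,0],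
  [0,-5,5,-5,5,-5,4,0,-10,30,-65,120,-175], [0,6,-6,5,-3,0,4,-9,15,-22,30,-39,48],
  [-30,85,-85,79,-70,60,-50,40,-30,20,-10,0,0], [0,-14,14,-14,14,-14,14,-15,15,0,-70,280,-715],
  [0,20,-20,17,-12,6,0,-5,8,-8,4,4,-16], [0,150,-150,108,-59,23,-5,0,0,0,0,0,0],
  [0,2,0,-1,1,0,-2,5,-9,14,-20,27,-35], [0,-1,1,0,-2,5,-9,14,-20,27,-35,44,-53],
  [0,1,-1,1,-1,1,-1,0,4,-9,9,-23,177], [0,0,0,0,0,0,0,-66,312,-803,1539,-2520,3746],
  [0,-3,5,-6,6,-5,3,0,-4,9,-15,22,-29], [0,16,0,-10,14,-15,15,-15,15,-14,10,0,-20],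
  [0,28,-28,28,-28,28,-30,35,-35,0,140,-518,1353], [0,0,0,0,0,0,0,-2,9,-21,28,-3,-54],
  [0,59,-51,43,-35,27,-19,11,-4,0,0,0,0], [0,-4,4,-4,4,-4,3,0,-5,10,-11,8,-8],
  [0,0,0,0,0,-2,9,-24,49,-84,126,-168,203], [0,35,-35,35,-35,34,-31,25,-15,0,21,-49,77],
  [0,36,-49,55,-55,50,-41,29,-15,0,15,-30,45], [0,0,0,0,0,0,0,0,1,-6,18,-32,27],
  [0,8,15,-24,24,-20,15,-10,5,0,-5,10,-15], [0,9,-9,9,-9,9,-9,8,-5,0,7,-16,25],
  [0,177,-177,149,-121,96,-72,48,-24,0,24,-48,48], [0,0,0,0,0,0,-1,3,-3,1,-1,-53,539],
  [0,1,-1,1,-1,1,-1,1,-1,0,5,-17,39], [0,-8,8,-7,4,-1,0,0,0,0,0,0,0],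
  [0,-2,2,-2,2,-2,2,-2,2,0,-7,14,0], [0,2,-2,0,3,-6,8,-8,5,2,-14,32,-32],
  [-3,14,-14,14,-14,14,-14,13,-9,0,14,-28,28], [0,-34,34,-34,34,-35,35,-35,35,0,-174,660,-1700],
  [0,14,7,-15,15,-12,9,-7,5,0,-13,41,-93], [0,30,-30,28,-24,18,-10,0,12,-26,39,-39,0],
  [-527,-947,947,-947,947,-947,946,-946,946,-911,701,0,0],
  [0,-9,9,-9,9,-10,10,0,-40,145,-369,789,-1482], [0,25,-25,25,-25,25,-25,23,-23,34,-45,0,202],
  [0,-9,9,-9,9,-6,2,0,0,0,0,0,0], [0,42,-42,42,-42,42,-42,41,-37,27,-11,0,0],
  [0,-80,80,-59,38,-20,8,-2,0,0,0,0,0], [0,-1,1,-1,1,-1,1,-1,1,0,-8,44,-163],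
  [0,-1,1,-1,1,-1,1,-1,1,0,-6,26,-76], [0,0,0,0,0,0,0,0,1,-5,14,-30,53],
  [0,-102,102,-81,60,-40,20,0,-20,40,-60,80,-80], [-7,-37,37,-23,9,0,-4,5,-5,5,-5,5,-5],
  [0,3,-3,3,-3,0,6,-13,20,-27,34,-41,48], [0,0,0,0,0,0,0,-1,6,-21,46,-46,46],
  [-6,0,0,0,0,0,0,0,0,0,-1,6,0], [0,3,0,-1,1,-1,1,0,-4,14,-34,69,-125],
  [0,-1,1,-1,0,0,0,0,0,21,-63,63,-63], [0,106,6,-20,6,1,-1,0,0,0,0,0,0],
  [-33,117,-117,82,-42,12,4,-9,9,-9,9,0,-40], [0,7,-7,10,-14,17,-17,12,0,-21,53,-98,156],
  [0,0,0,0,-7,26,-60,110,-175,252,-336,420,-420], [0,75,-75,75,-75,75,-75,75,-77,84,-84,0,420],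
  [0,1,-1,5,-5,3,-1,0,0,0,0,0,0], [0,-34,34,-34,34,-35,35,-35,35,0,-204,904,-2744],
  [0,-5,5,-5,5,-5,5,-5,4,0,-7,17,-30], [0,13,7,-15,15,-11,6,-2,0,0,1,-2,2],
  [0,0,0,0,0,0,0,0,0,1,-8,35,-110], [0,0,0,0,0,0,0,-2,11,-32,60,-63,9],
  [0,5,-5,5,-5,4,-2,0,1,-1,1,-1,1], [0,-163,163,-82,-4,55,-55,0,110,-275,495,-770,1100],
  [0,-9,1,3,-3,2,-1,0,1,-2,3,-4,5], [0,0,1,-2,3,-4,5,-6,7,-8,8,0,-43],
  [0,0,0,0,0,0,0,0,-1,5,-9,-7,92], [0,25,-25,25,-25,25,-25,25,-25,24,-18,0,30],
  [0,7,-6,5,-4,3,-2,1,0,-1,2,-3,3], [0,-9,9,-1,0,-6,12,-12,6,0,0,0,0],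
  [0,14,-14,12,-10,9,-9,9,-7,0,16,-46,95], [0,-6,6,-6,5,-3,1,0,0,0,0,0,0],
  [0,10,-10,9,-7,4,-1,0,-4,17,-44,91,-165], [0,-5,5,-5,5,0,-16,49,-105,190,-310,471,-679],
  [0,1,-1,1,0,-2,4,-5,5,-5,5,0,-20], [0,-8,8,-8,8,-8,6,0,-9,16,-16,16,-16],
  [0,75,-75,75,-75,75,-75,75,-77,84,-84,0,394], [0,0,0,0,0,0,0,0,0,-2,15,-60,175],
  [0,24,-24,24,-17,8,-2,0,0,0,0,0,0], [0,-6,2,0,0,0,0,-1,4,-10,20,-35,55],
  [0,2,-1,0,1,-2,3,-4,5,-6,7,-8,8], [0,23,-6,0,0,1,-1,0,1,-1,0,0,0],
  [0,125,-125,93,-47,0,40,-70,90,-100,100,-100,100], [-68,2,26,-40,40,-31,18,-6,0,0,0,0,0],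
  [0,48,-40,32,-24,16,-8,0,7,-11,11,-11,0], [0,8,-8,7,-6,5,-4,3,-2,1,0,0,-7],
  [-4,0,4,-5,5,-5,5,-5,5,-5,5,0,-40], [0,161,240,-408,408,-305,164,-50,0,0,0,0,0],
  [0,-6797,6797,-3416,861,9,-9,-46,0,0,0,0,0], [0,-4,2,-2,4,-4,2,0,0,-3,9,-18,27],
  [0,9,-14,14,-9,4,-1,0,0,0,0,0,0], [0,0,0,0,0,-1,3,-5,5,0,-14,37,0],
  [0,70,-70,47,-21,0,14,-21,21,-14,0,21,-21], [0,-29,29,-22,15,-9,4,0,-3,5,-6,6,-6],
  [0,-8,8,-8,8,-8,6,0,-9,16,-16,16,0], [0,0,0,0,0,0,-5,29,-98,252,-546,1050,-1834],
  [0,45,-45,45,-45,45,-45,44,-42,42,-42,0,252], [0,-18,18,-4,4,-9,9,-4,0,0,0,0,0],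
  [0,84,-42,0,17,-20,20,-20,20,-20,20,-20,20],
  [0,-21,21,0,-36,82,-134,189,-245,301,-357,413,-413],
  [0,-1360,1360,-877,394,-102,0,0,16,-16,16,-16,16], [-33,32,-33,34,-35,36,-36,33,-25,12,1,0,-43],
  [0,49,-49,49,-49,49,-49,46,-33,0,63,-163,307], [0,-22,22,-7,2,-2,2,-1,0,0,0,0,0],
  [0,32,-32,32,-32,32,-35,42,-42,0,155,-542,1340], [0,13,-13,13,-11,7,-3,1,-1,0,8,-32,81],
  [0,0,0,0,0,0,0,0,-1,8,-36,119,-310], [0,5,-5,2,2,-5,5,0,-12,33,-65,110,-168],
  [0,-3,3,-3,3,-3,2,0,-2,4,-6,8,-10], [0,4,-4,0,7,-16,26,-36,45,-52,56,-56,56],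
  [0,-5,5,0,-6,12,-18,24,-30,36,-42,48,-48],
  [0,630,-630,630,-714,815,-815,625,-245,-196,420,0,-420],
  [0,-75,75,-75,75,-75,50,0,0,-186,624,-1062,1500], [0,-7,7,-6,5,-4,3,-2,1,0,-1,2,-2],
  [0,9,-9,6,0,-5,5,0,-2,-19,99,-294,680], [0,0,0,0,0,0,0,-1,4,-4,1,0,1],
  [0,42,-42,40,-36,32,-30,30,-30,27,-18,0,27], [0,4,-4,4,-4,3,0,-6,15,-24,24,0,0],
  [0,-2,2,-2,2,-2,2,-2,2,0,-15,78,-271], [0,69,-69,27,-6,6,-6,3,-1,0,0,0,0],
  [0,182,-182,126,-72,33,-9,0,0,0,0,0,0], [0,42,-42,42,-42,40,-37,37,-44,56,-56,0,198],
  [-6,75,-75,75,-75,75,-75,75,-77,84,-84,0,360], [0,3,-3,-2,7,-7,2,5,-10,10,-5,0,0],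
  [0,-3,3,-6,6,-3,0,2,-3,3,-2,0,0], [-1,-1,1,-1,1,-1,1,-1,1,-1,1,0,-9],
  [0,9,-9,9,-9,8,-5,0,6,-12,18,-24,24], [0,0,0,0,0,0,0,-1,5,-5,5,-159,1029],
  [0,-1,1,-1,1,-1,1,-1,1,0,-7,35,-119], [0,0,0,0,0,0,0,0,0,-1,7,-25,65],
  [-8,10,-10,9,-7,4,0,-5,11,-18,26,-35,44], [0,-83,83,-71,59,-53,53,-53,41,0,-90,249,-408],
  [0,13,7,-15,15,-11,6,-2,0,0,1,-2,0], [0,4,-4,4,-4,4,0,-6,9,-9,9,-9,9],
  [0,-3,3,-3,3,0,-8,20,-32,39,-39,39,-39], [-44,30,-30,30,-30,29,-28,28,-28,28,-28,0,190],
  [-26,45,-45,45,-45,45,-45,44,-42,42,-42,0,245],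
  [0,-125,125,-125,125,-125,125,-126,126,-126,126,0,-750], [0,0,0,0,0,0,0,-1,5,-15,34,-53,53],
  [0,4,0,-2,2,-1,0,0,2,-7,16,-30,50], [0,6,-6,6,-6,4,0,-4,5,0,-14,40,0],
  [0,45,-45,45,-45,36,0,-66,152,-248,344,-440,536],
  [0,113,-645,911,-911,695,-353,0,239,-239,-125,978,-978],
  [0,-120,120,-120,106,-78,41,0,-42,84,-126,168,0], [0,6,-6,3,0,-2,3,-3,2,0,-3,7,-12],
  [0,13,7,-12,12,-12,12,-11,9,-7,5,0,-16], [0,0,-20,20,0,-20,20,-3,-5,0,0,0,0],
  [0,20,-7,-2,7,-9,9,-8,7,-7,7,0,-33], [-114,-84,84,-84,84,-84,82,-77,77,-112,182,0,-1265],
  [0,-14,14,-14,14,-14,14,-15,15,0,-30,0,301], [0,0,0,33,-28,9,0,1,-2,0,0,0,0],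
  [0,3165,-3165,3165,-3165,2276,0,-3236,6292,-8028,8028,-6600,4052],
  [0,-14,14,-14,14,-17,25,-39,59,-80,80,0,-160], [0,17,11,-18,18,-18,18,-16,12,-8,4,0,-4],
  [0,0,0,0,0,0,0,0,0,0,1,-9,44], [0,0,0,0,0,0,0,0,0,-1,9,-44,156],
  [0,1,-1,1,-1,1,-1,1,-1,0,8,-43,153], [0,1,-1,1,-1,1,-1,1,-1,0,7,-34,111],
  [0,35,-35,30,-20,5,12,-25,25,0,-65,188,-390], [0,-55,19,-1,1,-1,0,0,0,0,0,0,0],
  [0,1,-1,1,-1,1,-1,1,-1,0,3,-3,3], [0,-546,546,-273,0,0,0,80,0,-140,0,140,0],
  [0,0,0,-1,2,0,0,0,0,0,-132,792,-1452], [0,155,-155,120,-65,0,69,-139,209,-279,349,-419,419],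
  [0,0,0,0,0,0,0,0,-1,5,-15,34,0], [0,2,-2,3,-3,0,8,-23,47,-82,130,-193,273],
  [0,0,1,-2,2,0,-5,14,-28,48,-75,110,-153], [-2,6,-6,0,11,-26,44,-64,85,-106,126,-144,162],
  [0,-8,8,-8,8,-8,5,0,0,0,0,-182,1442], [-12,7,-7,7,-7,4,4,-16,28,-36,36,0,-193],
  [-17,15,-15,15,-15,12,-4,-8,20,-28,28,0,-108], [0,5,-5,5,-5,0,11,-25,39,-53,67,-67,67],
  [0,1,-1,0,0,1,-2,2,-1,0,1,-2,0], [0,0,0,32,-67,88,-88,68,-35,0,24,-24,0],
  [0,0,0,0,0,-6,21,-45,78,-120,161,-161,161], [0,-158,98,-38,8,2,-2,0,0,0,5,-15,15],
  [0,-1,1,-1,1,-1,-4,0,57,-211,421,-421,0], [0,0,0,0,0,0,0,-1,7,-28,81,-183,351],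
  [0,0,0,0,0,0,-1,5,-15,31,-47,63,-79], [0,-4,4,0,-4,5,-1,-9,25,-46,70,-94,118],
  [0,3,-1,0,0,1,-3,6,-10,15,-21,27,-27], [0,14,-14,0,14,-14,1,17,-35,53,-71,89,-89]]"

definition clause_12 :: "int \<Rightarrow> bool list" where
  "clause_12 = clause (map mask tops_12)"

schematic_goal masks_12: "map mask tops_12 = ?T"
  by code_simp

lemmas clauses_12 =
  tab_clause[of "map mask tops_12", folded clause_12_def, unfolded masks_12 tab.simps Num.inc.simps]

lemma valid_12: "list_all (valid 12) tops_12"
  by code_simp

schematic_goal statuses_12:
  "statuses 12 2 1 = ?s0 \<and> statuses 12 3 1 = ?s1 \<and> statuses 12 4 1 = ?s2 \<and>
    statuses 12 5 1 = ?s3 \<and> statuses 12 6 1 = ?s4 \<and> statuses 12 7 1 = ?s5 \<and>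
    statuses 12 8 1 = ?s6 \<and> statuses 12 9 1 = ?s7 \<and> statuses 12 10 1 = ?s8
    \<and> statuses 12 11 1 = ?s9 \<and> statuses 12 12 1 = ?s10 \<and> statuses 12 4 3 =
    ?s11 \<and> statuses 12 5 3 = ?s12 \<and> statuses 12 6 3 = ?s13 \<and> statuses 12 7
    3 = ?s14 \<and> statuses 12 8 3 = ?s15 \<and> statuses 12 9 3 = ?s16 \<and> statuses
    12 10 3 = ?s17 \<and> statuses 12 11 3 = ?s18 \<and> statuses 12 12 3 = ?s19 \<and>
    statuses 12 6 5 = ?s20 \<and> statuses 12 7 5 = ?s21 \<and> statuses 12 8 5 = ?s22
    \<and> statuses 12 9 5 = ?s23 \<and> statuses 12 10 5 = ?s24 \<and> statuses 12 11 5 =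
    ?s25 \<and> statuses 12 12 5 = ?s26 \<and> statuses 12 8 7 = ?s27 \<and> statuses 12 9
    7 = ?s28 \<and> statuses 12 10 7 = ?s29 \<and> statuses 12 11 7 = ?s30 \<and> statuses
    12 10 9 = ?s31 \<and> statuses 12 11 9 = ?s32"
  by (intro conjI) code_simp+

text \<open>The trees of degree 12 are grouped by m, here m = 1 with a from 2 to 12.\<close>

definition trees_12_1 :: "(nat \<times> nat \<times> tree) list" where
  "trees_12_1 = [
  (2,1, B 249 [B 16 [B 25 [L [26,76,150], L [26,28,150,84], L [19,26,150], L [23,26,27],
  L [40,96,27,28,58]], B 25 [L [26,76,150], L [26,121,150,211,183], L [19,26,150],
  L [23,26,41], L [40,96,41,11,257]], B 25 [L [26,76,150], L [26,10,150,121], L [26,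
  14,10,20], L [23,26,10], L [40,96,10]], B 25 [L [26,2,150,202], L [26,2,150,84],
  L [26,2,150,225,179], L [23,26,2], L [40,96,2]], B 26 [L [2,63,84,48,229], L [2,63,
  84,48,240], L [2,63,97,150,99], L [2,220,57,48,77,58], L [2,179,245,150,77,11,
  58]]]]), (3,1, B 249 [B 16 [B 209 [L [46,179,27,85], L [210,26,145,97], L [210,26,85],
  L [210,26,85], L [189,76,85,84]], B 204 [L [209,179,48], L [26,121,145,220,183],
  L [19,26,225,220,63], L [23,26,41], L [189,40,41]], B 204 [L [209,10,179], L [26,10,
  121,145,179], L [26,14,10,20], L [23,26,10], L [189,40,10]], B 204 [L [209,2,179],
  L [26,2,84,48], L [26,2,63,220], L [23,26,2], L [189,40,2]], B 209 [L [26,2,84,11],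
  L [26,2,84,48], L [26,2,63,220], L [26,2,77,11,176], L [76,11,179,29,176]]], B 16
  [B 25 [L [26,76,47,61], L [26,28,135], L [19,26,135], L [23,26,27], L [40,96,27,28,
  58]], B 25 [L [26,76,47,35], L [26,121,135,62], L [19,26,35], L [23,26,35], L [40,96,
  35]], B 25 [L [26,76,47,35], L [26,10,135,121], L [26,14,135], L [23,26,35], L [40,
  96,35]], B 25 [L [26,2,135,202], L [26,2,135,84], L [26,2,33], L [23,26,35], L [40,
  96,35]], B 24 [L [2,63,84,48,229], L [2,63,84,48,240], L [2,63,97,292], L [2,220,
  57,45,77,11], L [2,179,45,176,245]]]]), (4,1, B 249 [B 16 [B 25 [L [24,76,85,84],
  L [210,24,121,84], L [210,24,85], L [23,210,5], L [189,40,27]], B 25 [L [24,76,48,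
  11], L [24,121,145,161,183], L [19,24,225,161,63], L [23,24,41], L [189,40,41]],
  B 25 [L [24,76,48,11], L [24,10,121,145,200], L [24,14,10,20], L [23,24,10], L [189,
  40,10]], B 24 [L [46,2,63,23], L [46,2,63,23], L [46,2,97,23,63], L [46,2,161],
  L [189,2,200]], B 209 [L [24,2,84,11], L [24,2,84,11], L [30,2,293], L [30,2,63,
  161], L [30,2,77,11,176], L [76,11,161,29,176]]], B 16 [B 25 [L [24,76,47,61], L [24,
  28,135], L [19,24,135], L [23,24,27], L [40,96,27,28,58]], B 25 [L [24,76,47,35],
  L [24,121,135,62], L [19,24,35], L [23,24,35], L [40,96,35]], B 25 [L [24,76,47,35],
  L [24,10,135,121], L [24,14,135], L [23,24,35], L [40,96,35]], B 25 [L [24,2,135,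
  202], L [24,2,135,84], L [24,2,33], L [23,24,35], L [40,96,35]], B 24 [L [2,63,84,
  48,229], L [2,63,84,48,240], L [2,63,97,259], L [2,57,259,11,260], L [2,200,45,
  176,245]]], B 16 [B 25 [L [24,76,47,3], L [24,28,3], L [19,24,3], L [23,24,3], L [40,
  96,3]], B 25 [L [24,76,47,3], L [24,121,135,62], L [19,24,3], L [23,24,3], L [40,96,
  3]], B 25 [L [24,76,47,3], L [24,10,7,121], L [24,14,135], L [23,24,3], L [40,96,
  3]], B 25 [L [24,2,7], L [24,2,7], L [24,2,33], L [23,24,3], L [40,96,3]], B 24 [L [2,
  63,15,84,11,99], L [2,63,15,84,11,99], L [2,63,97,7], L [2,260,15,57,97,99],
  L [2,200,39,97]]]]), (5,1, B 261 [B 16 [B 25 [L [5,76,47,61], L [5,28,61,145,251],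
  L [19,5,61,271], L [23,5,27], L [111,40,27]], B 25 [L [5,76,47,35], L [5,62,35],
  L [19,5,35], L [23,5,35], L [111,40,35]], B 25 [L [5,76,47,35], L [5,10,121,145,
  251], L [14,5,35,20], L [23,5,35], L [111,40,35]], B 25 [L [5,2,45,84], L [5,2,84,
  61], L [5,2,33], L [23,5,35], L [111,40,35]], B 5 [L [24,2,45,77], L [2,63,84,48,
  229], L [2,63,84,48,240], L [2,63,97,45,77], L [2,57,97,251,45,221,77], L [200,2,
  245,45,77]]], B 16 [B 25 [L [5,76,47,3], L [5,28,3], L [19,5,3], L [23,5,3], L [40,
  96,3]], B 25 [L [5,76,47,3], L [5,62,3], L [19,5,3], L [23,5,3], L [40,96,3]], B 25
  [L [5,76,47,3], L [5,10,121,7,32], L [14,5,3,20], L [23,5,3], L [40,96,3]], B 25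
  [L [5,2,39], L [5,2,39], L [5,2,33], L [23,5,3], L [40,96,3]], B 24 [L [5,2,39],
  L [2,63,15,84,11,99], L [2,63,15,84,11,99], L [2,63,97,7], L [2,57,7,11,212,
  97], L [2,200,39,97]]], B 16 [B 25 [L [5,76,37,3], L [5,28,3], L [19,5,3], L [23,5,
  3], L [40,96,3]], B 25 [L [5,76,37,3], L [5,62,3], L [19,5,3], L [23,5,3], L [40,96,
  3]], B 25 [L [5,76,37,3], L [5,10,64,7,188], L [14,5,3,20], L [23,5,3], L [40,96,
  3]], B 25 [L [5,2,36], L [5,2,36], L [5,2,33], L [23,5,3], L [40,96,3]], B 5 [L [2,
  63,15,84,228], L [2,63,15,84,11,99], L [2,63,15,84,11,99], L [2,63,97,7], L [2,
  190,57,11], L [200,2,36,97]]]]), (6,1, B 261 [B 16 [B 25 [L [116,42,47,61], L [116,28,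
  61,211], L [19,116,61,211], L [23,116,27], L [111,40,27]], B 25 [L [116,42,47,35],
  L [116,62,35], L [19,116,35], L [23,116,35], L [111,40,35]], B 25 [L [116,42,47,35],
  L [116,10,97,145,246], L [116,14,35,20], L [23,116,35], L [111,40,35]], B 25 [L [116,
  2,97], L [116,2,97], L [116,2,33], L [23,116,35], L [111,40,35]], B 116 [L [5,2,45,
  77], L [5,2,45,77], L [5,2,45,77], L [2,63,97,272], L [2,57,97,47,221,244,225],
  L [2,246,45,176,294]]], B 16 [B 25 [L [5,42,47,3], L [5,28,3], L [19,5,3], L [23,5,
  3], L [40,107,3]], B 25 [L [5,42,47,3], L [5,62,3], L [19,5,3], L [23,5,3], L [40,
  107,3]], B 25 [L [5,42,47,3], L [5,10,121,7,32], L [14,5,3,20], L [23,5,3], L [40,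
  107,3]], B 25 [L [5,2,39], L [5,2,39], L [5,2,33], L [23,5,3], L [40,107,3]], B 5
  [L [2,24,39], L [2,13,7,15,29], L [2,13,7,15,29], L [2,13,7,15,29], L [2,57,7,
  11,212,125], L [246,2,39,97]]], B 16 [B 25 [L [5,42,37,3], L [5,28,3], L [19,5,3],
  L [23,5,3], L [40,107,3]], B 25 [L [5,42,37,3], L [5,62,3], L [19,5,3], L [23,5,3],
  L [40,107,3]], B 25 [L [5,42,37,3], L [5,10,64,7,188], L [14,5,3,20], L [23,5,3],
  L [40,107,3]], B 25 [L [5,2,36], L [5,2,36], L [5,2,33], L [23,5,3], L [40,107,3]],
  B 5 [L [2,13,36,63], L [2,13,7,15,29], L [2,13,7,15,29], L [2,13,273], L [2,190,
  57,11], L [246,2,36,97]]], B 16 [B 25 [L [5,42,37,3], L [5,28,3], L [19,5,3], L [23,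
  5,3], L [40,107,3]], B 25 [L [5,42,37,3], L [5,62,3], L [19,5,3], L [23,5,3], L [40,
  107,3]], B 25 [L [5,42,37,3], L [5,10,64,7,188], L [14,5,3,20], L [23,5,3], L [40,
  107,3]], B 25 [L [5,2,36], L [5,2,36], L [5,2,33], L [23,5,3], L [40,107,3]], B 5
  [L [2,13,36,102], L [2,13,7,15,29], L [2,13,7,15,29], L [2,13,110], L [161,2,57,
  11], L [161,2,36,97]]]]), (7,1, B 80 [B 16 [B 25 [L [5,42,47,3], L [5,28,3], L [19,5,
  3], L [23,5,3], L [40,107,3]], B 25 [L [5,42,47,3], L [5,62,3], L [19,5,3], L [23,5,
  3], L [40,107,3]], B 25 [L [5,42,47,3], L [5,10,121,7,32], L [14,5,3,20], L [23,5,
  3], L [40,107,3]], B 25 [L [5,2,39], L [5,2,39], L [5,2,33], L [23,5,3], L [40,2,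
  96]], B 2 [L [5,29,149,97,221], L [5,42,15,244], L [5,42,47,15], L [34,5,45,164],
  L [34,5,47], L [11,5,7,63,125], L [109,48,5,202]]], B 16 [B 25 [L [5,42,37,3], L [5,
  28,3], L [19,5,3], L [23,5,3], L [40,107,3]], B 25 [L [5,42,37,3], L [5,62,3],
  L [19,5,3], L [23,5,3], L [40,107,3]], B 25 [L [5,42,37,3], L [5,10,64,7,188],
  L [14,5,3,20], L [23,5,3], L [40,107,3]], B 25 [L [5,2,36], L [5,2,36], L [5,2,33],
  L [23,5,3], L [40,2,59]], B 5 [L [2,13,36,63], L [2,13,7,15,29], L [2,13,7,15,
  29], L [2,13,7,15,29], L [2,57,7,11,71], L [2,71,198,97,37]]], B 16 [B 25 [L [5,42,
  37,3], L [5,28,3], L [19,5,3], L [23,5,3], L [40,107,3]], B 25 [L [5,42,37,3], L [5,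
  62,3], L [19,5,3], L [23,5,3], L [40,107,3]], B 25 [L [5,42,37,3], L [5,10,64,7,
  188], L [14,5,3,20], L [23,5,3], L [40,107,3]], B 25 [L [5,2,36], L [5,2,36], L [5,
  2,33], L [23,5,3], L [40,2,59]], B 5 [L [2,13,36,102], L [2,13,7,15,29], L [2,13,
  7,15,29], L [2,13,110], L [161,2,57,11], L [161,2,45,77,58]]], B 16 [B 25 [L [24,42,
  37,3], L [24,28,3], L [19,24,3], L [23,24,3], L [40,27,3]], B 25 [L [24,42,37,3],
  L [24,62,3], L [19,24,3], L [23,24,3], L [40,71,94,41]], B 25 [L [24,42,37,3],
  L [24,10,71], L [24,14,71], L [23,24,3], L [40,10,71]], B 25 [L [24,2,7], L [24,2,
  7], L [24,2,71], L [23,24,3], L [40,2,59]], B 24 [L [2,13,7,15,29], L [2,13,7,15,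
  29], L [2,13,110], L [2,161,57,11], L [2,161,45,77,58]]]]), (8,1, B 16 [B 46 [B 80
  [L [5,42,47,3], L [5,42,37,3], L [5,42,37,3], L [24,42,37,3], L [151,42,37,3]],
  B 80 [L [5,28,3], L [5,28,3], L [5,28,3], L [24,28,3], L [151,28,3]], B 80 [L [19,5,
  3], L [19,5,3], L [19,5,3], L [19,24,3], L [151,19,3]], B 23 [L [80,5,3], L [19,80,
  3], L [53,80,3], L [53,80,3]], B 115 [L [111,42,45,3], L [19,111,3], L [53,111,3]]],
  B 46 [B 80 [L [5,42,47,3], L [5,42,37,3], L [5,42,37,3], L [24,42,37,3], L [151,42,
  37,3]], B 80 [L [5,62,3], L [5,62,3], L [5,62,3], L [24,62,3], L [151,62,3]], B 19
  [L [80,5,3], L [14,80,5], L [80,5,3], L [80,5,3], L [80,5,3]], B 22 [L [80,5,3],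
  L [19,80,3], L [53,80,3], L [53,80,3]], B 115 [L [111,42,45,3], L [19,111,3], L [53,
  111,3]]], B 46 [B 80 [L [5,42,47,3], L [5,42,37,3], L [5,42,37,3], L [24,42,37,3],
  L [151,42,37,3]], B 80 [L [5,10,121,7,185], L [5,10,64,7,188], L [5,10,64,7,188],
  L [24,10,71], L [151,10,71]], B 80 [L [14,5,3,20], L [14,5,3,20], L [14,5,3,20],
  L [24,14,71], L [151,14,71]], B 23 [L [80,5,3], L [14,80,213], L [53,80,3], L [53,80,
  3]], B 115 [L [111,42,45,3], L [14,111,42], L [53,111,3]]], B 46 [B 80 [L [5,2,39],
  L [5,2,36], L [5,2,36], L [24,2,7], L [151,2,7]], B 80 [L [5,2,39], L [5,2,36],
  L [5,2,36], L [24,2,7], L [151,2,7]], B 80 [L [5,2,33], L [5,2,33], L [5,2,33],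
  L [24,2,71], L [151,2,71]], B 23 [L [80,5,3], L [80,5,3], L [80,5,3], L [80,5,3]],
  B 115 [L [111,42,45,3], L [111,42,47], L [111,2,7]]], B 80 [B 54 [L [5,34,198,164],
  L [5,34,47,198], L [5,11,39,225,224], L [2,5,39], L [2,5,15,29], L [2,5,198],
  L [2,42,176]], B 54 [L [5,34,71,185], L [5,34,37,29], L [5,11,95,71,185], L [2,5,
  36], L [2,5,71,185], L [2,5,36], L [2,42,176]], B 5 [L [2,13,36,102], L [2,13,7,15,
  29], L [2,13,7,15,29], L [2,13,110], L [2,17,57,11], L [2,17,42,48,69]], B 24
  [L [2,13,7,15,29], L [2,13,7,15,29], L [2,13,110], L [2,21,57,11], L [2,21,45,
  42,77,48]], B 151 [L [2,13,7,15,29], L [2,13,7,15,29], L [2,13,110], L [2,51,57,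
  11], L [2,51,45,77,58]]]]), (9,1, B 16 [B 46 [B 18 [L [57,103,85,84,3], L [57,17,85,
  32], L [57,191,61,42,3], L [26,42,47,3], L [38,57,55,98,60]], B 18 [L [32,28,103,
  3,140], L [32,28,17,183,3], L [32,28,21,102], L [26,28,3], L [38,28,3]], B 19
  [L [18,89,3,59], L [14,18,59], L [18,175,3], L [18,33,89], L [18,27,3]], B 23 [L [18,
  27,3], L [19,18,3], L [53,18,3], L [53,18,3]], B 115 [L [18,141,3], L [19,18,3],
  L [53,18,3]]], B 46 [B 18 [L [57,11,103,7,257,71], L [57,17,11,48], L [57,191,11,7,
  35,21], L [26,42,47,3], L [38,11,7,132]], B 18 [L [32,41,103,56,211], L [32,17,48,
  183,3], L [32,21,48,102], L [26,62,3], L [38,62,3]], B 18 [L [19,163,3], L [19,102,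
  3], L [19,191,35], L [19,26,3], L [19,38,3]], B 22 [L [18,58,41,3], L [19,18,3],
  L [53,18,3], L [53,18,3]], B 115 [L [18,141,3], L [19,18,3], L [53,18,3]]], B 46 [B 18
  [L [57,10,103,276], L [57,10,17,11], L [57,191,10,7,47,21], L [26,10,7,42], L [38,
  10,7,132]], B 18 [L [32,48,103,71,10], L [32,17,48,10], L [32,21,48,10], L [26,10,
  7,64,32], L [38,10,7,64,60]], B 14 [L [18,20,103], L [18,20,3], L [18,11,103],
  L [18,10,103], L [18,33,89], L [18,10,103]], B 22 [L [18,10,103], L [14,18,213],
  L [53,18,3], L [53,18,3]], B 115 [L [18,141,3], L [14,18,59], L [53,18,3]]], B 46
  [B 18 [L [2,13,7,103], L [2,13,17], L [2,13,21], L [26,2,7], L [38,2,7]], B 18 [L [2,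
  13,7,103], L [2,13,17], L [2,13,21], L [26,2,7], L [38,2,7]], B 18 [L [2,163,33],
  L [2,102,33,122], L [2,191,33], L [26,2,33], L [38,2,33]], B 23 [L [18,2,7], L [18,
  2,78], L [18,2,7], L [18,2,7]], B 115 [L [18,2,7], L [18,2,59], L [18,2,7]]], B 18
  [B 57 [L [13,11,103,224,45], L [2,163,7,103], L [2,103,198], L [32,2,71,48,7],
  L [2,163,78,103], L [2,198,103], L [42,2,59,198,257]], B 2 [L [57,103,29,140,59,
  77], L [57,103,77,244,140,58,37], L [57,103,126,176,140,37], L [34,102,122,59],
  L [34,102,37,122], L [11,102,17,103], L [109,48,17]], B 54 [L [57,191,61,42,239],
  L [57,191,61,84,239], L [13,11,21,102], L [2,13,21], L [2,191,102,239], L [2,58,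
  78,69], L [2,42,69]], B 26 [L [2,13,7,15,29], L [2,13,7,15,29], L [2,13,7,15,29],
  L [2,13,110], L [2,51,57,11], L [2,51,45,77,58]], B 26 [L [2,13,7,15,29], L [2,13,
  7,15,29], L [2,13,7,15,29], L [2,13,110], L [2,51,60,50], L [98,2,60,7]]]]), (10,
  1, B 16 [B 46 [B 129 [L [18,57,55], L [18,57,55], L [18,13,37,45], L [18,13,3], L [18,
  85,72], L [18,58,3], L [76,85,69]], B 18 [L [13,3,269], L [13,3,269], L [13,21,175,
  3,183], L [26,28,3], L [38,28,3], L [4,28,3]], B 19 [L [18,89,3,59], L [14,18,59],
  L [18,175,3], L [18,33,89], L [27,18,3]], B 22 [L [18,27,3], L [19,18,3], L [53,18,
  3], L [53,18,3]], B 79 [L [18,141,3], L [19,18,3], L [53,18,3]]], B 46 [B 18 [L [57,11,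
  7,163,58,3], L [57,17,11,48], L [57,21,11,48], L [26,76,47,3], L [38,76,47,3],
  L [4,11,7,125]], B 18 [L [13,56,41,71,205,183,140], L [13,56,17,41,140], L [13,56,
  21,41,148], L [26,62,3], L [38,62,3], L [4,62,3]], B 19 [L [18,11,72], L [14,18,59],
  L [18,72,3], L [18,11,89], L [18,41,72,3]], B 22 [L [18,58,41,3], L [19,18,3],
  L [53,18,3], L [53,18,3]], B 79 [L [18,141,3], L [19,18,3], L [53,18,3]]], B 46 [B 18
  [L [57,10,7,163,58,37], L [57,10,17,11], L [57,21,11,10], L [26,10,7,76], L [38,
  10,7,76], L [4,10,7,125]], B 18 [L [13,10,7,64,71,188], L [13,10,17], L [13,10,
  21], L [26,10,7,64,75], L [38,10,7,64,60], L [4,10,7,64,60]], B 14 [L [18,20,72,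
  17,138], L [18,20,3], L [18,11,72], L [18,10,72], L [18,33,89], L [18,10,72]], B 22
  [L [18,10,7,58], L [14,18,213], L [53,18,3], L [53,18,3]], B 79 [L [18,141,3], L [14,
  18,59], L [53,18,3]]], B 46 [B 18 [L [2,13,7,15,235], L [2,13,17], L [2,13,21],
  L [26,2,7], L [38,2,7], L [4,2,7]], B 18 [L [2,13,7,15,235], L [2,13,17], L [2,13,
  21], L [26,2,7], L [38,2,7], L [4,2,7]], B 18 [L [2,102,33,163], L [2,102,33,89,
  11], L [2,102,21], L [26,2,33], L [38,2,33], L [4,2,33]], B 22 [L [18,2,7], L [18,2,
  78], L [18,2,7], L [18,2,7]], B 79 [L [18,2,7], L [18,2,59], L [18,2,7]]], B 18 [B 129
  [L [57,227,15,163,193,78,274], L [57,48,71,193,29,248,198], L [13,11,95,163,71,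
  149,236], L [2,13,7,235], L [2,102,37,29,89,11], L [2,58,78,7], L [2,76,270]],
  B 129 [L [57,17,227,164,45,140], L [57,17,48,102,248], L [13,11,17,102,45,247],
  L [2,13,17], L [2,102,17,89,11], L [2,58,78,69], L [2,76,69]], B 54 [L [57,21,227,
  13], L [57,21,48,102], L [13,11,21,102], L [2,13,21], L [2,102,21], L [2,58,78,69],
  L [2,76,69]], B 57 [L [26,11,7,71,125], L [2,26,7], L [2,26,7], L [2,13,21], L [2,
  26,15,29], L [2,26,7], L [76,2,69,48]], B 38 [L [2,13,7,15,29], L [2,13,7,15,29],
  L [2,13,7,15,29], L [2,13,110], L [2,51,60,50], L [98,2,60,7]], B 4 [L [2,63,60,
  7], L [2,63,15,57,99,11], L [2,63,15,195,148,99], L [2,51,60,50], L [2,98,60,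
  7]]]]), (11,1, B 16 [B 192 [B 54 [L [8,74,55], L [8,74,55], L [8,13,17], L [8,13,3],
  L [8,85,69], L [8,104,3], L [8,100,3]], B 18 [L [8,13,3], L [13,159,3,17], L [13,21,
  175,3,183], L [13,51,3,61,27], L [30,28,3,72], L [4,28,3], L [4,28,3]], B 19 [L [8,
  89,110], L [14,8,50], L [8,175,3], L [8,33,89], L [27,8,3]], B 53 [L [22,4,3], L [19,
  8,3], L [22,4,3], L [8,27,3], L [19,8,3]], B 79 [L [8,141,3], L [19,8,3], L [53,8,
  3]]], B 192 [B 129 [L [8,74,55], L [8,74,55], L [8,13,17], L [8,13,3], L [8,11,17],
  L [8,11,17], L [8,100,3]], B 8 [L [13,56,17,159], L [13,56,21,41,72], L [13,56,51],
  L [30,62,35], L [4,62,3], L [4,62,3]], B 19 [L [8,11,17], L [14,8,50], L [8,72,3],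
  L [8,11,17], L [8,41,72,3]], B 53 [L [22,4,3], L [19,8,3], L [22,4,3], L [8,41,94,
  17], L [19,8,3]], B 79 [L [8,141,3], L [19,8,3], L [53,8,3]]], B 192 [B 129 [L [8,74,
  55], L [8,74,55], L [8,13,17], L [8,10,17], L [8,10,17], L [8,10,17], L [8,100,3]],
  B 8 [L [13,10,17], L [13,10,21], L [13,10,21], L [30,10,7,13,60], L [4,10,7,64,
  60], L [4,10,7,64,60]], B 14 [L [8,20,17,89], L [8,20,3], L [8,11,17], L [8,10,17],
  L [8,33,89], L [8,10,17]], B 53 [L [22,4,3], L [14,8,17], L [22,4,3], L [8,10,17],
  L [14,8,17]], B 79 [L [8,141,3], L [14,8,59], L [53,8,3]]], B 192 [B 8 [L [2,13,17],
  L [2,13,21], L [2,13,21], L [2,30,7,60], L [4,2,7], L [4,2,7]], B 8 [L [2,13,17],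
  L [2,13,21], L [2,13,21], L [2,30,7,60], L [4,2,7], L [4,2,7]], B 8 [L [2,72,33,
  89,11], L [2,72,33,12], L [2,72,33,66], L [2,30,33], L [4,2,33], L [4,2,33]], B 22
  [L [8,2,7], L [8,2,78], L [8,2,7], L [8,2,7], L [2,4,7]], B 79 [L [8,2,7], L [8,2,
  59], L [8,2,7]]], B 8 [B 54 [L [34,72,159,75,180], L [34,72,159,75,248], L [13,159,
  11,45,247], L [2,13,17], L [2,72,159,89,11], L [2,104,69,78], L [2,76,69]], B 129
  [L [34,72,21,241,180], L [34,72,21,241,45], L [13,11,21,45,72], L [2,13,21], L [2,
  72,21,235], L [2,104,12,69], L [2,76,69]], B 2 [L [54,51,29,13], L [54,51,15,89,
  104], L [54,51,126], L [34,72,21,45,250], L [34,72,243,66], L [11,72,21,13,45],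
  L [109,48,21]], B 2 [L [54,98,29,149], L [54,98,77,149], L [54,98,126,51], L [34,30,
  45,221], L [34,30,47], L [11,30,224,50,125], L [109,48,21]], B 4 [L [2,63,60,7],
  L [2,63,15,104,89], L [2,63,15,149,29], L [2,63,15,195,74,99], L [2,51,60,50],
  L [2,98,60,7]], B 163 [L [4,2,15,59,60], L [4,2,39], L [4,2,7], L [158,2,51,11],
  L [4,2,7], L [2,60,59]]]]), (12,1, B 16 [B 44 [B 129 [L [8,13,17], L [8,13,17], L [8,
  13,17], L [8,13,3], L [8,85,69], L [8,104,3], L [8,104,3]], B 18 [L [8,13,3], L [13,
  159,3,17], L [13,21,175,3,256], L [13,51,3,61,27], L [13,51,3,61,27], L [4,28,
  3], L [4,28,3]], B 14 [L [8,20,17,27], L [8,20,3], L [8,89,110], L [8,175,3], L [8,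
  33,89], L [27,8,3]], B 22 [L [8,27,3], L [14,8,17], L [14,8,69], L [14,8,69], L [14,
  104,110,69]], B 79 [L [8,141,3], L [14,8,59], L [14,8,69]]], B 44 [B 129 [L [8,13,17],
  L [8,13,17], L [8,13,17], L [8,13,3], L [8,11,17], L [8,11,17], L [8,11,17]], B 8
  [L [13,56,17,159], L [13,56,21,41,72], L [13,56,51], L [13,56,51], L [4,62,3],
  L [4,62,3]], B 14 [L [8,20,17,205], L [8,20,3], L [8,11,17], L [8,72,3], L [8,33,
  89], L [8,41,94,59]], B 22 [L [8,41,94,17], L [14,8,17], L [14,8,132], L [14,8,132],
  L [14,104,110,247]], B 79 [L [8,141,3], L [14,8,59], L [14,8,59]]], B 44 [B 129 [L [8,
  13,17], L [8,13,17], L [8,13,17], L [8,10,17], L [8,10,17], L [8,10,17], L [8,10,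
  17]], B 8 [L [13,10,17], L [13,10,21], L [13,10,21], L [13,10,21], L [4,10,7,64,60],
  L [4,10,7,64,60]], B 14 [L [8,20,17,89], L [8,20,3], L [8,11,17], L [8,10,17],
  L [8,33,89], L [8,10,17]], B 22 [L [8,10,17], L [14,8,17], L [14,8,214], L [14,8,
  214], L [14,104,110,214]], B 79 [L [8,141,3], L [14,8,59], L [14,8,59]]], B 44 [B 8
  [L [2,13,17], L [2,13,21], L [2,13,21], L [2,13,21], L [4,2,7], L [4,2,7]], B 8
  [L [2,13,17], L [2,13,21], L [2,13,21], L [2,13,21], L [4,2,7], L [4,2,7]], B 2
  [L [8,89,110], L [8,89,110], L [8,89,110], L [8,89,110], L [8,48,69], L [11,8,17],
  L [11,8,69]], B 22 [L [8,2,7], L [8,2,78], L [8,2,7], L [8,2,7], L [2,4,7]], B 79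
  [L [8,2,7], L [8,2,59], L [8,2,7]]], B 8 [B 129 [L [34,72,159,13,180], L [34,72,159,
  13,248], L [13,159,11,45,247], L [2,13,17], L [2,72,159,89,11], L [2,104,69,78],
  L [2,42,69]], B 129 [L [34,72,21,241,180], L [34,72,21,241,45], L [13,11,21,45,
  72], L [2,13,21], L [2,72,21,235], L [2,104,12,69], L [2,42,69]], B 2 [L [129,51,29,
  13], L [129,51,15,89,104], L [129,51,126], L [34,72,21,45,164], L [34,72,243,12],
  L [11,72,21,13,45], L [129,48,21]], B 129 [L [34,72,21,13,180], L [34,72,21,13,
  45], L [13,51,11,45], L [2,13,21], L [2,72,21,69,98], L [2,104,12,69], L [2,104,
  59]], B 4 [L [2,63,60,7], L [2,63,15,104,89], L [2,63,15,13,29], L [2,63,15,195,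
  13,99], L [2,51,60,7], L [2,98,60,7]], B 163 [L [4,2,15,59,60], L [4,2,15,29],
  L [4,2,7], L [158,2,51,11], L [4,2,7], L [2,60,59]]]])]"

lemma refutes_12_1: "refutes clause_12 12 (Suc (Suc (Suc (Suc (Suc 0))))) trees_12_1"
  unfolding trees_12_1_def by (simp only: check_rules clauses_12 statuses_12)

definition trees_12_3 :: "(nat \<times> nat \<times> tree) list" where
  "trees_12_3 = [
  (4,3, B 30 [B 165 [B 278 [L [46,101,228], L [46,101,139], L [46,101,139]], B 252 [L [46,
  101,228], L [46,101,139]]], B 279 [B 155 [L [46,101,48,27,105], L [46,101,48,27,58],
  L [46,101,48,27,58], L [16,139,85,58]], B 252 [L [46,101,139], L [46,101,139]]]]),
  (5,3, B 30 [B 46 [B 155 [L [165,105,101], L [165,105,101], L [165,105,101], L [165,139,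
  101]], B 155 [L [16,165,105], L [16,165,105], L [16,165,105], L [16,165,139]], B 165
  [L [16,117,155], L [16,117,167], L [16,117,155], L [166,16,117]], B 22 [L [16,165,58],
  L [117,16,166]]], B 280 [B 25 [L [155,101,242], L [16,242,105], L [16,117,242], L [23,
  16,242]], B 252 [L [46,101,139], L [46,101,139], L [46,101,139], L [46,101,139]], B 181
  [L [46,101,139], L [46,101,139]]], B 281 [B 155 [L [46,181,2], L [46,181,2], L [46,181,
  2], L [181,16,58]]]]), (6,3, B 116 [B 46 [B 112 [L [65,120,101], L [65,120,2], L [166,
  65,2], L [65,120,2], L [166,65,2]], B 16 [L [112,65,120], L [112,65,120], L [112,65,
  120], L [112,65,120]], B 138 [L [16,117,120], L [16,112,120], L [117,112,120], L [16,
  112,120]], B 22 [L [16,112,120], L [117,16,120]]], B 46 [B 65 [L [123,105,2], L [123,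
  105,2], L [123,105,2], L [123,105,2], L [123,139,2]], B 16 [L [65,123,157], L [65,123,
  157], L [65,123,10], L [65,123,2]], B 138 [L [16,117,31], L [16,65,3], L [117,65,31],
  L [16,65,3]], B 22 [L [16,123,58], L [117,16,31]]], B 201 [B 25 [L [65,166,2,29,105],
  L [16,65,166], L [16,117,167], L [23,16,166]], B 25 [L [65,166,2,29,105], L [16,65,
  3], L [16,117,167], L [23,16,3]], B 123 [L [46,2,228], L [46,2,65,14], L [46,2,
  228]]]]), (7,3, B 4 [B 46 [B 128 [L [81,112,11,194,39], L [54,112,65,58], L [42,112,
  48,29,105], L [32,112,68,181], L [65,112,2,101], L [58,112,164,101,29]], B 16
  [L [32,112,157], L [32,112,157], L [32,112,68,181], L [32,112,68,181]], B 16 [L [138,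
  65,3], L [138,65,3], L [138,65,3], L [117,65,2,166]], B 22 [L [16,58,166], L [138,
  112,2,181]]], B 46 [B 81 [L [82,31,2,194], L [82,31,68,123], L [65,123,2], L [105,31,
  2], L [65,123,2], L [31,58,48,34,123]], B 16 [L [32,31,157], L [32,31,157], L [32,31,
  68,123], L [32,31,68,123]], B 16 [L [138,65,3], L [138,65,3], L [138,65,3], L [117,
  65,31,167]], B 22 [L [16,58,31], L [138,31,2]]], B 46 [B 32 [L [81,31,11,194,113],
  L [54,31,227,65,229], L [42,31,48,113], L [82,31,48,113], L [65,123,2], L [58,31,
  34,2]], B 16 [L [32,31,157], L [32,31,157], L [32,31,68,113], L [32,31,68,113]], B 16
  [L [138,65,3], L [138,65,3], L [138,65,3], L [117,65,31,167]], B 22 [L [16,58,31],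
  L [138,31,2]]], B 253 [B 25 [L [82,2,65,45,77,11], L [16,32,61], L [16,65,85], L [23,
  16,35,27]], B 25 [L [82,156,68,2,194], L [16,32,55], L [16,65,3], L [23,16,3]], B 25
  [L [82,156,68,2,71], L [16,32,55], L [16,194,156], L [23,16,3]]]]), (8,3, B 43 [B 46
  [B 81 [L [82,130,31], L [82,130,31], L [54,130,31], L [42,130,31], L [177,130,31],
  L [130,58,164]], B 16 [L [32,130,31], L [32,130,31], L [32,130,31], L [32,130,31]],
  B 16 [L [19,130,3], L [19,130,3], L [14,130,31], L [130,2,31]], B 22 [L [16,130,3],
  L [16,130,3]]], B 46 [B 81 [L [82,31,2,226], L [82,31,68,113], L [54,31,226,2],
  L [42,31,48,113], L [177,31,11,113], L [58,113,164,48,99]], B 16 [L [32,31,157],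
  L [32,31,157], L [32,31,68,113], L [32,31,68,113]], B 16 [L [19,31,226], L [19,31,
  226], L [14,31,203,71], L [2,31,226]], B 22 [L [16,58,166], L [16,117,31]]], B 46
  [B 118 [L [82,68,61,58,177], L [82,156,68,2,125], L [82,156,68,2,194], L [82,156,
  68,2,71], L [113,82,68]], B 16 [L [118,32,61], L [118,32,61], L [118,32,61], L [118,
  32,61]], B 16 [L [118,19,167], L [118,19,35], L [118,14,203], L [118,2,33]], B 22
  [L [16,118,45], L [16,118,47]]], B 151 [B 25 [L [82,68,7,177,2], L [16,32,55], L [16,
  194,15,3], L [23,16,3]], B 25 [L [82,2,7,177,37], L [16,32,55], L [16,194,15,3],
  L [23,16,3]], B 25 [L [82,113,68], L [16,32,55], L [16,113,85], L [23,16,3]]]]), (9,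
  3, B 46 [B 43 [B 254 [L [86,81,11,45,268], L [54,86,55,3,180,243], L [54,86,34],
  L [32,86,48], L [86,177,3,11], L [58,86,48,180]], B 54 [L [82,86,122], L [82,86,
  122], L [86,81,122,11], L [32,86,122], L [2,86,122], L [58,2,113]], B 32 [L [81,113,
  11,45,148], L [54,12,227,148,45,2], L [54,12,29], L [82,12,48,21], L [177,10,113],
  L [2,12,282]], B 54 [L [82,93,61,51], L [82,93,61,51], L [93,11,187,45,148], L [32,
  93,68], L [2,93,47,177,148], L [58,2,113]], B 38 [L [82,68,7,177,2], L [82,68,7,
  136,2], L [82,68,7,148,2], L [182,82,68]]], B 16 [B 18 [L [32,86,147], L [32,86,122],
  L [32,12,157], L [32,93,147], L [38,32,55]], B 18 [L [32,86,147], L [32,86,122],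
  L [32,12,157], L [32,93,147], L [38,32,55]], B 18 [L [32,86,68], L [32,86,122], L [32,
  12,68,21], L [32,93,68], L [38,32,55]], B 43 [L [32,86,68], L [32,86,122], L [32,12,
  68,21], L [32,93,68], L [38,32,55]]], B 16 [B 19 [L [43,119,3], L [43,14,59], L [43,
  119,3], L [43,33,136,85], L [43,27,3]], B 19 [L [43,119,3], L [43,14,59], L [43,119,
  3], L [43,11,136], L [43,177,3,41]], B 43 [L [14,86,203], L [14,86,122], L [14,12,
  203,71], L [14,93,203,239], L [38,14,3,20]], B 43 [L [2,86,33,117,299], L [2,86,
  122], L [2,12,33,148], L [2,93,33,148], L [38,2,33]]], B 23 [B 16 [L [43,58,27,3],
  L [43,58,41,3], L [43,58,152,3], L [43,2,7]], B 16 [L [19,43,3], L [19,43,3], L [43,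
  14,213], L [43,2,78]]]]), (10,3, B 46 [B 6 [B 54 [L [9,128,15,180], L [9,128,37,15],
  L [9,144,37,45], L [2,9,170], L [2,9,37,77], L [58,2,37,78,99]], B 54 [L [9,128,
  12,15], L [9,128,12,37], L [9,144,37,12], L [2,9,12], L [2,9,12], L [58,2,37,78,
  99]], B 54 [L [128,51,61,152,180], L [128,51,61,152,45], L [144,182,11,45,148],
  L [2,144,182], L [2,93,15,255,11,29], L [58,2,37,195,99]], B 54 [L [38,145,55,
  221], L [38,34,7,47], L [38,11,7,149], L [38,2,7], L [38,2,15,29], L [38,2,7]], B 4
  [L [54,236,34,11], L [54,236,34,11], L [54,236,34,11], L [54,155,34,37,195], L [54,
  51,126]]], B 16 [B 18 [L [6,144,3], L [9,144,3], L [9,144,3], L [93,28,145,147],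
  L [38,28,3], L [4,28,3]], B 6 [L [9,144,3], L [9,144,3], L [144,182,35,147,148],
  L [38,145,147], L [4,145,147]], B 6 [L [9,144,3], L [9,144,3], L [144,10,182], L [38,
  145,55,3], L [4,145,55,3]], B 6 [L [2,9,170], L [2,9,12], L [2,144,182], L [38,2,
  7], L [4,2,7]]], B 16 [B 19 [L [6,119,3], L [6,14,50], L [6,175,3], L [6,33,148,9],
  L [6,27,3]], B 6 [L [19,9,3], L [19,9,3], L [19,93,35,148], L [19,38,3], L [4,19,
  3]], B 6 [L [14,9,3,20,119], L [14,9,12], L [14,93,10,20], L [14,38,3,20], L [4,14,
  3,20]], B 6 [L [2,9,33], L [2,9,12], L [2,93,33,148], L [38,2,33], L [4,2,33]]],
  B 22 [B 16 [L [6,58,27,3], L [6,58,41,3], L [6,58,152,3], L [6,2,7]], B 16 [L [19,6,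
  3], L [19,6,3], L [6,14,213], L [6,2,78]], B 53 [L [16,6,3], L [19,6,3], L [6,11,
  69]]]]), (11,3, B 16 [B 192 [B 8 [L [54,9,15], L [54,9,15], L [54,51,126], L [54,98,61,
  51], L [4,54,15,100,3], L [4,158,55,98,60]], B 8 [L [28,9,3], L [28,9,3], L [28,51,
  3,61,211], L [30,28,3,61,211], L [4,28,3], L [4,28,3]], B 19 [L [6,119,3], L [14,6,
  50], L [6,175,3], L [6,33,69,85], L [27,6,3]], B 53 [L [22,4,3], L [19,6,3], L [22,
  4,3], L [6,27,3], L [19,6,3]], B 79 [L [6,141,3], L [19,6,3], L [53,6,3]]], B 192
  [B 8 [L [54,9,15], L [54,9,15], L [54,51,152,61], L [54,98,61,51], L [4,11,7,132],
  L [4,11,7,132]], B 8 [L [9,41,56,62,140], L [9,41,12,48], L [62,56,51,183], L [30,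
  62,35], L [4,62,3], L [4,62,3]], B 19 [L [6,11,50,119], L [14,6,50], L [6,119,3],
  L [6,11,50,21,114], L [6,41,50,94]], B 53 [L [22,4,3], L [19,6,3], L [22,4,3],
  L [6,41,94,12,113], L [19,6,3]], B 79 [L [6,141,3], L [19,6,3], L [53,6,3]]], B 192
  [B 8 [L [54,9,15], L [54,9,15], L [54,51,152,61], L [54,98,61,51], L [4,10,7,132],
  L [4,10,7,132]], B 8 [L [9,10,64,75,7,266], L [9,10,12,64,21], L [10,51,64,266,
  48,66], L [30,10,7,60,64,162], L [4,10,7,64,60], L [4,10,7,64,60]], B 14 [L [6,
  20,110,119], L [6,20,3], L [6,11,50,119], L [6,10,119], L [6,33,10,21,114], L [6,
  10,50,21,114]], B 53 [L [22,4,3], L [14,6,110], L [22,4,3], L [6,10,7,21,113],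
  L [14,6,207]], B 79 [L [6,141,3], L [14,6,59], L [53,6,3]]], B 192 [B 6 [L [2,9,36,
  75], L [2,9,12], L [2,51,74,11], L [2,30,7,60], L [4,2,7], L [4,2,7]], B 8 [L [2,9,
  36,75], L [2,9,12], L [2,51,39,75], L [2,30,7,60], L [4,2,7], L [4,2,7]], B 6
  [L [2,9,33], L [2,9,12], L [2,33,51], L [2,30,33], L [4,2,33], L [4,2,33]], B 22
  [L [6,2,7], L [6,2,78], L [6,2,7], L [6,2,7], L [2,4,7]], B 79 [L [6,2,7], L [6,2,
  59], L [6,2,7]]], B 6 [B 2 [L [54,9,95,255], L [54,9,15], L [54,9,15], L [34,9,45,
  74], L [34,9,37], L [11,9,95,149,237], L [109,9,15]], B 2 [L [54,9,95,21], L [54,9,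
  15], L [54,9,15], L [34,9,12], L [34,9,12], L [11,9,12,149], L [109,9,15]], B 2
  [L [54,51,29,149], L [54,51,15,255], L [54,51,126], L [34,51,45,74], L [34,51,47,
  243], L [11,237,51,149,66], L [109,68,21,15]], B 2 [L [54,98,29,149], L [54,98,77,
  149], L [54,98,126,51], L [34,30,45,237], L [34,30,47], L [11,30,237,149,60],
  L [109,68,21,15]], B 4 [L [2,155,60,7], L [2,155,15,104,237,59], L [2,155,15,149,
  29], L [2,155,15,195,74,99], L [2,51,60,50], L [2,98,60,7]], B 284 [L [2,155,15,
  75,99], L [2,171,110], L [2,60,50,7], L [2,98,60,7]]]]), (12,3, B 16 [B 172 [B 44
  [L [52,87,55], L [52,28,3], L [14,52,3,27], L [22,27,3], L [79,27,3]], B 44 [L [52,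
  87,55], L [52,28,3], L [14,52,3,27], L [22,27,3], L [79,27,3]], B 44 [L [52,87,55],
  L [52,28,3], L [14,52,3,27], L [22,27,3], L [79,27,3]], B 44 [L [4,87,153,60,69],
  L [4,28,3], L [14,4,153], L [22,4,3], L [79,27,3]], B 44 [L [4,87,55,98,60], L [4,
  28,3], L [14,4,59,3,27], L [14,4,3,27], L [79,27,3]]], B 172 [B 44 [L [52,87,55],
  L [52,41,56,256,12], L [14,52,3,20,12], L [22,41,12,94], L [79,114,3]], B 44
  [L [52,87,55], L [52,41,56,256,12], L [14,52,3,20,12], L [22,41,12,94], L [79,41,
  94,59]], B 44 [L [52,87,55], L [52,41,56,62,12], L [14,52,3,20,12], L [22,41,12,
  94], L [79,41,94,59]], B 44 [L [4,11,7,132], L [4,62,3], L [14,4,153], L [22,4,3],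
  L [79,41,94,59]], B 44 [L [4,11,7,132], L [4,62,3], L [14,4,59,3,205], L [14,4,3,
  7], L [79,41,94,59]]], B 172 [B 44 [L [52,87,55], L [52,10,64,12,215], L [14,52,3,
  20,12], L [22,10,106], L [79,10,114]], B 44 [L [52,87,55], L [52,10,64,12,215],
  L [14,52,3,20,12], L [22,10,106], L [79,10,71]], B 44 [L [52,87,55], L [52,10,64,
  12,215], L [14,52,3,20,12], L [22,10,106], L [79,10,106]], B 44 [L [4,10,7,132],
  L [4,10,7,64,60], L [14,4,153], L [22,4,3], L [79,10,106]], B 44 [L [4,10,7,132],
  L [4,10,7,64,60], L [14,4,59,3,20], L [14,4,214], L [79,10,106]]], B 172 [B 44
  [L [2,52,36], L [2,52,36], L [2,52,33], L [22,2,12], L [79,2,59]], B 44 [L [2,52,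
  36], L [2,52,36], L [2,52,33], L [22,2,12], L [79,2,59]], B 44 [L [2,52,36], L [2,52,
  36], L [2,52,33], L [22,2,12], L [79,2,59]], B 44 [L [2,4,7], L [2,4,7], L [2,4,33],
  L [22,2,12], L [79,2,59]], B 44 [L [2,4,7], L [2,4,7], L [2,4,33], L [2,4,7], L [79,
  2,59]]], B 172 [B 2 [L [52,87,95], L [52,87,95], L [52,87,55], L [34,52,45,164,12],
  L [34,52,37], L [11,52,95,125,215,264], L [87,52,55]], B 2 [L [52,87,95], L [52,87,
  95], L [52,87,55], L [34,52,45,164,12], L [34,52,37], L [11,52,95,125,264], L [87,
  52,55]], B 2 [L [52,87,95], L [52,87,95], L [52,87,55], L [34,52,45,164,12], L [34,
  52,37], L [11,52,95,60,162], L [87,52,55]], B 2 [L [4,29,59,87,60], L [4,87,153,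
  60,69], L [4,87,126,51], L [34,4,153], L [34,4,47], L [11,4,7,125,285], L [87,4,
  153,11,69]], B 2 [L [4,29,59,87,60], L [4,87,77,59,60], L [4,87,126,51], L [34,4,
  59,45,221], L [34,4,47], L [11,4,7,125,297], L [87,4,55,162,37]]]])]"

lemma refutes_12_3: "refutes clause_12 12 (Suc (Suc (Suc (Suc (Suc 0))))) trees_12_3"
  unfolding trees_12_3_def by (simp only: check_rules clauses_12 statuses_12)

definition trees_12_5 :: "(nat \<times> nat \<times> tree) list" where
  "trees_12_5 = [
  (6,5, B 116 [B 46 [B 81 [L [196,184,120,146], L [196,184,120,146], L [184,238,120,
  146]], B 173 [L [105,184,120,146], L [105,184,2,120]], B 108 [L [173,184,120,146]]],
  B 46 [B 81 [L [196,190,184], L [196,190,184], L [190,184,29]], B 173 [L [105,190,10],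
  L [105,190,2]], B 108 [L [173,190,10]]], B 46 [B 81 [L [201,196,167], L [201,196,167],
  L [201,124,238]], B 173 [L [201,105,35], L [201,105,35]], B 108 [L [173,201,35]]]]), (7,
  5, B 46 [B 196 [B 81 [L [4,124,156,71,146], L [4,124,156,71,146], L [4,124,187]], B 81
  [L [4,84,55], L [4,124,156,2], L [4,124,212]], B 80 [L [230,238,124], L [230,238,
  124], L [238,124,71], L [253,124,187]]], B 173 [B 4 [L [81,230,10], L [81,230,31],
  L [81,124,17], L [253,81,35]], B 81 [L [4,84,55], L [4,124,156,2], L [4,124,156,
  2]]], B 108 [B 173 [L [4,124,156,71,146], L [4,124,156,2]]]]), (8,5, B 46 [B 81 [B 43
  [L [82,160,31], L [82,160,31], L [82,118,61], L [82,67,61]], B 43 [L [131,160,31],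
  L [131,160,31], L [131,118,61], L [131,67,61]], B 43 [L [160,31,2], L [160,31,2],
  L [118,124,187,35], L [67,187,11,47]]], B 81 [B 43 [L [16,160,31], L [16,160,31],
  L [16,118,61], L [16,67,61]], B 43 [L [16,160,31], L [16,160,31], L [16,118,61],
  L [16,67,61]], B 263 [L [43,31,2], L [16,43,3], L [16,43,3]]], B 108 [B 43 [L [16,160,
  31], L [16,160,31], L [16,118,61], L [16,67,61]]]]), (9,5, B 46 [B 82 [B 81 [L [43,83,
  136,217], L [43,187,268], L [43,136,11], L [43,167,11,136], L [43,187,11,37]], B 18
  [L [131,140,83], L [131,140,122], L [131,12,2,196], L [131,93,83,2,67], L [38,131,
  83]], B 81 [L [43,2,36], L [43,2,36], L [43,2,36], L [43,2,136]], B 18 [L [231,217,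
  136], L [231,122,187], L [231,12,187], L [231,93,217], L [38,2,15,29]]], B 16 [B 18
  [L [81,86,3], L [81,86,3], L [81,173,3], L [81,182,277], L [38,28,3]], B 18 [L [81,
  86,3], L [81,86,3], L [81,173,3], L [81,182,35,67,41], L [38,62,3]], B 81 [L [43,10,
  136], L [43,10,64,188], L [43,10,136], L [43,203,136], L [43,203,64]], B 43 [L [81,2,
  230], L [81,2,174], L [81,2,174], L [81,2,182], L [38,2,39]]], B 108 [B 16 [L [43,27,
  3], L [43,136,94,41], L [43,10,136], L [43,2,136]]]]), (10,5, B 46 [B 6 [B 74 [L [9,83,
  170,11,17,140,75,286], L [91,9,83], L [91,9,83], L [91,9,83], L [9,2,170], L [9,2,
  15,77]], B 74 [L [9,83,12,125,275], L [91,9,12], L [91,9,12], L [91,9,83], L [9,2,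
  12], L [9,2,12]], B 254 [L [127,93,11], L [91,127,66], L [91,127,66], L [91,127,83],
  L [93,127,2], L [93,231,217]], B 254 [L [38,83,39,125,224], L [38,91,83], L [38,91,
  29], L [91,67,29], L [38,2,39], L [38,2,15,29]], B 4 [L [128,83,199,186], L [128,83,
  236,58], L [128,83,232,68], L [128,83,232,68], L [67,91,83]]], B 16 [B 6 [L [137,143,
  3,50], L [137,12,75,3,27], L [137,93,265], L [38,137,3], L [4,28,3]], B 137 [L [6,
  56,17,48], L [6,41,50,56], L [6,147,50], L [6,147,50], L [147,4,50,143,3], L [6,
  56,17,265]], B 6 [L [137,10,50,143], L [137,10,12,21,64], L [137,93,10], L [38,137,
  3], L [4,10,207,64,146]], B 6 [L [2,9,170], L [2,9,12], L [2,127,66], L [38,2,39],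
  L [4,2,39]]], B 16 [B 108 [L [6,27,3], L [19,6,3], L [19,6,3], L [19,4,3]], B 108
  [L [6,41,50,94], L [19,6,3], L [19,6,3], L [19,4,3]], B 108 [L [6,10,17], L [6,14,
  50], L [6,14,50], L [14,4,213,67]], B 108 [L [6,2,50], L [6,2,50], L [6,2,50], L [2,
  4,33]]]]), (11,5, B 16 [B 25 [B 8 [L [74,9,55,124], L [74,9,55,21], L [74,49,3,152],
  L [30,131,47,61], L [4,85,206,15], L [4,158,55,98,85]], B 8 [L [28,9,3], L [28,9,
  3], L [28,49,3], L [30,28,3,49], L [4,28,3], L [4,28,3]], B 19 [L [6,119,3], L [14,
  6,50], L [6,175,3], L [6,33,69,85], L [27,6,3]], B 53 [L [22,4,3], L [19,6,3],
  L [22,4,3], L [6,27,3], L [19,6,3]], B 115 [L [6,208,3], L [19,6,3], L [53,6,3]]],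
  B 25 [B 8 [L [74,9,55,124], L [74,9,55,21], L [74,49,3,11], L [30,11,49,142], L [4,
  11,39,132], L [4,11,39,132]], B 8 [L [9,41,56,62,140], L [9,41,12,48], L [137,56,
  66,250], L [30,137,35], L [4,62,3], L [4,62,3]], B 19 [L [6,11,17], L [14,6,50],
  L [6,119,3], L [6,11,17], L [6,41,50,94]], B 53 [L [22,4,3], L [19,6,3], L [22,4,
  3], L [6,41,94,17], L [19,6,3]], B 115 [L [6,208,3], L [19,6,3], L [53,6,3]]], B 25
  [B 8 [L [74,9,55,68], L [74,9,55,21], L [74,49,3,11], L [30,10,49,142], L [4,10,
  39,132], L [4,10,39,132]], B 8 [L [9,10,64,137,50], L [9,10,12,64,21], L [137,10,
  66,250], L [30,137,35], L [4,10,207,64,146], L [4,10,207,64,146]], B 14 [L [6,20,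
  17,119], L [6,20,3], L [6,11,17], L [6,10,17], L [6,33,10,17], L [6,10,17]], B 53
  [L [22,4,3], L [14,6,17], L [22,4,3], L [6,10,17], L [14,6,17]], B 115 [L [6,208,3],
  L [14,6,17], L [53,6,3]]], B 25 [B 6 [L [2,9,36,75], L [2,9,12], L [2,49,74,11],
  L [2,30,49,186], L [4,2,39], L [4,2,39]], B 8 [L [2,9,36,75], L [2,9,12], L [2,49,
  36,67], L [2,30,49,186], L [4,2,39], L [4,2,39]], B 6 [L [2,108,50], L [2,108,12],
  L [2,108,66], L [2,108,66], L [4,2,33], L [4,2,33]], B 22 [L [6,2,17], L [6,2,78],
  L [6,2,78], L [6,2,78], L [2,4,39]], B 115 [L [6,2,17], L [6,2,78], L [6,2,78]]],
  B 6 [B 2 [L [74,9,95,104,127,99], L [74,9,37,15], L [74,9,55,127], L [34,9,45,74],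
  L [34,9,37], L [168,11,50,75], L [109,9,15]], B 2 [L [74,9,95,12,21], L [74,9,37,
  12], L [74,9,55,21], L [34,9,12], L [34,9,12], L [168,11,12,125], L [109,9,15]], B 2
  [L [74,49,95,67,99,154], L [74,49,37,67,15], L [74,49,152,45], L [34,49,45,74],
  L [34,49,37,67], L [168,11,66,125], L [109,68,21,15]], B 2 [L [30,29,216,49,186],
  L [30,131,77,244], L [30,131,47,126], L [34,30,49,45,83], L [34,30,47], L [168,11,
  30], L [109,68,21,15]], B 4 [L [2,186,74,199,83], L [2,74,95,11,78,15,168], L [2,
  74,232,11], L [2,74,174,11,162], L [2,67,186,50], L [2,67,186,78]], B 4 [L [2,171,
  15,75,99], L [2,185,75,36], L [2,171,15,75,99], L [2,171,174], L [2,51,186,50],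
  L [2,98,186,78]]]]), (12,5, B 16 [B 172 [B 44 [L [70,3,114,21,85], L [70,3,27,92],
  L [14,92,3,27], L [22,27,3], L [22,27,3]], B 70 [L [44,92,3], L [44,92,3], L [44,3,
  27,71,85], L [44,92,3], L [44,92,3], L [44,3,27,131,12], L [44,51,126]], B 70
  [L [44,92,3], L [44,92,3], L [44,142,3,61], L [44,92,3], L [44,92,3], L [44,3,27,
  131,12], L [44,142,3,61]], B 44 [L [4,70,3], L [4,70,3], L [14,4,153], L [22,4,3],
  L [22,27,3]], B 44 [L [4,85,69,158,3], L [4,28,3], L [14,4,3,27], L [14,4,3,27],
  L [14,208,3,27]]], B 172 [B 44 [L [70,56,114,21,11], L [70,56,114,205], L [14,92,3,
  20,12], L [22,41,12,94], L [22,41,94,106]], B 44 [L [70,56,12,125,67], L [70,56,12,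
  41,67], L [14,92,3,20,12], L [22,41,12,94], L [22,41,94,106]], B 44 [L [70,56,12,
  125,67], L [70,56,12,41,67], L [14,92,3,20,12], L [22,41,12,94], L [22,41,94,
  106]], B 44 [L [4,70,3], L [4,70,3], L [14,4,153], L [22,4,3], L [22,41,94,106]],
  B 44 [L [4,11,36,158,17,3], L [4,62,3], L [14,4,3,20], L [14,4,3,20], L [14,208,
  3,20,205]]], B 172 [B 44 [L [70,10,12,114,21], L [70,10,12,114,64], L [14,92,3,20,
  12], L [22,10,106], L [22,10,106]], B 44 [L [70,10,12,71,162], L [70,10,12,71,162],
  L [14,92,3,20,12], L [22,10,106], L [22,10,106]], B 70 [L [44,92,3], L [44,92,3],
  L [44,10,232], L [44,92,3], L [44,92,3], L [44,10,106], L [44,10,21]], B 44 [L [4,70,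
  3], L [4,70,3], L [14,4,153], L [22,4,3], L [22,10,106]], B 44 [L [4,10,36,158,17,
  47], L [4,10,207,64,218], L [14,4,270,3,20], L [14,4,214], L [14,208,214]]], B 172
  [B 44 [L [2,70,12], L [2,70,12], L [2,108,12], L [22,2,12], L [22,2,106]], B 44 [L [2,
  70,12], L [2,70,12], L [2,108,12], L [22,2,12], L [22,2,106]], B 44 [L [2,70,12],
  L [2,70,12], L [2,108,12], L [22,2,12], L [22,2,106]], B 44 [L [2,4,70], L [2,4,70],
  L [2,4,70], L [22,2,12], L [22,2,106]], B 44 [L [2,4,15,202], L [2,4,15,36,218],
  L [2,4,33], L [2,4,33], L [2,208,218]]], B 172 [B 2 [L [70,29,12,215], L [70,12,114,
  104,37], L [70,12,114,104,37], L [34,92,45,164,12], L [34,92,37], L [168,11,12,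
  125], L [11,92,202,55,215]], B 288 [L [2,70,12], L [2,70,12], L [92,2,36], L [2,71,
  45,77,267,99], L [70,2,12], L [2,71,131,48,12], L [2,51,45,77,104]], B 70 [L [2,
  92,36], L [2,92,15,29], L [2,142,15,267,99,12], L [2,92,142,12], L [2,92,36],
  L [2,12,131,48,195], L [2,142,15,174,77,47]], B 2 [L [4,70,99,29], L [4,70,77,
  153], L [4,70,47,152], L [34,4,153], L [34,4,47], L [168,11,4], L [11,4,153,202]],
  B 4 [L [2,158,218,11,212,217], L [2,158,95,11,300], L [2,17,36,104,217], L [2,158,
  218,11,95], L [2,158,174,11,162], L [2,51,158,11], L [2,98,218,78]]]])]"

lemma refutes_12_5: "refutes clause_12 12 (Suc (Suc (Suc (Suc (Suc 0))))) trees_12_5"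
  unfolding trees_12_5_def by (simp only: check_rules clauses_12 statuses_12)

text \<open>The pair (12, 7) is absent: it is the mirror image of (12, 5). Likewise (12, 9) and (12,
  11) reduce to (12, 3) and (12, 1).\<close>

definition trees_12_7 :: "(nat \<times> nat \<times> tree) list" where
  "trees_12_7 = [
  (8,7, B 46 [B 82 [B 197 [L [43,31,219,169,95], L [43,31,219,169,37], L [43,167,219,
  118,31], L [43,85,71], L [43,11,71]], B 289 [L [43,197,31], L [43,197,31], L [43,197,
  31]]], B 263 [B 43 [L [197,143,31], L [197,143,31], L [118,197,39,219], L [67,197,39,
  301]]]]), (9,7, B 46 [B 82 [B 18 [L [86,73,170,143], L [86,73,122], L [73,12,219,39],
  L [67,73,39,47,169], L [38,73,88]], B 18 [L [86,73,170,143], L [86,73,122], L [73,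
  12,219,39], L [67,73,39,167,77], L [38,73,88]]], B 133 [B 290 [L [43,136,48], L [43,
  2,136], L [43,2,88], L [38,2,88]]]]), (10,7, B 46 [B 6 [B 128 [L [9,73,170], L [91,9,
  83], L [91,9,83], L [91,9,83], L [9,73,170]], B 128 [L [9,73,12], L [91,9,12], L [91,
  9,12], L [91,9,83], L [9,73,12]], B 128 [L [127,73,66], L [91,127,66], L [91,127,66],
  L [91,127,83], L [93,127,2]], B 128 [L [38,73,88], L [91,38,83], L [91,38,29], L [91,
  73,67], L [38,73,88]], B 128 [L [4,73,88], L [4,91,83], L [4,91,29], L [91,73,67],
  L [4,143,83]]], B 16 [B 137 [L [6,170,17,75,38], L [6,27,3], L [6,28,3], L [6,28,3],
  L [28,4,3]], B 137 [L [6,56,17,48], L [6,41,50,56], L [6,147,50], L [6,147,50],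
  L [147,4,50,143,3]], B 6 [L [133,10,50,143], L [133,10,106], L [133,93,10], L [133,
  38,3], L [4,10,88,64,146]], B 6 [L [2,9,170], L [2,9,12], L [2,127,66], L [38,2,
  88], L [4,2,88]]]]), (11,7, B 16 [B 25 [B 8 [L [9,85,69,154,15], L [9,12,85,100,69],
  L [49,85,100,152,69], L [30,85,49,142], L [4,85,88,206], L [4,85,206,15]], B 8
  [L [28,9,3], L [28,9,3], L [28,49,3], L [30,28,3,49], L [4,28,3], L [4,28,3]], B 19
  [L [6,119,3], L [14,6,50], L [6,119,3], L [6,85,69], L [27,6,3]], B 22 [L [6,27,3],
  L [19,6,3], L [53,6,3], L [53,6,3], L [53,4,3]], B 115 [L [6,100,27,3], L [19,6,3],
  L [53,6,3]]], B 25 [B 8 [L [9,11,39,100,75,50], L [9,11,12,100,114], L [49,11,39,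
  100,75,66], L [30,11,49,142], L [4,11,88,206], L [4,11,39,206]], B 8 [L [9,41,56,
  62,140], L [9,41,12,48], L [133,56,66,75,41], L [30,133,35], L [4,62,3], L [4,62,
  3]], B 19 [L [6,11,17], L [14,6,50], L [6,119,3], L [6,11,17], L [6,41,50,94]], B 22
  [L [6,41,94,17], L [19,6,3], L [53,6,3], L [53,6,3], L [53,4,3]], B 115 [L [6,100,
  41,3], L [19,6,3], L [53,6,3]]], B 25 [B 8 [L [9,10,39,100,75,50], L [9,10,12,100,
  114], L [10,49,39,100,75,66], L [30,10,49,142], L [4,10,88,206], L [4,10,39,206]],
  B 8 [L [9,10,64,133,50], L [9,10,12,64,21], L [133,10,66,75,162], L [30,133,35],
  L [4,10,88,64,146], L [4,10,207,64,146]], B 14 [L [6,20,17,119], L [6,20,3], L [6,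
  11,17], L [6,10,17], L [6,11,17], L [6,10,17]], B 53 [L [22,4,3], L [14,6,17], L [22,
  4,3], L [6,10,17], L [14,6,17]], B 115 [L [6,100,152,3], L [14,6,17], L [53,6,3]]],
  B 25 [B 6 [L [2,9,39,75], L [2,9,12], L [2,49,39,67], L [2,30,49,142], L [4,2,88],
  L [4,2,39]], B 8 [L [2,9,39,75], L [2,9,12], L [2,49,39,67], L [2,30,49,142], L [4,
  2,88], L [4,2,39]], B 6 [L [2,108,50], L [2,108,12], L [2,108,66], L [2,108,66],
  L [4,2,88], L [4,2,222]], B 22 [L [6,2,17], L [6,2,78], L [6,2,78], L [6,2,78],
  L [2,4,39]], B 115 [L [6,2,17], L [6,2,78], L [6,2,78]]], B 6 [B 2 [L [29,9,100,75,
  50,216,95,77], L [9,77,100,37,114,75], L [9,47,100,152,114,75], L [34,9,55,83,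
  75], L [34,9,37], L [168,11,50,75], L [109,9,15]], B 2 [L [29,9,12,154], L [9,12,77,
  100,114], L [9,12,100,47,114], L [34,9,12], L [34,9,12], L [168,11,12,75], L [109,
  9,15]], B 2 [L [29,67,75,216,66,95], L [49,169,100,37,66,75], L [49,100,152,66,
  75,37], L [34,49,66,127,83], L [34,49,37,67], L [168,11,66,75], L [109,68,21,15]],
  B 2 [L [30,29,216,49,95], L [30,77,216,15,49], L [30,216,95,224,47], L [34,30,49,
  55,83], L [34,30,47], L [168,11,30], L [109,68,21,15]], B 4 [L [2,199,15,100,83,
  169,258,47], L [2,39,169,100,78,83], L [2,199,50,39,262], L [2,174,169,47,287,
  83], L [2,67,39,224,47], L [2,67,199,78]], B 4 [L [2,171,15,75,193], L [2,185,75,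
  39], L [2,171,15,75,193], L [2,171,174], L [2,51,295], L [2,98,199,78]]]])]"

lemma refutes_12_7: "refutes clause_12 12 (Suc (Suc (Suc (Suc (Suc 0))))) trees_12_7"
  unfolding trees_12_7_def by (simp only: check_rules clauses_12 statuses_12)

definition trees_12_9 :: "(nat \<times> nat \<times> tree) list" where
  "trees_12_9 = [
  (10,9, B 46 [B 6 [B 134 [L [9,2,15,36,90], L [73,9,36,90], L [73,9,15,77], L [73,
  140,15,90,29], L [73,143,17,15,77]], B 9 [L [134,2,12], L [134,2,12], L [134,2,12],
  L [134,2,12], L [134,2,12], L [73,90,88,36], L [73,21,39,48,303]], B 134 [L [127,2,
  66], L [73,127,66], L [73,233,66], L [73,93,291], L [73,67,39,61,77,126]], B 134
  [L [38,2,88], L [38,73,88], L [38,73,15,29], L [38,73,88], L [38,73,88]], B 4 [L [73,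
  143,88,15,193], L [73,143,36,3,193], L [262,73,15,143,29], L [73,143,36,296],
  L [67,73,36,302]]]]), (11,9, B 16 [B 204 [B 8 [L [9,3,223,233,15], L [9,12,126,178,
  90], L [49,3,223,233,66], L [30,134,61,126], L [4,3,223,15], L [4,3,90,69,199,
  185]], B 8 [L [28,9,3], L [28,9,3], L [28,49,3], L [30,28,3,49], L [4,28,3], L [4,
  28,3]], B 8 [L [20,9,3,27], L [20,12,9,27], L [20,67,3,49,27], L [30,20,3,49,27],
  L [4,20,3], L [4,20,3]], B 8 [L [20,154,3,17,15], L [20,154,12], L [20,154,66],
  L [30,20,3,49,27], L [4,20,3], L [4,20,3]], B 115 [L [6,27,3], L [6,20,3], L [6,20,
  3]]], B 204 [B 8 [L [9,56,36,178,90,50], L [9,56,12,178,90], L [49,56,66,134,48,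
  195], L [30,134,35,61], L [4,56,88,178,305], L [4,56,90,106,185,48]], B 8 [L [9,41,
  56,62,140], L [9,41,12,48], L [133,56,66,90,41], L [30,133,35], L [4,62,3], L [4,
  62,3]], B 8 [L [20,56,9,205], L [20,56,9,205], L [20,67,35], L [30,20,35], L [4,20,
  3], L [4,20,3]], B 8 [L [20,154,3,17,15], L [20,154,12], L [20,154,66], L [30,20,
  35], L [4,20,3], L [4,20,3]], B 115 [L [6,41,17,56], L [6,20,3], L [6,20,3]]], B 204
  [B 8 [L [9,56,36,178,90,50], L [9,56,12,178,90], L [49,56,66,134,162,15], L [30,
  134,35,61], L [4,56,88,68,232,258], L [4,56,90,258,174]], B 8 [L [9,56,64,178,90,
  50], L [9,56,12,178,90], L [133,56,66,90,162], L [30,133,35], L [4,56,304], L [4,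
  56,207,90,162]], B 8 [L [20,56,9,133], L [20,56,9,133], L [20,67,35], L [30,20,35],
  L [4,20,3], L [4,20,3]], B 8 [L [20,154,3,17,15], L [20,154,12], L [20,154,66],
  L [30,20,35], L [4,20,3], L [4,20,3]], B 115 [L [6,56,17,283], L [6,20,3], L [6,20,
  3]]], B 204 [B 8 [L [2,9,36,90], L [2,9,12], L [2,49,36,67], L [2,30,49,36], L [4,2,
  88], L [4,2,39]], B 8 [L [2,9,36,90], L [2,9,12], L [2,49,36,67], L [2,30,49,36],
  L [4,2,88], L [4,2,39]], B 8 [L [2,9,222], L [2,9,12], L [2,49,222], L [2,30,49,
  142], L [4,2,88], L [4,2,222]], B 8 [L [2,9,222], L [2,9,12], L [2,49,222], L [2,30,
  49,36], L [4,2,88], L [4,2,39]], B 115 [L [6,2,17], L [6,2,78], L [6,2,78]]], B 6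
  [B 234 [L [9,212,223,233,55,69,134], L [9,109,15,36,154], L [2,9,39,90], L [2,9,
  36,90], L [2,114,36,90], L [2,95,90,50]], B 234 [L [9,12,126,178,90], L [9,109,12,
  15], L [2,9,12], L [2,9,12], L [2,114,12], L [2,12,90,36]], B 234 [L [134,66,233,
  223,21,15], L [109,49,15,178,90], L [2,49,39,67], L [2,49,36,67], L [2,169,66,
  50], L [2,169,66,50]], B 234 [L [30,134,39,126,49], L [30,109,49,142,15], L [2,30,
  49,142], L [2,30,49,36], L [2,30,169,50], L [2,30,169,50]], B 234 [L [4,223,39,
  212], L [4,48,88,109,69], L [2,4,88], L [2,4,39], L [2,4,39], L [2,4,39]], B 4
  [L [2,171,15,90,193], L [2,185,90,36], L [2,171,15,90,193], L [2,171,174], L [2,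
  51,298], L [2,98,199,78]]]])]"

lemma refutes_12_9: "refutes clause_12 12 (Suc (Suc (Suc (Suc (Suc 0))))) trees_12_9"
  unfolding trees_12_9_def by (simp only: check_rules clauses_12 statuses_12)

lemma keys_12: "set (keys 12) \<subseteq> set (map (\<lambda>x. (fst x, fst (snd x))) (trees_12_1 @ trees_12_3 @ trees_12_5 @ trees_12_7 @ trees_12_9))"
  unfolding trees_12_1_def trees_12_3_def trees_12_5_def trees_12_7_def trees_12_9_def list.map append.simps fst_conv snd_conv by code_simp

lemma refutes_12: "refutes clause_12 12 (Suc (Suc (Suc (Suc (Suc 0))))) (trees_12_1 @ trees_12_3 @ trees_12_5 @ trees_12_7 @ trees_12_9)"
  by (simp only: refutes_append refutes_12_1 refutes_12_3 refutes_12_5 refutes_12_7 refutes_12_9 simp_thms)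

section \<open>Decomposition of sharp polynomials\<close>

lemma frame_eq_if_few_terms:
  assumes "line_coeffs c d" "even d" "2 < d" "d \<le> 12" "2 * card {(i, j). c i j \<noteq> 0} \<le> d + 4"
    and "frame c d a m"
  shows "m = a"
proof -
  interpret line_coeffs c d by (rule assms(1))
  obtain k where k: "d = 2 * k" using assms(2) by auto
  then consider "d = 4" | "d = 6" | "d = 8" | "d = 10" | "d = 12"
    using assms(3,4) by fastforce
  then show ?thesis
  proof cases
    case 1
    have "card {(i, j). c i j \<noteq> 0} \<le> Suc 0 + 3" using assms(5) 1 by simp
    then show ?thesis
      using frame_eq_if_refutes[OF assms(6,2)] valid_4 refutes_4 keys_4 1
      unfolding clause_4_def by blast
  next
    case 2
    have "card {(i, j). c i j \<noteq> 0} \<le> Suc (Suc 0) + 3" using assms(5) 2 by simp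
    then show ?thesis
      using frame_eq_if_refutes[OF assms(6,2)] valid_6 refutes_6 keys_6 2
      unfolding clause_6_def by blast
  next
    case 3
    have "card {(i, j). c i j \<noteq> 0} \<le> Suc (Suc (Suc 0)) + 3" using assms(5) 3 by simp
    then show ?thesis
      using frame_eq_if_refutes[OF assms(6,2)] valid_8 refutes_8 keys_8 3
      unfolding clause_8_def by blast
  next
    case 4
    have "card {(i, j). c i j \<noteq> 0} \<le> Suc (Suc (Suc (Suc 0))) + 3" using assms(5) 4 by simp
    then show ?thesis
      using frame_eq_if_refutes[OF assms(6,2)] valid_10 refutes_10 keys_10 4
      unfolding clause_10_def by blast
  next
    case 5
    have "card {(i, j). c i j \<noteq> 0} \<le> Suc (Suc (Suc (Suc (Suc 0)))) + 3" using assms(5) 5 by simp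
    then show ?thesis
      using frame_eq_if_refutes[OF assms(6,2)] valid_12 refutes_12 keys_12 5
      unfolding clause_12_def by blast
  qed
qed

theorem theorem2p2:
  fixes d :: nat and f :: bipoly
  assumes "even d" and "2 < d" and "d \<le> 12"
    and "sharp d f"
  shows "\<exists>g\<in>{f, swap_vars f}. \<exists>a b :: nat. \<exists>p q p0 :: bipoly.
           odd a \<and> odd b \<and> a + b = d \<and> sharp a p \<and> sharp b q \<and>
           p = varX ^ a + varY ^ a + p0 \<and> total_degree p0 < a \<and>
           g = varX ^ a + varY ^ a * q + p0"
proof -
  have f: "f \<in> H2 d" using assms(4) by (simp add: sharp_def)
  obtain r where "r \<in> H2 d" "2 * num_terms r \<le> d + 4"
    using ex_H2_few_terms[OF assms(1-3)] by blast
  then have N: "2 * num_terms f \<le> d + 4" using assms(4) unfolding sharp_def by fastforce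
  interpret F: line_coeffs "coeff2 f" d using f assms(2) by (intro line_coeffs_if_H2) auto
  obtain c a m where c: "c \<in> {coeff2 f, \<lambda>i j. coeff2 f j i}" "frame c d a m"
    and corner: "quot c 0 (a - 1) = 1" and below: "\<And>i j. j < m \<Longrightarrow> a \<le> i + j \<Longrightarrow> quot c i j = 0"
    using F.frame_or_flip[OF assms(1)] N unfolding num_terms_def support2_def by blast
  obtain g where g: "g \<in> {f, swap_vars f}" "coeff2 g = c"
  proof -
    have "coeff2 (swap_vars f) = (\<lambda>i j. coeff2 f j i)"
      by (intro ext) (rule coeff2_swap_vars)
    then show ?thesis using c(1) that by blast
  qed
  have line: "line_coeffs c d" using c(1) F.line_coeffs_axioms F.flip by blast
  then interpret C: line_coeffs c d .
  have Nc: "2 * card {(i, j). c i j \<noteq> 0} \<le> d + 4"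
    using c(1) N F.card_support_flip unfolding num_terms_def support2_def by auto
  have "m = a" by (rule frame_eq_if_few_terms[OF line assms(1-3) Nc c(2)])
  note fr = c(2)[unfolded \<open>m = a\<close>] and below = below[unfolded \<open>m = a\<close>]
  have "odd a" "a \<le> d" and ca0: "c a 0 = 1" using fr by (auto simp: frame_def)
  \<comment> \<open>As m = a is odd and d is even, the shape with a = d and three monomials of
    degree d is ruled out here.\<close>
  then have lt: "a < d" and odd_b: "odd (d - a)" using assms(1) by (auto simp: le_less)
  have "0 < a" using \<open>odd a\<close> by (cases a) auto
  interpret W: line_coeffs "lower a c" a by (rule C.line_lower[OF fr lt corner below])
  interpret U: line_coeffs "upper a c" "d - a" by (rule C.line_upper[OF fr lt corner below])
  define p where "p = bipoly_of a (lower a c)"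
  define q where "q = bipoly_of (d - a) (upper a c)"
  have cp: "coeff2 p = lower a c" unfolding p_def by (rule W.coeff2_bipoly_of_line)
  have cq: "coeff2 q = upper a c" unfolding q_def by (rule U.coeff2_bipoly_of_line)
  have p: "p \<in> H2 a" unfolding p_def by (rule W.bipoly_of_H2)
  have q: "q \<in> H2 (d - a)" unfolding q_def by (rule U.bipoly_of_H2)
  have "num_terms p + num_terms q = card {(i, j). c i j \<noteq> 0} + 1"
    using C.card_support_split[OF fr lt corner below] by (simp add: num_terms_def support2_def cp cq)
  moreover have "a + 3 \<le> 2 * num_terms p" "(d - a) + 3 \<le> 2 * num_terms q"
    using num_terms_lower_bound[OF p \<open>0 < a\<close>] num_terms_lower_bound[OF q] lt by simp_all
  \<comment> \<open>The sum of 2 N(p) and 2 N(q) is at most d + 6, which is the sum of the two lower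
    bounds a + 3 and (d - a) + 3.\<close>
  ultimately have Np: "2 * num_terms p = a + 3" and Nq: "2 * num_terms q = (d - a) + 3"
    using Nc lt by linarith+
  have sharp_p: "sharp a p"
    unfolding sharp_def using p num_terms_lower_bound[of _ a] \<open>0 < a\<close> Np by fastforce
  have sharp_q: "sharp (d - a) q"
    unfolding sharp_def using q num_terms_lower_bound[of _ "d - a"] lt Nq by fastforce
  define p0 where "p0 = p - varX ^ a - varY ^ a"
  \<comment> \<open>With 2 N(p) = a + 3 the sign count admits only two monomials of degree a, so
    they are x^a and y^a, both with coefficient 1; subtracting them leaves degree below a.\<close>
  have "card (W.terms a) \<le> 2"
    using W.ends_bound Np by (simp add: num_terms_def support2_def cp)
  moreover have "{0, a} \<subseteq> W.terms a"
    using ca0 \<open>0 < a\<close> by (auto simp: W.terms_def lower_def)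
  ultimately have terms: "W.terms a = {0, a}"
    using card_seteq[OF W.finite_terms, of "{0, a}" a] \<open>0 < a\<close> by auto
  have "coeff2 p0 i j = 0" if "a \<le> i + j" for i j
  proof (cases "i + j = a")
    case True
    then have "j = a - i" "i \<le> a" by auto
    consider "i = 0" | "i = a" | "i \<noteq> 0" "i \<noteq> a" by blast
    then show ?thesis
    proof cases
      case 1
      then show ?thesis using \<open>j = a - i\<close> \<open>0 < a\<close> by (simp add: p0_def cp lower_def)
    next
      case 2
      then show ?thesis using \<open>j = a - i\<close> \<open>0 < a\<close> ca0 by (simp add: p0_def cp lower_def)
    next
      case 3
      then have "i \<notin> W.terms a" using terms by simp
      then have "lower a c i j = 0" using \<open>i \<le> a\<close> \<open>j = a - i\<close> by (simp add: W.terms_def)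
      then show ?thesis using 3 by (simp add: p0_def cp)
    qed
  next
    case False
    then have "lower a c i j = 0" using that by (intro W.degree_le) simp
    moreover have "\<not> (i = a \<and> j = 0)" "\<not> (i = 0 \<and> j = a)" using False by auto
    ultimately show ?thesis using \<open>0 < a\<close> by (simp add: p0_def cp)
  qed
  then have "total_degree p0 < a" using \<open>0 < a\<close> by (rule total_degree_less)
  moreover have "g = varX ^ a + varY ^ a * q + p0"
    by (rule bipoly_eqI) (use \<open>0 < a\<close> in \<open>auto simp: g(2) p0_def cp cq lower_def upper_def\<close>)
  moreover have "p = varX ^ a + varY ^ a + p0" by (simp add: p0_def)
  ultimately show ?thesis
    using g(1) \<open>odd a\<close> odd_b lt sharp_p sharp_q
    by (intro bexI[of _ g] exI[of _ a] exI[of _ "d - a"]) auto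
qed

end
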